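(* For each even $n$, let $z\in\{\pm1\}^n$ with $\langle z,\mathbf{1}\rangle=0$, let $0\leq q<p\leq 1$, and let $r\geq 4$ be an integer ($z$, $p$, $q$ and $r$ can depend on $n$). Let $A$ be the adjacency matrix of a random graph on $\{1,\dots,n\}$ drawn from the binary symmetric stochastic block model with label vector $z$: $A$ is symmetric with zero diagonal, and its entries $A_{ij}$, $i<j$, are independent Bernoulli random variables with $$\mathbf{P}(A_{ij}=1) = \begin{cases} p & \text{if } z_i = z_j,\\ q & \text{if } z_i\neq z_j.\end{cases}$$ Suppose that, for some $0<\epsilon\leq 1/12$ independent of $n$, $$\frac{n}{\log n}\left(\sqrt{p - \left(\frac{1}{r-1}+\epsilon\right)(p-q)} - \sqrt{q + \left(\frac{1}{r-1}+\epsilon\right)(p-q)}\right)^2\geq 2.$$ Then, with probability $\to 1$ as $n\to\infty$, with cost matrix $$C = A - \frac{1}{n^2}\langle A, \mathbf{1}\mathbf{1}^\top\rangle \mathbf{1}\mathbf{1}^\top \qquad\text{or}\qquad C = A - \frac{p+q}{2}\mathbf{1}\mathbf{1}^\top,$$ every second-order critical point $Y\in\mathbf{R}^{n\times r}$ of the problem $$\max_{Y \in \mathbf{R}^{n\times r}}~\langle C, YY^\top\rangle \quad \text{s.t. } \mathrm{ddiag}(YY^\top) = I_n$$ satisfies $Y = zu^\top$ for some unit-norm $u\in\mathbf{R}^r$.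
   Context: $\mathbf{1}$ is the all-ones vector in $\mathbf{R}^n$. $\langle \cdot,\cdot\rangle$ is the Euclidean inner product for vectors and the Frobenius inner product $\langle A,B\rangle = \mathrm{trace}(A^\top B)$ for matrices; $\mathrm{ddiag}\colon \mathbf{R}^{n\times n}\to\mathbf{R}^{n\times n}$ keeps the diagonal of a matrix and sets the off-diagonal entries to zero. The constraint $\mathrm{ddiag}(YY^\top)=I_n$ says that every row of $Y$ is a unit vector in $\mathbf{R}^r$, so the feasible set is a Riemannian manifold (a product of $n$ unit spheres embedded in $\mathbf{R}^r$). A second-order critical point is a feasible $Y$ at which the Riemannian gradient of the objective is zero and the Riemannian Hessian is negative semidefinite. Explicitly, for symmetric $C$, put $S(Y) = \mathrm{ddiag}(CYY^\top) - C$; a feasible $Y$ is second-order critical if and only if (i) $S(Y)Y = 0$, and (ii) $\langle S(Y), \dot Y \dot Y^\top\rangle \ge 0$ for every $\dot Y\in\mathbf{R}^{n\times r}$ such that $\mathrm{ddiag}(Y\dot Y^\top)=0$. *)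

theory Defs
  imports "HOL-Probability.Product_PMF" "Jordan_Normal_Form.Matrix"
begin

unbundle no vec_syntax and no inner_syntax

section \<open>Matrix notation\<close>

definition ones_vec :: "nat \<Rightarrow> real vec" where
  "ones_vec n = Matrix.vec n (\<lambda>_. 1)"

text \<open>\<^term>\<open>outer u v\<close> is the rank-one matrix $u v^T$.\<close>

definition outer :: "real vec \<Rightarrow> real vec \<Rightarrow> real mat" where
  "outer u v = Matrix.mat (dim_vec u) (dim_vec v) (\<lambda>(i, j). u $ i * v $ j)"

definition mat_trace :: "real mat \<Rightarrow> real" where
  "mat_trace A = (\<Sum>i<dim_row A. A $$ (i, i))"

definition frob_inner :: "real mat \<Rightarrow> real mat \<Rightarrow> real" where
  "frob_inner A B = mat_trace (A\<^sup>T * B)"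

definition ddiag :: "real mat \<Rightarrow> real mat" where
  "ddiag A = mat_diag (dim_row A) (\<lambda>i. A $$ (i, i))"


section \<open>Optimization over products of unit spheres\<close>

definition sphere_rows :: "nat \<Rightarrow> nat \<Rightarrow> real mat set" where
  "sphere_rows n r = {Y \<in> carrier_mat n r. ddiag (Y * Y\<^sup>T) = 1\<^sub>m n}"

definition tangent_space :: "real mat \<Rightarrow> real mat set" where
  "tangent_space Y =
     {V \<in> carrier_mat (dim_row Y) (dim_col Y).
        ddiag (Y * V\<^sup>T) = 0\<^sub>m (dim_row Y) (dim_row Y)}"

text \<open>For \<^term>\<open>Y \<in> sphere_rows n r\<close> this is the Frobenius-orthogonal projection onto
  \<^term>\<open>tangent_space Y\<close>; see \<open>tangent_proj_in_tangent_space\<close> and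
  \<open>tangent_proj_residual_orthogonal\<close> below.\<close>

definition tangent_proj :: "real mat \<Rightarrow> real mat \<Rightarrow> real mat" where
  "tangent_proj Y W = W - ddiag (W * Y\<^sup>T) * Y"

definition matrix_unit :: "nat \<Rightarrow> nat \<Rightarrow> nat \<times> nat \<Rightarrow> real mat" where
  "matrix_unit n r ij = Matrix.mat n r (\<lambda>kl. if kl = ij then 1 else 0)"

definition euclidean_grad :: "(real mat \<Rightarrow> real) \<Rightarrow> real mat \<Rightarrow> real mat" where
  "euclidean_grad f Y =
     (let n = dim_row Y; r = dim_col Y
      in Matrix.mat n r (\<lambda>ij. deriv (\<lambda>t. f (Y + t \<cdot>\<^sub>m matrix_unit n r ij)) 0))"

definition dir_deriv :: "(real mat \<Rightarrow> real mat) \<Rightarrow> real mat \<Rightarrow> real mat \<Rightarrow> real mat" where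
  "dir_deriv F Y V =
     Matrix.mat (dim_row Y) (dim_col Y) (\<lambda>ij. deriv (\<lambda>t. F (Y + t \<cdot>\<^sub>m V) $$ ij) 0)"

text \<open>The manifold carries the metric inherited from the ambient matrix space. Hence the
  Riemannian gradient is the projected Euclidean gradient, and the Riemannian Hessian is the
  projected ambient derivative of the gradient field. The formula for the gradient makes sense
  at all matrices and so provides the smooth extension of that field off the manifold that is
  differentiated here; the projected derivative along a tangent vector does not depend on the
  choice of the extension.\<close>

definition riem_grad :: "(real mat \<Rightarrow> real) \<Rightarrow> real mat \<Rightarrow> real mat" where
  "riem_grad f Y = tangent_proj Y (euclidean_grad f Y)"

definition riem_hess :: "(real mat \<Rightarrow> real) \<Rightarrow> real mat \<Rightarrow> real mat \<Rightarrow> real mat" where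
  "riem_hess f Y V = tangent_proj Y (dir_deriv (riem_grad f) Y V)"

definition second_order_critical ::
    "nat \<Rightarrow> nat \<Rightarrow> (real mat \<Rightarrow> real) \<Rightarrow> real mat \<Rightarrow> bool" where
  "second_order_critical n r f Y \<longleftrightarrow>
     Y \<in> sphere_rows n r \<and>
     riem_grad f Y = 0\<^sub>m n r \<and>
     (\<forall>V \<in> tangent_space Y. frob_inner V (riem_hess f Y V) \<le> 0)"

definition objective :: "real mat \<Rightarrow> real mat \<Rightarrow> real" where
  "objective C Y = frob_inner C (Y * Y\<^sup>T)"


section \<open>The binary symmetric stochastic block model\<close>

text \<open>The independent coins are indexed by the pairs \<open>(i, j)\<close> with \<open>i < j < n\<close>; vertices are
  numbered from 0.\<close>

definition adjacency_of_edges :: "nat \<Rightarrow> (nat \<times> nat \<Rightarrow> bool) \<Rightarrow> real mat" where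
  "adjacency_of_edges n e =
     Matrix.mat n n (\<lambda>(i, j). if i = j then 0 else of_bool (e (min i j, max i j)))"

definition sbm :: "nat \<Rightarrow> real vec \<Rightarrow> real \<Rightarrow> real \<Rightarrow> real mat pmf" where
  "sbm n z p q =
     map_pmf (adjacency_of_edges n)
       (Pi_pmf {(i, j). i < j \<and> j < n} False
          (\<lambda>(i, j). bernoulli_pmf (if z $ i = z $ j then p else q)))"

definition cost_empirical :: "nat \<Rightarrow> real mat \<Rightarrow> real mat" where
  "cost_empirical n A =
     (let J = outer (ones_vec n) (ones_vec n)
      in A - (1 / real n ^ 2 * frob_inner A J) \<cdot>\<^sub>m J)"

definition cost_population :: "nat \<Rightarrow> real \<Rightarrow> real \<Rightarrow> real mat \<Rightarrow> real mat" where
  "cost_population n p q A =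
     A - ((p + q) / 2) \<cdot>\<^sub>m outer (ones_vec n) (ones_vec n)"

text \<open>All second-order critical points have the form $z u^T$ with $u$ a unit vector.\<close>

definition benign_landscape :: "nat \<Rightarrow> nat \<Rightarrow> real vec \<Rightarrow> real mat \<Rightarrow> bool" where
  "benign_landscape n r z C \<longleftrightarrow>
     (\<forall>Y. second_order_critical n r (objective C) Y \<longrightarrow>
        (\<exists>u \<in> carrier_vec r. sqrt (u \<bullet> u) = 1 \<and> Y = outer z u))"


section \<open>Explicit form of second-order criticality\<close>

lemma mult_index:
  assumes "A \<in> carrier_mat n m" "B \<in> carrier_mat m k" "i < n" "j < k"
  shows "(A * B) $$ (i, j) = (\<Sum>l<m. A $$ (i, l) * B $$ (l, j) :: real)"
  using assms by (auto simp: scalar_prod_def atLeast0LessThan)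

lemma mult_transpose_index:
  assumes "A \<in> carrier_mat n m" "B \<in> carrier_mat k m" "i < n" "j < k"
  shows "(A * B\<^sup>T) $$ (i, j) = (\<Sum>l<m. A $$ (i, l) * B $$ (j, l) :: real)"
  using assms by (auto simp: scalar_prod_def atLeast0LessThan)

lemma ddiag_mult_index:
  assumes "A \<in> carrier_mat n n" "B \<in> carrier_mat n m" "i < n" "j < m"
  shows "(ddiag A * B) $$ (i, j) = A $$ (i, i) * B $$ (i, j)"
  using assms by (simp add: ddiag_def mat_diag_mult_left)

lemma ddiag_carrier [simp]: "A \<in> carrier_mat n m \<Longrightarrow> ddiag A \<in> carrier_mat n n"
  by (simp add: ddiag_def)

lemma frob_inner_sum:
  assumes "A \<in> carrier_mat n m" "B \<in> carrier_mat n m"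
  shows "frob_inner A B = (\<Sum>i<n. \<Sum>j<m. A $$ (i, j) * B $$ (i, j))"
proof -
  have "frob_inner A B = (\<Sum>j<m. \<Sum>i<n. A $$ (i, j) * B $$ (i, j))"
    using assms unfolding frob_inner_def mat_trace_def
    by (auto simp: scalar_prod_def atLeast0LessThan intro!: sum.cong)
  then show ?thesis by (subst sum.swap) simp
qed

lemma tangent_space_iff:
  assumes "Y \<in> carrier_mat n r"
  shows "V \<in> tangent_space Y \<longleftrightarrow>
    V \<in> carrier_mat n r \<and> (\<forall>i<n. (\<Sum>k<r. Y $$ (i, k) * V $$ (i, k)) = 0)"
proof (cases "V \<in> carrier_mat n r")
  case True
  have "ddiag (Y * V\<^sup>T) = 0\<^sub>m n n \<longleftrightarrow> (\<forall>i<n. (Y * V\<^sup>T) $$ (i, i) = 0)"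
    using assms True by (auto simp: ddiag_def mat_diag_def mat_eq_iff)
  then show ?thesis
    using assms True
    by (simp add: tangent_space_def mult_transpose_index[OF assms True] del: index_mult_mat)
next
  case False
  then show ?thesis using assms by (simp add: tangent_space_def)
qed

lemma sphere_rows_iff:
  "Y \<in> sphere_rows n r \<longleftrightarrow> Y \<in> carrier_mat n r \<and> (\<forall>i<n. (\<Sum>k<r. Y $$ (i, k) ^ 2) = 1)"
proof (cases "Y \<in> carrier_mat n r")
  case True
  have "ddiag (Y * Y\<^sup>T) = 1\<^sub>m n \<longleftrightarrow> (\<forall>i<n. (Y * Y\<^sup>T) $$ (i, i) = 1)"
    using True by (auto simp: ddiag_def mat_diag_def mat_eq_iff)
  then show ?thesis
    using True
    by (simp add: sphere_rows_def mult_transpose_index[OF True True] power2_eq_square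
        del: index_mult_mat)
next
  case False
  then show ?thesis by (simp add: sphere_rows_def)
qed

lemma tangent_proj_carrier [simp]:
  assumes "Y \<in> carrier_mat n r" "W \<in> carrier_mat n r"
  shows "tangent_proj Y W \<in> carrier_mat n r"
proof -
  have "W * Y\<^sup>T \<in> carrier_mat n n" using assms by simp
  then have "ddiag (W * Y\<^sup>T) * Y \<in> carrier_mat n r"
    using assms by (meson ddiag_carrier mult_carrier_mat)
  then show ?thesis unfolding tangent_proj_def by (rule minus_carrier_mat)
qed

lemma tangent_proj_index:
  assumes "Y \<in> carrier_mat n r" "W \<in> carrier_mat n r" "i < n" "k < r"
  shows "tangent_proj Y W $$ (i, k) =
    W $$ (i, k) - (\<Sum>l<r. W $$ (i, l) * Y $$ (i, l)) * Y $$ (i, k)"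
proof -
  have WY: "W * Y\<^sup>T \<in> carrier_mat n n" using assms by simp
  have dY: "ddiag (W * Y\<^sup>T) * Y \<in> carrier_mat n r"
    using assms ddiag_carrier[OF WY] by simp
  have "tangent_proj Y W $$ (i, k) = W $$ (i, k) - (ddiag (W * Y\<^sup>T) * Y) $$ (i, k)"
    unfolding tangent_proj_def using assms dY by (metis carrier_matD index_minus_mat(1))
  then show ?thesis
    unfolding ddiag_mult_index[OF WY assms(1,3,4)] mult_transpose_index[OF assms(2,1,3,3)] .
qed

lemma tangent_proj_in_tangent_space:
  assumes Y: "Y \<in> sphere_rows n r" and W: "W \<in> carrier_mat n r"
  shows "tangent_proj Y W \<in> tangent_space Y"
proof -
  have Yc: "Y \<in> carrier_mat n r" using Y by (simp add: sphere_rows_def)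
  have "(\<Sum>k<r. Y $$ (i, k) * tangent_proj Y W $$ (i, k)) = 0" if i: "i < n" for i
  proof -
    let ?s = "\<Sum>l<r. W $$ (i, l) * Y $$ (i, l)"
    have "(\<Sum>k<r. Y $$ (i, k) * tangent_proj Y W $$ (i, k))
        = (\<Sum>k<r. W $$ (i, k) * Y $$ (i, k) - ?s * Y $$ (i, k) ^ 2)"
      using i by (intro sum.cong)
        (simp_all add: tangent_proj_index[OF Yc W] algebra_simps power2_eq_square)
    also have "\<dots> = ?s - ?s * (\<Sum>k<r. Y $$ (i, k) ^ 2)"
      by (simp add: sum_subtractf sum_distrib_left)
    also have "\<dots> = 0" using Y i by (simp add: sphere_rows_iff)
    finally show ?thesis .
  qed
  then show ?thesis using Yc W by (simp add: tangent_space_iff[OF Yc])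
qed

lemma tangent_proj_frob_inner:
  assumes Y: "Y \<in> carrier_mat n r" and W: "W \<in> carrier_mat n r" and V: "V \<in> tangent_space Y"
  shows "frob_inner V (tangent_proj Y W) = frob_inner V W"
proof -
  have Vc: "V \<in> carrier_mat n r" and V0: "\<And>i. i < n \<Longrightarrow> (\<Sum>k<r. Y $$ (i, k) * V $$ (i, k)) = 0"
    using V by (simp_all add: tangent_space_iff[OF Y])
  have "(\<Sum>k<r. V $$ (i, k) * tangent_proj Y W $$ (i, k)) = (\<Sum>k<r. V $$ (i, k) * W $$ (i, k))"
    if i: "i < n" for i
  proof -
    let ?s = "\<Sum>l<r. W $$ (i, l) * Y $$ (i, l)"
    have "(\<Sum>k<r. V $$ (i, k) * tangent_proj Y W $$ (i, k))
        = (\<Sum>k<r. V $$ (i, k) * W $$ (i, k) - ?s * (Y $$ (i, k) * V $$ (i, k)))"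
      using i by (intro sum.cong) (simp_all add: tangent_proj_index[OF Y W] algebra_simps)
    also have "\<dots> = (\<Sum>k<r. V $$ (i, k) * W $$ (i, k)) - ?s * (\<Sum>k<r. Y $$ (i, k) * V $$ (i, k))"
      by (simp add: sum_subtractf sum_distrib_left)
    finally show ?thesis using V0[OF i] by simp
  qed
  then show ?thesis
    using Y W Vc by (simp add: frob_inner_sum[of _ n r])
qed

lemma tangent_proj_residual_orthogonal:
  assumes Y: "Y \<in> carrier_mat n r" and W: "W \<in> carrier_mat n r" and V: "V \<in> tangent_space Y"
  shows "frob_inner V (W - tangent_proj Y W) = 0"
proof -
  have Vc: "V \<in> carrier_mat n r" using V by (simp add: tangent_space_iff[OF Y])
  have P: "tangent_proj Y W \<in> carrier_mat n r" using Y W by simp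
  have "frob_inner V (W - tangent_proj Y W) = frob_inner V W - frob_inner V (tangent_proj Y W)"
    using Vc W P
    by (simp add: frob_inner_sum[of _ n r] minus_carrier_mat sum_subtractf[symmetric]
        right_diff_distrib)
  then show ?thesis using tangent_proj_frob_inner[OF assms] by simp
qed

lemma sum_mult_indicator:
  fixes f g :: "nat \<Rightarrow> real"
  assumes "a < n"
  shows "(\<Sum>j<n. f j * (if j = a then g j else 0)) = f a * g a"
proof -
  have "(\<Sum>j<n. f j * (if j = a then g j else 0)) = (\<Sum>j<n. if j = a then f j * g j else 0)"
    by (intro sum.cong) auto
  then show ?thesis using assms by simp
qed

lemma euclidean_grad_objective:
  assumes C: "C \<in> carrier_mat n n" and sym: "C\<^sup>T = C" and Y: "Y \<in> carrier_mat n r"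
  shows "euclidean_grad (objective C) Y = 2 \<cdot>\<^sub>m (C * Y)"
proof (rule eq_matI)
  fix a b assume "a < dim_row (2 \<cdot>\<^sub>m (C * Y))" "b < dim_col (2 \<cdot>\<^sub>m (C * Y))"
  then have a: "a < n" and b: "b < r" using C Y by auto
  define E where "E = matrix_unit n r (a, b)"
  have E: "E \<in> carrier_mat n r" by (simp add: E_def matrix_unit_def)
  have Eab: "E $$ (i, k) = (if i = a then if k = b then 1 else 0 else 0)" if "i < n" "k < r" for i k
    using that by (simp add: E_def matrix_unit_def)
  have YE: "(\<Sum>k<r. Y $$ (i, k) * E $$ (j, k)) = (if j = a then Y $$ (i, b) else 0)"
    if "j < n" for i j
  proof -
    have "(\<Sum>k<r. Y $$ (i, k) * E $$ (j, k)) =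
        (\<Sum>k<r. Y $$ (i, k) * (if k = b then (if j = a then 1 else 0) else 0))"
      using that by (intro sum.cong) (auto simp: Eab)
    then show ?thesis using b by (simp only: sum_mult_indicator) simp
  qed
  have EY: "(\<Sum>k<r. E $$ (i, k) * Y $$ (j, k)) = (if i = a then Y $$ (j, b) else 0)"
    if "i < n" for i j
    using YE[OF that, of j] by (simp only: mult.commute)
  have Csym: "C $$ (i, j) = C $$ (j, i)" if "i < n" "j < n" for i j
    using that C arg_cong[OF sym, of "\<lambda>M. M $$ (i, j)"] by simp
  have obj: "objective C (Y + t \<cdot>\<^sub>m E) = (\<Sum>i<n. \<Sum>j<n. C $$ (i, j) *
      (\<Sum>k<r. (Y $$ (i, k) + t * E $$ (i, k)) * (Y $$ (j, k) + t * E $$ (j, k))))" for t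
  proof -
    have Z: "Y + t \<cdot>\<^sub>m E \<in> carrier_mat n r" using Y E by simp
    have ZZ: "(Y + t \<cdot>\<^sub>m E) * (Y + t \<cdot>\<^sub>m E)\<^sup>T \<in> carrier_mat n n" using Z by simp
    show ?thesis unfolding objective_def frob_inner_sum[OF C ZZ]
      using Y E by (intro sum.cong refl) (simp add: mult_transpose_index[OF Z Z] del: index_mult_mat)
  qed
  have "((\<lambda>t. objective C (Y + t \<cdot>\<^sub>m E)) has_real_derivative
      (\<Sum>i<n. \<Sum>j<n. C $$ (i, j) *
        (\<Sum>k<r. Y $$ (i, k) * E $$ (j, k) + E $$ (i, k) * Y $$ (j, k)))) (at 0)"
    unfolding obj by (auto intro!: derivative_eq_intros sum.cong simp: algebra_simps)
  then have "deriv (\<lambda>t. objective C (Y + t \<cdot>\<^sub>m E)) 0 = (\<Sum>i<n. \<Sum>j<n. C $$ (i, j) *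
        (\<Sum>k<r. Y $$ (i, k) * E $$ (j, k) + E $$ (i, k) * Y $$ (j, k)))"
    by (rule DERIV_imp_deriv)
  also have "\<dots> = (\<Sum>i<n. \<Sum>j<n. C $$ (i, j) *
        ((if j = a then Y $$ (i, b) else 0) + (if i = a then Y $$ (j, b) else 0)))"
    by (intro sum.cong refl arg_cong2[where f = "(*)"]) (simp add: EY YE sum.distrib)
  also have "\<dots> = (\<Sum>i<n. C $$ (i, a) * Y $$ (i, b)) + (\<Sum>j<n. C $$ (a, j) * Y $$ (j, b))"
  proof -
    have s1: "(\<Sum>j<n. C $$ (i, j) * (if j = a then Y $$ (i, b) else 0)) = C $$ (i, a) * Y $$ (i, b)" for i
      using a by (simp only: sum_mult_indicator)
    have s2: "(\<Sum>i<n. C $$ (i, j) * (if i = a then Y $$ (j, b) else 0)) = C $$ (a, j) * Y $$ (j, b)" for j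
      using a by (simp only: sum_mult_indicator)
    have "(\<Sum>i<n. \<Sum>j<n. C $$ (i, j) * (if i = a then Y $$ (j, b) else 0))
        = (\<Sum>j<n. C $$ (a, j) * Y $$ (j, b))"
      by (subst sum.swap) (simp add: s2)
    then show ?thesis by (simp only: distrib_left sum.distrib s1)
  qed
  also have "\<dots> = 2 * (\<Sum>j<n. C $$ (a, j) * Y $$ (j, b))"
    using a Csym by simp
  also have "\<dots> = (2 \<cdot>\<^sub>m (C * Y)) $$ (a, b)"
    using a b C Y by (simp add: mult_index[OF C Y a b, symmetric])
  finally show "euclidean_grad (objective C) Y $$ (a, b) = (2 \<cdot>\<^sub>m (C * Y)) $$ (a, b)"
    using a b Y by (simp add: euclidean_grad_def E_def)
qed (use C Y in \<open>simp_all add: euclidean_grad_def\<close>)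

lemma riem_grad_objective_index:
  assumes C: "C \<in> carrier_mat n n" and sym: "C\<^sup>T = C" and Y: "Y \<in> carrier_mat n r"
    and ik: "i < n" "k < r"
  shows "riem_grad (objective C) Y $$ (i, k) =
    2 * (\<Sum>j<n. C $$ (i, j) * Y $$ (j, k))
    - 2 * (\<Sum>l<r. (\<Sum>j<n. C $$ (i, j) * Y $$ (j, l)) * Y $$ (i, l)) * Y $$ (i, k)"
proof -
  have W: "2 \<cdot>\<^sub>m (C * Y) \<in> carrier_mat n r" using C Y by simp
  have Wi: "(2 \<cdot>\<^sub>m (C * Y)) $$ (i, l) = 2 * (\<Sum>j<n. C $$ (i, j) * Y $$ (j, l))" if "l < r" for l
    using that ik C Y by (simp add: mult_index[OF C Y ik(1) that, symmetric])
  have "(\<Sum>l<r. (2 \<cdot>\<^sub>m (C * Y)) $$ (i, l) * Y $$ (i, l)) =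
      2 * (\<Sum>l<r. (\<Sum>j<n. C $$ (i, j) * Y $$ (j, l)) * Y $$ (i, l))"
    unfolding sum_distrib_left[of 2 _ "{..<r}"]
    by (intro sum.cong refl) (simp only: Wi lessThan_iff mult.assoc)
  then show ?thesis
    unfolding riem_grad_def euclidean_grad_objective[OF C sym Y] tangent_proj_index[OF Y W ik]
    by (simp only: Wi[OF ik(2)])
qed

lemma second_order_critical_objective_iff:
  assumes C: "C \<in> carrier_mat n n" and sym: "C\<^sup>T = C"
  defines "S \<equiv> \<lambda>Y. ddiag (C * Y * Y\<^sup>T) - C"
  shows "second_order_critical n r (objective C) Y \<longleftrightarrow>
    Y \<in> sphere_rows n r \<and> S Y * Y = 0\<^sub>m n r \<and>
    (\<forall>V \<in> carrier_mat n r. ddiag (Y * V\<^sup>T) = 0\<^sub>m n n \<longrightarrow> frob_inner (S Y) (V * V\<^sup>T) \<ge> 0)"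
proof (cases "Y \<in> sphere_rows n r")
  case True
  then have Y: "Y \<in> carrier_mat n r" by (simp add: sphere_rows_def)
  have CY: "C * Y \<in> carrier_mat n r" and CYY: "C * Y * Y\<^sup>T \<in> carrier_mat n n"
    using C Y by auto
  have Sc: "S Y \<in> carrier_mat n n" unfolding S_def using C by (simp add: minus_carrier_mat)
  define c where "c Z i k = (\<Sum>j<n. C $$ (i, j) * Z $$ (j, k))" for Z :: "real mat" and i k
  define s where "s i = (\<Sum>l<r. c Y i l * Y $$ (i, l))" for i
  have S_index: "S Y $$ (i, j) = (if i = j then s i else 0) - C $$ (i, j)" if ij: "i < n" "j < n" for i j
  proof -
    have "S Y $$ (i, j) = ddiag (C * Y * Y\<^sup>T) $$ (i, j) - C $$ (i, j)"
      unfolding S_def using ij C by (metis carrier_matD index_minus_mat(1))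
    also have "ddiag (C * Y * Y\<^sup>T) $$ (i, j) = (if i = j then (C * Y * Y\<^sup>T) $$ (i, i) else 0)"
      unfolding ddiag_def mat_diag_def using ij CYY by (simp del: index_mult_mat)
    also have "(C * Y * Y\<^sup>T) $$ (i, i) = s i"
      unfolding s_def c_def mult_transpose_index[OF CY Y ij(1) ij(1)]
      using ij by (intro sum.cong refl) (simp add: mult_index[OF C Y ij(1)] del: index_mult_mat)
    finally show ?thesis .
  qed
  have SZ_index: "(\<Sum>j<n. S Y $$ (i, j) * Z $$ (j, k)) = s i * Z $$ (i, k) - c Z i k"
    if i: "i < n" for Z i k
  proof -
    have "(\<Sum>j<n. S Y $$ (i, j) * Z $$ (j, k))
        = (\<Sum>j<n. (if i = j then s i * Z $$ (j, k) else 0) - C $$ (i, j) * Z $$ (j, k))"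
      using i by (intro sum.cong refl) (simp add: S_index left_diff_distrib)
    then show ?thesis using i by (simp add: sum_subtractf c_def)
  qed
  have rg: "riem_grad (objective C) Z $$ (i, k) =
      2 * c Z i k - 2 * (\<Sum>l<r. c Z i l * Z $$ (i, l)) * Z $$ (i, k)"
    if "Z \<in> carrier_mat n r" "i < n" "k < r" for Z i k
    using riem_grad_objective_index[OF C sym that] by (simp add: c_def)
  have rgc: "riem_grad (objective C) Y \<in> carrier_mat n r"
    unfolding riem_grad_def using Y by (simp add: euclidean_grad_def Let_def)
  have first: "riem_grad (objective C) Y = 0\<^sub>m n r \<longleftrightarrow> S Y * Y = 0\<^sub>m n r"
  proof -
    have "riem_grad (objective C) Y $$ (i, k) = - 2 * (S Y * Y) $$ (i, k)" if "i < n" "k < r" for i k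
      unfolding rg[OF Y that] mult_index[OF Sc Y that] SZ_index[OF that(1)]
      by (simp add: s_def)
    moreover have "S Y * Y \<in> carrier_mat n r" using Sc Y by simp
    ultimately show ?thesis using rgc
      by (auto simp: mat_eq_iff simp del: index_mult_mat)
  qed
  have second: "frob_inner V (riem_hess (objective C) Y V) = - 2 * frob_inner (S Y) (V * V\<^sup>T)"
    if V: "V \<in> tangent_space Y" for V
  proof -
    have Vc: "V \<in> carrier_mat n r" and V0: "\<And>i. i < n \<Longrightarrow> (\<Sum>k<r. Y $$ (i, k) * V $$ (i, k)) = 0"
      using V by (simp_all add: tangent_space_iff[OF Y])
    define W where "W = dir_deriv (riem_grad (objective C)) Y V"
    define d where "d i = (\<Sum>l<r. c V i l * Y $$ (i, l) + c Y i l * V $$ (i, l))" for i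
    have Wc: "W \<in> carrier_mat n r" unfolding W_def dir_deriv_def using Y by simp
    have W_index: "W $$ (i, k) = 2 * c V i k - 2 * d i * Y $$ (i, k) - 2 * s i * V $$ (i, k)"
      if ik: "i < n" "k < r" for i k
    proof -
      have c_line: "c (Y + t \<cdot>\<^sub>m V) i l = c Y i l + t * c V i l" if "l < r" for t l
      proof -
        have "c (Y + t \<cdot>\<^sub>m V) i l =
            (\<Sum>j<n. C $$ (i, j) * Y $$ (j, l) + t * (C $$ (i, j) * V $$ (j, l)))"
          unfolding c_def using that Y Vc by (intro sum.cong refl) (simp add: algebra_simps)
        then show ?thesis by (simp add: c_def sum.distrib sum_distrib_left)
      qed
      have line: "riem_grad (objective C) (Y + t \<cdot>\<^sub>m V) $$ (i, k) =
          2 * (c Y i k + t * c V i k)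
          - 2 * (\<Sum>l<r. (c Y i l + t * c V i l) * (Y $$ (i, l) + t * V $$ (i, l)))
              * (Y $$ (i, k) + t * V $$ (i, k))" for t
      proof -
        have Z: "Y + t \<cdot>\<^sub>m V \<in> carrier_mat n r" using Y Vc by simp
        have sm: "(\<Sum>l<r. c (Y + t \<cdot>\<^sub>m V) i l * (Y + t \<cdot>\<^sub>m V) $$ (i, l)) =
            (\<Sum>l<r. (c Y i l + t * c V i l) * (Y $$ (i, l) + t * V $$ (i, l)))"
          using ik Y Vc by (intro sum.cong refl) (simp add: c_line)
        show ?thesis unfolding rg[OF Z ik] sm c_line[OF ik(2)] using ik Y Vc by simp
      qed
      have D: "((\<lambda>t. \<Sum>l<r. (c Y i l + t * c V i l) * (Y $$ (i, l) + t * V $$ (i, l)))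
          has_real_derivative d i) (at 0)"
        unfolding d_def by (auto intro!: derivative_eq_intros sum.cong simp: algebra_simps)
      have "((\<lambda>t. riem_grad (objective C) (Y + t \<cdot>\<^sub>m V) $$ (i, k)) has_real_derivative
          2 * c V i k - 2 * d i * Y $$ (i, k) - 2 * s i * V $$ (i, k)) (at 0)"
        unfolding line by (rule derivative_eq_intros D refl)+ (simp add: s_def algebra_simps)
      then have "deriv (\<lambda>t. riem_grad (objective C) (Y + t \<cdot>\<^sub>m V) $$ (i, k)) 0 =
          2 * c V i k - 2 * d i * Y $$ (i, k) - 2 * s i * V $$ (i, k)"
        by (rule DERIV_imp_deriv)
      then show ?thesis using ik Y by (simp add: W_def dir_deriv_def)
    qed
    have row: "(\<Sum>k<r. V $$ (i, k) * W $$ (i, k)) =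
        - 2 * (\<Sum>k<r. (s i * V $$ (i, k) - c V i k) * V $$ (i, k))" if i: "i < n" for i
    proof -
      have "(\<Sum>k<r. V $$ (i, k) * W $$ (i, k)) =
          (\<Sum>k<r. - 2 * ((s i * V $$ (i, k) - c V i k) * V $$ (i, k))
             - 2 * d i * (Y $$ (i, k) * V $$ (i, k)))"
        using i by (intro sum.cong refl) (simp add: W_index algebra_simps)
      also have "\<dots> = - 2 * (\<Sum>k<r. (s i * V $$ (i, k) - c V i k) * V $$ (i, k))
          - 2 * d i * (\<Sum>k<r. Y $$ (i, k) * V $$ (i, k))"
        by (simp only: sum_subtractf sum_distrib_left)
      finally show ?thesis using V0[OF i] by simp
    qed
    have VV: "V * V\<^sup>T \<in> carrier_mat n n" using Vc by simp
    have SVV: "(\<Sum>j<n. S Y $$ (i, j) * (V * V\<^sup>T) $$ (i, j)) =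
        (\<Sum>k<r. (s i * V $$ (i, k) - c V i k) * V $$ (i, k))" if i: "i < n" for i
    proof -
      have "(\<Sum>j<n. S Y $$ (i, j) * (V * V\<^sup>T) $$ (i, j)) =
          (\<Sum>j<n. \<Sum>k<r. S Y $$ (i, j) * V $$ (j, k) * V $$ (i, k))"
        using i by (intro sum.cong refl)
          (simp add: mult_transpose_index[OF Vc Vc i] sum_distrib_left algebra_simps
            del: index_mult_mat)
      also have "\<dots> = (\<Sum>k<r. (\<Sum>j<n. S Y $$ (i, j) * V $$ (j, k)) * V $$ (i, k))"
        by (subst sum.swap) (simp only: sum_distrib_right)
      finally show ?thesis by (simp only: SZ_index[OF i])
    qed
    have "frob_inner V (riem_hess (objective C) Y V) = frob_inner V W"
      unfolding riem_hess_def W_def[symmetric] by (rule tangent_proj_frob_inner[OF Y Wc V])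
    also have "\<dots> = (\<Sum>i<n. - 2 * (\<Sum>k<r. (s i * V $$ (i, k) - c V i k) * V $$ (i, k)))"
      unfolding frob_inner_sum[OF Vc Wc] using row by simp
    also have "\<dots> = - 2 * frob_inner (S Y) (V * V\<^sup>T)"
      unfolding frob_inner_sum[OF Sc VV] using SVV
      by (simp only: sum_distrib_left[symmetric] cong: sum.cong) (simp add: SVV del: index_mult_mat)
    finally show ?thesis .
  qed
  have "(\<forall>V \<in> tangent_space Y. frob_inner V (riem_hess (objective C) Y V) \<le> 0) \<longleftrightarrow>
      (\<forall>V \<in> tangent_space Y. frob_inner (S Y) (V * V\<^sup>T) \<ge> 0)"
    using second by auto
  also have "\<dots> \<longleftrightarrow> (\<forall>V \<in> carrier_mat n r. ddiag (Y * V\<^sup>T) = 0\<^sub>m n n \<longrightarrow>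
      frob_inner (S Y) (V * V\<^sup>T) \<ge> 0)"
    using Y by (auto simp: tangent_space_def)
  finally show ?thesis using True first by (simp add: second_order_critical_def)
next
  case False
  then show ?thesis by (simp add: second_order_critical_def)
qed

end

theory Submission
  imports Defs "HOL-Library.Discrete_Functions"
begin

text \<open>
  Why the theorem holds. After multiplying row \<open>i\<close> of \<open>Y\<close> by the label \<open>z\<^sub>i\<close>, the claim becomes
  that all rows \<open>y\<^sub>i\<close> of a second-order critical point coincide. Write \<open>w\<^sub>i\<^sub>j\<close> for the inner
  product of \<open>y\<^sub>i\<close> and \<open>y\<^sub>j\<close>. Moving all rows at once towards a common coordinate direction and
  averaging the second-order condition over the \<open>r\<close> directions gives
  (\<open>second_order_critical_averaged\<close>) \<open>\<Sum>\<^sub>i\<^sub>j z\<^sub>i z\<^sub>j C\<^sub>i\<^sub>j (1 - w\<^sub>i\<^sub>j) (r - 2 - w\<^sub>i\<^sub>j) \<le> 0\<close>. The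
  weights are nonnegative, so if the matrix \<open>z\<^sub>i z\<^sub>j C\<^sub>i\<^sub>j\<close> were positive, every \<open>w\<^sub>i\<^sub>j\<close> would have
  to be 1.

  In the block model \<open>z\<^sub>i z\<^sub>j C\<^sub>i\<^sub>j = \<mu> + N\<^sub>i\<^sub>j\<close> off the diagonal, with signal \<open>\<mu> = (p - q) / 2\<close>
  and centred noise \<open>N\<close>. In terms of the deviations \<open>v\<^sub>i\<close> of the rows from their mean and
  \<open>b\<^sub>i = |v\<^sub>i|\<^sup>2\<close>, the noise enters the sum through its row sums, weighted by \<open>b\<^sub>i\<close> and \<open>b\<^sub>i\<^sup>2\<close>,
  and through bilinear forms that are bounded by the operator norm of \<open>N\<close> times \<open>\<Sum>\<^sub>i b\<^sub>i\<close>. The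
  signal contributes at least \<open>(r - 3) \<mu> n \<Sum>\<^sub>i b\<^sub>i + \<mu> n \<Sum>\<^sub>i b\<^sub>i\<^sup>2 / 2\<close> with the same weights as
  the row sums, so signal and row sums combine to the signed degrees of the graph. Hence, if all
  signed degrees are at least a fixed fraction of \<open>\<mu> n\<close> and the norm of \<open>N\<close> is a small fraction of
  \<open>\<mu> n\<close>, all \<open>b\<^sub>i\<close> vanish (\<open>landscape_rigidity\<close>).

  The signed degrees are handled by a Chernoff bound (\<open>signed_degree_tail\<close>). With
  \<open>p' = p - \<delta> (p - q)\<close>, \<open>q' = q + \<delta> (p - q)\<close> and exponential tilt \<open>ln (sqrt p' / sqrt q')\<close>, the
  exponent is \<open>n (sqrt p' - sqrt q')\<^sup>2 / 2\<close>, which the threshold makes at least \<open>ln n\<close>, plus a term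
  that is at least \<open>\<epsilon> ln n / 2\<close> because only the smaller fraction \<open>\<epsilon> / 2\<close> of \<open>\<mu> n\<close> is required
  (\<open>threshold_consequences\<close>). A union bound over the vertices then tends to 0.

  The threshold also forces \<open>\<mu> n\<close> to be at least \<open>sqrt (n p ln n) / 2\<close>, so it remains to bound the
  norm of the centred adjacency matrix by an arbitrarily small multiple of \<open>sqrt (n p ln n)\<close>
  (\<open>random_graph_norm\<close>). The proof follows Kahn and Szemeredi: by rounding, the bilinear form is
  maximal on a lattice ball with at most \<open>exp (6 n)\<close> points; index pairs with small products of
  entries are controlled by a Chernoff bound and a union bound over the ball; pairs with large
  products are controlled deterministically by the maximal degree and the edge counts between
  vertex sets. The spare factor \<open>sqrt (ln n)\<close> over the optimal bound keeps this last step short.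

  The empirical cost differs from the population cost by a multiple of the all-ones matrix that the
  same norm bound controls, and this multiple leaves the signed degrees unchanged since the labels
  are balanced.
\<close>

section \<open>Averaged second-order condition and rigidity\<close>

text \<open>The bound \<open>K\<close> on the operator norm is stated through bilinear forms with arbitrary test vectors,
  because products such as \<open>b\<^sub>i v\<^sub>i\<^sub>k\<close> are plugged in later on.\<close>

definition bilinear_norm_le :: "nat \<Rightarrow> (nat \<Rightarrow> nat \<Rightarrow> real) \<Rightarrow> real \<Rightarrow> bool" where
  "bilinear_norm_le n N K \<longleftrightarrow> (\<forall>u v. \<bar>\<Sum>i<n. \<Sum>j<n. N i j * u i * v j\<bar>
      \<le> K * L2_set u {..<n} * L2_set v {..<n})"

lemma bilinear_norm_leD:
  assumes "bilinear_norm_le n N K"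
  shows "\<bar>\<Sum>i<n. \<Sum>j<n. N i j * u i * v j\<bar> \<le> K * L2_set u {..<n} * L2_set v {..<n}"
  using assms unfolding bilinear_norm_le_def by blast

lemma L2_set_squared: "L2_set f A * L2_set f A = (\<Sum>i\<in>A. f i ^ 2)"
  by (simp add: L2_set_def sum_nonneg)

lemma bilinear_norm_le_quadratic:
  assumes "bilinear_norm_le n N K"
  shows "\<bar>\<Sum>i<n. \<Sum>j<n. N i j * u i * u j\<bar> \<le> K * (\<Sum>i<n. u i ^ 2)"
  using bilinear_norm_leD[OF assms, of u u] by (simp add: L2_set_squared mult.assoc)

lemma sum_swap3:
  "(\<Sum>i\<in>A. \<Sum>j\<in>B. \<Sum>k\<in>C. f i j k) = (\<Sum>k\<in>C. \<Sum>i\<in>A. \<Sum>j\<in>B. f i j k)"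
proof -
  have "(\<Sum>i\<in>A. \<Sum>j\<in>B. \<Sum>k\<in>C. f i j k) = (\<Sum>i\<in>A. \<Sum>k\<in>C. \<Sum>j\<in>B. f i j k)"
    by (intro sum.cong refl sum.swap)
  also have "\<dots> = (\<Sum>k\<in>C. \<Sum>i\<in>A. \<Sum>j\<in>B. f i j k)" by (rule sum.swap)
  finally show ?thesis .
qed

text \<open>This is the Frobenius inner product of the two orthogonal projections \<open>1 - y y\<^sup>T\<close> and
  \<open>1 - y' y'\<^sup>T\<close>.\<close>

lemma unit_rows_projector_trace:
  fixes y y' :: "nat \<Rightarrow> real"
  assumes "(\<Sum>k<r. y k ^ 2) = 1" "(\<Sum>k<r. y' k ^ 2) = 1"
  shows "(\<Sum>k<r. \<Sum>l<r. ((if k = l then 1 else 0) - y k * y l) * ((if k = l then 1 else 0) - y' k * y' l))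
    = real r - 2 + (\<Sum>k<r. y k * y' k) ^ 2"
proof -
  have "(\<Sum>k<r. \<Sum>l<r. ((if k = l then 1 else 0) - y k * y l) * ((if k = l then 1 else 0) - y' k * y' l))
    = (\<Sum>k<r. \<Sum>l<r. (if k = l then 1 - y k ^ 2 - y' k ^ 2 else 0) + (y k * y' k) * (y l * y' l))"
    by (intro sum.cong refl) (auto simp: power2_eq_square algebra_simps)
  also have "\<dots> = (\<Sum>k<r. 1 - y k ^ 2 - y' k ^ 2) + (\<Sum>k<r. y k * y' k) ^ 2"
    by (simp add: sum.distrib power2_eq_square sum_product)
  also have "(\<Sum>k<r. 1 - y k ^ 2 - y' k ^ 2) = real r - 2"
    using assms by (simp add: sum_subtractf)
  finally show ?thesis .
qed

text \<open>The test directions are \<open>V\<^sub>i = z\<^sub>i (e\<^sub>k - y\<^sub>i\<^sub>k y\<^sub>i)\<close> for \<open>k < r\<close>, the tangential parts of one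
  and the same coordinate direction at all rows. Their Gram matrices add up to the traces computed
  in \<open>unit_rows_projector_trace\<close>, and \<open>(r - 1) w - (r - 2) - w\<^sup>2 = - (1 - w) (r - 2 - w)\<close>.\<close>

lemma second_order_critical_averaged:
  fixes z :: "nat \<Rightarrow> real"
  assumes C: "C \<in> carrier_mat n n" and sym: "C\<^sup>T = C"
    and crit: "second_order_critical n r (objective C) Y"
    and z: "\<And>i. i < n \<Longrightarrow> z i * z i = 1"
  defines "w \<equiv> \<lambda>i j. \<Sum>k<r. (z i * Y $$ (i, k)) * (z j * Y $$ (j, k))"
  shows "(\<Sum>i<n. \<Sum>j<n. z i * z j * C $$ (i, j) * ((1 - w i j) * (real r - 2 - w i j))) \<le> 0"
proof -
  define S where "S = ddiag (C * Y * Y\<^sup>T) - C"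
  define s where "s i = (\<Sum>j<n. C $$ (i, j) * (z i * z j * w i j))" for i
  define y where "y i k = z i * Y $$ (i, k)" for i k
  define V where "V k = Matrix.mat n r (\<lambda>(i, l). z i * ((if k = l then 1 else 0) - y i k * y i l))" for k
  have Ysph: "Y \<in> sphere_rows n r"
    and pos: "\<And>V. V \<in> carrier_mat n r \<Longrightarrow> ddiag (Y * V\<^sup>T) = 0\<^sub>m n n \<Longrightarrow> frob_inner S (V * V\<^sup>T) \<ge> 0"
    using crit second_order_critical_objective_iff[OF C sym, of r Y] by (auto simp: S_def)
  have Y: "Y \<in> carrier_mat n r" using Ysph by (simp add: sphere_rows_iff)
  have zz: "z i * (z i * a) = a" if "i < n" for i a
    using z[OF that] by (metis mult.assoc mult_1)
  have unit: "(\<Sum>k<r. y i k ^ 2) = 1" if "i < n" for i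
    using Ysph that z[OF that]
    by (simp add: sphere_rows_iff y_def power_mult_distrib power2_eq_square zz mult.assoc
        mult.left_commute)
  have CY: "C * Y \<in> carrier_mat n r" and CYY: "C * Y * Y\<^sup>T \<in> carrier_mat n n"
    using C Y by auto
  have Sc: "S \<in> carrier_mat n n" unfolding S_def using C by (simp add: minus_carrier_mat)
  have x: "z i * z j * w i j = (\<Sum>k<r. Y $$ (i, k) * Y $$ (j, k))" if "i < n" "j < n" for i j
    unfolding w_def sum_distrib_left using that
    by (intro sum.cong refl) (metis (no_types, opaque_lifting) mult.assoc mult.left_commute zz)
  have S_index: "S $$ (i, j) = (if i = j then s i else 0) - C $$ (i, j)" if ij: "i < n" "j < n" for i j
  proof -
    have "S $$ (i, j) = ddiag (C * Y * Y\<^sup>T) $$ (i, j) - C $$ (i, j)"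
      unfolding S_def using ij C by (metis carrier_matD index_minus_mat(1))
    also have "ddiag (C * Y * Y\<^sup>T) $$ (i, j) = (if i = j then (C * Y * Y\<^sup>T) $$ (i, i) else 0)"
      unfolding ddiag_def mat_diag_def using ij CYY by (simp del: index_mult_mat)
    also have "(C * Y * Y\<^sup>T) $$ (i, i) = (\<Sum>l<r. \<Sum>j<n. C $$ (i, j) * Y $$ (j, l) * Y $$ (i, l))"
      unfolding mult_transpose_index[OF CY Y ij(1) ij(1)]
      using ij by (intro sum.cong refl)
        (simp add: mult_index[OF C Y ij(1)] sum_distrib_right del: index_mult_mat)
    also have "\<dots> = (\<Sum>j<n. \<Sum>l<r. C $$ (i, j) * Y $$ (j, l) * Y $$ (i, l))"
      by (rule sum.swap)
    also have "\<dots> = s i"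
      unfolding s_def using ij
      by (intro sum.cong refl, simp only: x[OF ij(1)] lessThan_iff sum_distrib_left)
        (intro sum.cong refl, simp only: ac_simps)
    finally show ?thesis .
  qed
  have Vc: "V k \<in> carrier_mat n r" for k by (simp add: V_def)
  have VV: "V k * (V k)\<^sup>T \<in> carrier_mat n n" for k using Vc[of k] by simp
  have "V k \<in> tangent_space Y" if k: "k < r" for k
  proof -
    have "(\<Sum>l<r. Y $$ (i, l) * V k $$ (i, l)) = 0" if i: "i < n" for i
    proof -
      have "(\<Sum>l<r. Y $$ (i, l) * V k $$ (i, l)) =
          (\<Sum>l<r. (if k = l then y i l else 0) - y i k * y i l ^ 2)"
        using i by (intro sum.cong refl)
          (auto simp: V_def y_def power2_eq_square algebra_simps)
      then show ?thesis
        using k i by (simp add: sum_subtractf unit sum_distrib_left[symmetric])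
    qed
    then show ?thesis by (simp add: tangent_space_iff[OF Y] Vc)
  qed
  then have "frob_inner S (V k * (V k)\<^sup>T) \<ge> 0" if "k < r" for k
    using pos[OF Vc] that Y by (simp add: tangent_space_def)
  then have "0 \<le> (\<Sum>k<r. frob_inner S (V k * (V k)\<^sup>T))"
    by (intro sum_nonneg) simp
  also have "\<dots> = (\<Sum>k<r. \<Sum>i<n. \<Sum>j<n. S $$ (i, j) * (\<Sum>l<r. V k $$ (i, l) * V k $$ (j, l)))"
    by (intro sum.cong refl)
      (simp add: frob_inner_sum[OF Sc VV] mult_transpose_index[OF Vc Vc] del: index_mult_mat)
  also have "\<dots> = (\<Sum>i<n. \<Sum>j<n. S $$ (i, j) * (\<Sum>k<r. \<Sum>l<r. V k $$ (i, l) * V k $$ (j, l)))"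
    unfolding sum_distrib_left[of _ _ "{..<r}"] by (rule sum_swap3[symmetric])
  also have "\<dots> = (\<Sum>i<n. \<Sum>j<n. S $$ (i, j) * (z i * z j * (real r - 2 + w i j ^ 2)))"
  proof (intro sum.cong refl arg_cong2[where f = "(*)"])
    fix i j assume "i \<in> {..<n}" "j \<in> {..<n}"
    then have ij: "i < n" "j < n" by auto
    have "(\<Sum>k<r. \<Sum>l<r. V k $$ (i, l) * V k $$ (j, l)) = z i * z j *
       (\<Sum>k<r. \<Sum>l<r. ((if k = l then 1 else 0) - y i k * y i l)
           * ((if k = l then 1 else 0) - y j k * y j l))"
      unfolding sum_distrib_left using ij by (intro sum.cong refl) (simp add: V_def)
    then show "(\<Sum>k<r. \<Sum>l<r. V k $$ (i, l) * V k $$ (j, l)) = z i * z j * (real r - 2 + w i j ^ 2)"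
      using unit_rows_projector_trace[OF unit unit, OF ij] by (simp add: w_def y_def)
  qed
  also have "\<dots> = (\<Sum>i<n. \<Sum>j<n. (if i = j then s i * (real r - 1) else 0)
      - z i * z j * C $$ (i, j) * (real r - 2 + w i j ^ 2))"
  proof (intro sum.cong refl)
    fix i j assume "i \<in> {..<n}" "j \<in> {..<n}"
    then have ij: "i < n" "j < n" by auto
    have "w i i = 1" if "i < n" for i
      using unit[OF that] by (simp add: w_def y_def power2_eq_square)
    then show "S $$ (i, j) * (z i * z j * (real r - 2 + w i j ^ 2)) =
       (if i = j then s i * (real r - 1) else 0) - z i * z j * C $$ (i, j) * (real r - 2 + w i j ^ 2)"
      using ij z by (auto simp: S_index algebra_simps)
  qed
  also have "\<dots> = (\<Sum>i<n. s i * (real r - 1))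
      - (\<Sum>i<n. \<Sum>j<n. z i * z j * C $$ (i, j) * (real r - 2 + w i j ^ 2))"
    by (simp add: sum_subtractf)
  also have "\<dots> = - (\<Sum>i<n. \<Sum>j<n. z i * z j * C $$ (i, j) * ((1 - w i j) * (real r - 2 - w i j)))"
    unfolding s_def sum_distrib_right sum_subtractf[symmetric] sum_negf[symmetric]
    by (intro sum.cong refl) (simp add: algebra_simps power2_eq_square)
  finally show ?thesis by simp
qed


lemma sum_rank_one_rows:
  fixes f g :: "nat \<Rightarrow> real"
  shows "(\<Sum>i<n. \<Sum>j<n. f i + g j) = real n * (\<Sum>i<n. f i) + real n * (\<Sum>j<n. g j)"
  by (simp add: sum.distrib sum_distrib_left)

text \<open>With \<open>D\<^sub>i\<^sub>j = 1 - w\<^sub>i\<^sub>j\<close> the weight is \<open>(r - 3) D + D\<^sup>2\<close>, and \<open>D\<^sub>i\<^sub>j = (b\<^sub>i + b\<^sub>j) / 2 - g\<^sub>i\<^sub>j\<close>,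
  where \<open>g\<close> is the Gram matrix of the centred rows \<open>v\<^sub>i\<close> and \<open>b\<close> its diagonal. Against the constant
  \<open>\<mu>\<close> every term linear in \<open>g\<close> sums to 0. Against \<open>N\<close> the terms without \<open>g\<close> and without \<open>b\<^sub>i b\<^sub>j\<close>
  only see the row sums, and each remaining term is a bilinear form of \<open>N\<close> with total at most a
  constant times \<open>K \<Sum>\<^sub>i b\<^sub>i\<close>, as \<open>b\<^sub>i \<le> 4\<close>. The weights \<open>(r - 3) b\<^sub>i + b\<^sub>i\<^sup>2 / 2\<close> of the row sums
  are nonnegative, which is why lower bounds on the row sums suffice. The constant 15 comes from
  the total noise \<open>(r + 11) K \<le> 15 (r - 3) K\<close> for \<open>r \<ge> 4\<close>.\<close>

lemma landscape_rigidity: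
  fixes y :: "nat \<Rightarrow> nat \<Rightarrow> real" and B N :: "nat \<Rightarrow> nat \<Rightarrow> real"
  assumes unit: "\<And>i. i < n \<Longrightarrow> (\<Sum>k<r. y i k ^ 2) = 1"
    and r: "4 \<le> r" and mu: "0 < \<mu>" and K: "15 * K < \<eta> * \<mu> * real n" "0 \<le> K"
    and B: "\<And>i j. i < n \<Longrightarrow> j < n \<Longrightarrow> i \<noteq> j \<Longrightarrow> B i j = \<mu> + N i j"
    and N_sym: "\<And>i j. i < n \<Longrightarrow> j < n \<Longrightarrow> N i j = N j i"
    and N_norm: "bilinear_norm_le n N K"
    and N_rows: "\<And>i. i < n \<Longrightarrow> \<eta> * \<mu> * real n \<le> \<mu> * real n + (\<Sum>j<n. N i j)"
  defines "w \<equiv> \<lambda>i j. \<Sum>k<r. y i k * y j k"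
  assumes crit: "(\<Sum>i<n. \<Sum>j<n. B i j * ((1 - w i j) * (real r - 2 - w i j))) \<le> 0"
    and ik: "i < n" "k < r"
  shows "y i k = (\<Sum>j<n. y j k) / real n"
proof -
  define m where "m k = (\<Sum>j<n. y j k) / real n" for k
  define v where "v i k = y i k - m k" for i k
  define b where "b i = (\<Sum>k<r. v i k ^ 2)" for i
  define g where "g i j = (\<Sum>k<r. v i k * v j k)" for i j
  define \<nu> where "\<nu> i = (\<Sum>j<n. N i j)" for i
  define D where "D i j = 1 - w i j" for i j
  define Sb where "Sb = (\<Sum>i<n. b i)"
  define Sbb where "Sbb = (\<Sum>i<n. b i ^ 2)"
  have n: "0 < n" using ik by simp
  have b0: "0 \<le> b i" for i unfolding b_def by (intro sum_nonneg) simp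
  have Sb0: "0 \<le> Sb" unfolding Sb_def by (intro sum_nonneg b0)
  have sum_v: "(\<Sum>j<n. v j k) = 0" for k
    using n by (simp add: v_def m_def sum_subtractf)
  have sum_g: "(\<Sum>j<n. g i j) = 0" for i
    unfolding g_def by (subst sum.swap) (simp add: sum_distrib_left[symmetric] sum_v)
  have g_sym: "g i j = g j i" for i j by (simp add: g_def mult.commute)
  have D_eq: "D i j = (b i + b j) / 2 - g i j" if "i < n" "j < n" for i j
  proof -
    have "2 * D i j = (\<Sum>k<r. y i k ^ 2 + y j k ^ 2 - 2 * (y i k * y j k))"
      using that by (simp add: D_def w_def unit sum.distrib sum_subtractf sum_distrib_left)
    also have "\<dots> = (\<Sum>k<r. v i k ^ 2 + v j k ^ 2 - 2 * (v i k * v j k))"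
      by (intro sum.cong refl) (simp add: v_def power2_eq_square algebra_simps)
    also have "\<dots> = b i + b j - 2 * g i j"
      by (simp add: b_def g_def sum.distrib sum_subtractf sum_distrib_left)
    finally show ?thesis by argo
  qed
  have D_le: "D i j \<le> 2" if "i < n" "j < n" for i j
  proof -
    have "0 \<le> (\<Sum>k<r. (y i k + y j k) ^ 2)" by (intro sum_nonneg) simp
    also have "\<dots> = (\<Sum>k<r. y i k ^ 2 + y j k ^ 2 + 2 * (y i k * y j k))"
      by (intro sum.cong refl) (simp add: power2_eq_square algebra_simps)
    also have "\<dots> = 4 - 2 * D i j"
      using that by (simp add: D_def w_def unit sum.distrib sum_distrib_left)
    finally show ?thesis by simp
  qed
  \<comment> \<open>averaging \<open>D i j \<le> 2\<close> over \<open>j\<close> removes \<open>g\<close> and leaves \<open>b i\<close> plus a nonnegative mean\<close>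
  have b4: "b i \<le> 4" if i: "i < n" for i
  proof -
    have "(\<Sum>j<n. D i j) = (\<Sum>j<n. b i / 2 + b j / 2 - g i j)"
      using i by (intro sum.cong refl) (simp add: D_eq add_divide_distrib)
    also have "\<dots> = real n * (b i / 2) + Sb / 2"
      by (simp add: sum.distrib sum_subtractf sum_g Sb_def sum_divide_distrib)
    finally have "real n * (b i / 2) + Sb / 2 \<le> (\<Sum>j<n. 2)"
      using D_le[OF i] by (metis sum_mono lessThan_iff)
    then have "real n * (b i / 2) \<le> real n * 2" using Sb0 by simp
    then show ?thesis using n by simp
  qed
  have bb: "b i ^ 2 \<le> 4 * b i" if "i < n" for i
    using mult_right_mono[OF b4[OF that] b0[of i]] by (simp add: power2_eq_square)
  have Sbb: "Sbb \<le> 4 * Sb"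
    unfolding Sbb_def Sb_def sum_distrib_left by (intro sum_mono) (simp add: bb)
  have sum_g2: "(\<Sum>i<n. \<Sum>j<n. b i * g i j) = 0" "(\<Sum>i<n. \<Sum>j<n. b j * g i j) = 0"
    subgoal by (simp add: sum_distrib_left[symmetric] sum_g)
    subgoal by (subst sum.swap, subst g_sym) (simp add: sum_distrib_left[symmetric] sum_g)
    done
  have D_sum: "(\<Sum>i<n. \<Sum>j<n. D i j) = real n * Sb"
  proof -
    have "(\<Sum>i<n. \<Sum>j<n. D i j) = (\<Sum>i<n. \<Sum>j<n. (b i / 2 + b j / 2) - g i j)"
      by (intro sum.cong refl) (simp add: D_eq add_divide_distrib)
    also have "\<dots> = real n * Sb"
      by (simp only: sum_subtractf sum_g sum_rank_one_rows)
        (simp add: Sb_def sum_divide_distrib[symmetric] field_simps)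
    finally show ?thesis .
  qed
  have D_sum2: "(\<Sum>i<n. \<Sum>j<n. D i j ^ 2) \<ge> real n * Sbb / 2"
  proof -
    have "(\<Sum>i<n. \<Sum>j<n. D i j ^ 2) = (\<Sum>i<n. \<Sum>j<n. (b i ^ 2 / 4 + b j ^ 2 / 4)
        + b i * b j / 2 - b i * g i j - b j * g i j + g i j ^ 2)"
      by (intro sum.cong refl) (simp add: D_eq power2_eq_square field_simps)
    also have "\<dots> = (\<Sum>i<n. \<Sum>j<n. b i ^ 2 / 4 + b j ^ 2 / 4) + (\<Sum>i<n. \<Sum>j<n. b i * b j / 2)
        + (\<Sum>i<n. \<Sum>j<n. g i j ^ 2)"
      by (simp only: sum.distrib sum_subtractf sum_g2)
    also have "(\<Sum>i<n. \<Sum>j<n. b i ^ 2 / 4 + b j ^ 2 / 4) = real n * Sbb / 2"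
      by (simp only: sum_rank_one_rows) (simp add: Sbb_def sum_divide_distrib[symmetric] field_simps)
    finally have *: "(\<Sum>i<n. \<Sum>j<n. D i j ^ 2) = real n * Sbb / 2
        + (\<Sum>i<n. \<Sum>j<n. b i * b j / 2) + (\<Sum>i<n. \<Sum>j<n. g i j ^ 2)" .
    have "0 \<le> (\<Sum>i<n. \<Sum>j<n. b i * b j / 2)" "0 \<le> (\<Sum>i<n. \<Sum>j<n. g i j ^ 2)"
      using b0 by (auto intro!: sum_nonneg)
    then show ?thesis using * by linarith
  qed
  have N_row_sum: "(\<Sum>i<n. \<Sum>j<n. N i j * (f i + f j)) = 2 * (\<Sum>i<n. \<nu> i * f i)" for f
  proof -
    have "(\<Sum>i<n. \<Sum>j<n. N i j * f j) = (\<Sum>i<n. \<Sum>j<n. N i j * f i)"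
      by (subst sum.swap) (intro sum.cong refl, simp add: N_sym)
    moreover have "(\<Sum>i<n. \<Sum>j<n. N i j * f i) = (\<Sum>i<n. \<nu> i * f i)"
      by (simp add: \<nu>_def sum_distrib_right)
    ultimately show ?thesis by (simp add: distrib_left sum.distrib)
  qed
  have sum_v2: "(\<Sum>k<r. \<Sum>i<n. v i k ^ 2) = Sb"
    unfolding Sb_def b_def by (rule sum.swap)
  have noise_g: "\<bar>\<Sum>i<n. \<Sum>j<n. N i j * g i j\<bar> \<le> K * Sb"
  proof -
    have "(\<Sum>i<n. \<Sum>j<n. N i j * g i j) = (\<Sum>k<r. \<Sum>i<n. \<Sum>j<n. N i j * v i k * v j k)"
      unfolding g_def sum_distrib_left mult.assoc by (rule sum_swap3)
    also have "\<bar>\<dots>\<bar> \<le> (\<Sum>k<r. K * (\<Sum>i<n. v i k ^ 2))"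
      by (rule order_trans[OF sum_abs]) (intro sum_mono bilinear_norm_le_quadratic N_norm)
    also have "\<dots> = K * Sb"
      by (simp add: sum_distrib_left[symmetric] sum_v2)
    finally show ?thesis .
  qed
  have noise_b: "\<bar>\<Sum>i<n. \<Sum>j<n. N i j * b i * b j\<bar> \<le> K * (4 * Sb)"
    using bilinear_norm_le_quadratic[OF N_norm, of b] mult_left_mono[OF Sbb K(2)]
    unfolding Sbb_def by linarith
  have noise_bg: "\<bar>\<Sum>i<n. \<Sum>j<n. N i j * (b i * g i j)\<bar> \<le> 4 * (K * Sb)"
  proof -
    have "(\<Sum>i<n. \<Sum>j<n. N i j * (b i * g i j)) = (\<Sum>k<r. \<Sum>i<n. \<Sum>j<n. N i j * (b i * v i k) * v j k)"
      unfolding g_def sum_distrib_left mult.assoc by (rule sum_swap3)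
    also have "\<bar>\<dots>\<bar> \<le> (\<Sum>k<r. K * (4 * (\<Sum>i<n. v i k ^ 2)))"
    proof (rule order_trans[OF sum_abs], intro sum_mono)
      fix k
      have "L2_set (\<lambda>i. b i * v i k) {..<n} \<le> L2_set (\<lambda>i. 4 * v i k) {..<n}"
        unfolding L2_set_def power_mult_distrib
        by (intro real_sqrt_le_mono sum_mono mult_right_mono power_mono) (auto simp: b4 b0)
      also have "\<dots> = 4 * L2_set (\<lambda>i. v i k) {..<n}"
        by (simp add: L2_set_def power_mult_distrib sum_distrib_left[symmetric] real_sqrt_mult)
      finally have "L2_set (\<lambda>i. b i * v i k) {..<n} * L2_set (\<lambda>i. v i k) {..<n}
          \<le> 4 * (L2_set (\<lambda>i. v i k) {..<n} * L2_set (\<lambda>i. v i k) {..<n})"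
        by (metis L2_set_nonneg mult.assoc mult_right_mono)
      then have "K * (L2_set (\<lambda>i. b i * v i k) {..<n} * L2_set (\<lambda>i. v i k) {..<n})
          \<le> K * (4 * (\<Sum>i<n. v i k ^ 2))"
        unfolding L2_set_squared by (intro mult_left_mono K)
      then show "\<bar>\<Sum>i<n. \<Sum>j<n. N i j * (b i * v i k) * v j k\<bar> \<le> K * (4 * (\<Sum>i<n. v i k ^ 2))"
        using bilinear_norm_leD[OF N_norm, of "\<lambda>i. b i * v i k" "\<lambda>i. v i k"]
        by (simp add: mult.assoc)
    qed
    also have "\<dots> = 4 * (K * Sb)"
      by (simp add: sum_distrib_left[symmetric] sum_v2)
    finally show ?thesis .
  qed
  have noise_gg: "\<bar>\<Sum>i<n. \<Sum>j<n. N i j * g i j ^ 2\<bar> \<le> K * (4 * Sb)"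
  proof -
    have "(\<Sum>i<n. \<Sum>j<n. N i j * g i j ^ 2) =
        (\<Sum>i<n. \<Sum>j<n. \<Sum>(k, l)\<in>{..<r} \<times> {..<r}. N i j * (v i k * v i l) * (v j k * v j l))"
      by (intro sum.cong refl)
        (simp add: g_def power2_eq_square sum_product sum_distrib_left sum.cartesian_product
            case_prod_unfold mult_ac)
    also have "\<dots> = (\<Sum>x\<in>{..<r} \<times> {..<r}. \<Sum>i<n. \<Sum>j<n.
        N i j * (v i (fst x) * v i (snd x)) * (v j (fst x) * v j (snd x)))"
      unfolding case_prod_unfold by (rule sum_swap3)
    also have "\<bar>\<dots>\<bar> \<le> (\<Sum>x\<in>{..<r} \<times> {..<r}. K * (\<Sum>i<n. (v i (fst x) * v i (snd x)) ^ 2))"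
      by (rule order_trans[OF sum_abs]) (intro sum_mono bilinear_norm_le_quadratic N_norm)
    also have "\<dots> = K * (\<Sum>i<n. \<Sum>x\<in>{..<r} \<times> {..<r}. (v i (fst x) * v i (snd x)) ^ 2)"
      unfolding sum_distrib_left[symmetric] by (rule arg_cong[OF sum.swap])
    also have "(\<Sum>i<n. \<Sum>x\<in>{..<r} \<times> {..<r}. (v i (fst x) * v i (snd x)) ^ 2) = Sbb"
      unfolding Sbb_def b_def
      by (intro sum.cong refl)
        (simp add: power2_eq_square[of "sum _ _"] sum_product sum.cartesian_product
            case_prod_unfold power_mult_distrib)
    also have "K * Sbb \<le> K * (4 * Sb)" by (intro mult_left_mono Sbb K)
    finally show ?thesis .
  qed
  have ND: "(\<Sum>i<n. \<Sum>j<n. N i j * D i j) = (\<Sum>i<n. \<nu> i * b i) - (\<Sum>i<n. \<Sum>j<n. N i j * g i j)"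
  proof -
    have "(\<Sum>i<n. \<Sum>j<n. N i j * D i j) = (\<Sum>i<n. \<Sum>j<n. N i j * (b i / 2 + b j / 2) - N i j * g i j)"
      by (intro sum.cong refl) (simp add: D_eq field_simps)
    then show ?thesis
      by (simp only: sum_subtractf N_row_sum) (simp add: sum_divide_distrib[symmetric])
  qed
  have ND2: "(\<Sum>i<n. \<Sum>j<n. N i j * D i j ^ 2) = (\<Sum>i<n. \<nu> i * b i ^ 2) / 2
      + (\<Sum>i<n. \<Sum>j<n. N i j * b i * b j) / 2
      - 2 * (\<Sum>i<n. \<Sum>j<n. N i j * (b i * g i j)) + (\<Sum>i<n. \<Sum>j<n. N i j * g i j ^ 2)"
  proof -
    have "(\<Sum>i<n. \<Sum>j<n. N i j * D i j ^ 2) = (\<Sum>i<n. \<Sum>j<n. N i j * (b i ^ 2 / 4 + b j ^ 2 / 4)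
        + N i j * b i * b j / 2 - N i j * (b i * g i j) - N i j * (b j * g i j) + N i j * g i j ^ 2)"
      by (intro sum.cong refl) (simp add: D_eq power2_eq_square field_simps)
    moreover have "(\<Sum>i<n. \<Sum>j<n. N i j * (b j * g i j)) = (\<Sum>i<n. \<Sum>j<n. N i j * (b i * g i j))"
      by (subst sum.swap) (intro sum.cong refl, simp add: N_sym g_sym)
    ultimately show ?thesis
      by (simp only: sum.distrib sum_subtractf N_row_sum) (simp add: sum_divide_distrib[symmetric])
  qed
  define R where "R = real r - 3"
  have R: "1 \<le> R" using r by (simp add: R_def)
  have "(\<Sum>i<n. \<Sum>j<n. B i j * ((1 - w i j) * (real r - 2 - w i j)))
      = (\<Sum>i<n. \<Sum>j<n. R * (\<mu> * D i j) + R * (N i j * D i j) + \<mu> * D i j ^ 2 + N i j * D i j ^ 2)"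
  proof (intro sum.cong refl)
    fix i j assume "i \<in> {..<n}" "j \<in> {..<n}"
    then have ij: "i < n" "j < n" by auto
    show "B i j * ((1 - w i j) * (real r - 2 - w i j))
      = R * (\<mu> * D i j) + R * (N i j * D i j) + \<mu> * D i j ^ 2 + N i j * D i j ^ 2"
    proof (cases "i = j")
      case True
      have "D i i = 0" using ij unit by (simp add: D_def w_def power2_eq_square)
      then show ?thesis using True by (simp add: D_def)
    next
      case False
      then show ?thesis using ij B
        by (simp add: D_def R_def power2_eq_square algebra_simps)
    qed
  qed
  also have "\<dots> = R * (\<mu> * (real n * Sb)) + R * ((\<Sum>i<n. \<nu> i * b i) - (\<Sum>i<n. \<Sum>j<n. N i j * g i j))
     + \<mu> * (\<Sum>i<n. \<Sum>j<n. D i j ^ 2) + (\<Sum>i<n. \<Sum>j<n. N i j * D i j ^ 2)"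
    by (simp only: sum.distrib sum_distrib_left[symmetric] D_sum ND)
  finally have total: "R * (\<mu> * (real n * Sb)) + R * ((\<Sum>i<n. \<nu> i * b i) - (\<Sum>i<n. \<Sum>j<n. N i j * g i j))
     + \<mu> * (\<Sum>i<n. \<Sum>j<n. D i j ^ 2) + (\<Sum>i<n. \<Sum>j<n. N i j * D i j ^ 2) \<le> 0"
    using crit by simp
  have row1: "\<eta> * \<mu> * real n * Sb \<le> \<mu> * (real n * Sb) + (\<Sum>i<n. \<nu> i * b i)"
  proof -
    have "\<eta> * \<mu> * real n * Sb = (\<Sum>i<n. \<eta> * \<mu> * real n * b i)" by (simp add: Sb_def sum_distrib_left)
    also have "\<dots> \<le> (\<Sum>i<n. (\<mu> * real n + \<nu> i) * b i)"
      using N_rows b0 by (intro sum_mono mult_right_mono) (auto simp: \<nu>_def)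
    finally show ?thesis by (simp add: Sb_def sum_distrib_left distrib_right sum.distrib mult.assoc)
  qed
  \<comment> \<open>the combined row sums are nonnegative because \<open>\<eta> \<mu> n\<close> exceeds \<open>15 K \<ge> 0\<close>\<close>
  have row2: "0 \<le> \<mu> * (real n * Sbb) + (\<Sum>i<n. \<nu> i * b i ^ 2)"
  proof -
    have "0 \<le> \<mu> * real n + \<nu> i" if "i < n" for i
      using N_rows[OF that] K by (simp add: \<nu>_def)
    then have "0 \<le> (\<Sum>i<n. (\<mu> * real n + \<nu> i) * b i ^ 2)" by (intro sum_nonneg mult_nonneg_nonneg) auto
    then show ?thesis by (simp add: Sbb_def sum_distrib_left distrib_right sum.distrib mult.assoc)
  qed
  have "R * (\<eta> * \<mu> * real n * Sb) \<le> R * (\<mu> * (real n * Sb) + (\<Sum>i<n. \<nu> i * b i))"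
    using R by (intro mult_left_mono row1) simp
  moreover have "R * (\<Sum>i<n. \<Sum>j<n. N i j * g i j) \<le> R * (K * Sb)"
    using R noise_g by (intro mult_left_mono) auto
  moreover have "\<mu> * (real n * Sbb / 2) \<le> \<mu> * (\<Sum>i<n. \<Sum>j<n. D i j ^ 2)"
    using mu by (intro mult_left_mono D_sum2) simp
  ultimately have "R * (\<eta> * \<mu> * real n * Sb) \<le> R * (K * Sb) + 14 * (K * Sb)"
    using total row2 noise_b noise_bg noise_gg unfolding ND2
    by (simp add: distrib_left right_diff_distrib)
  also have "\<dots> \<le> R * (15 * K * Sb)"
    using mult_right_mono[OF R, of "14 * (K * Sb)"] Sb0 K by (simp add: algebra_simps)
  finally have "(\<eta> * \<mu> * real n - 15 * K) * Sb \<le> 0"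
    using R by (simp add: mult_le_cancel_left algebra_simps)
  then have "Sb \<le> 0" using K by (simp add: mult_le_0_iff)
  then have "b i = 0"
    using sum_nonneg_eq_0_iff[of "{..<n}" b] b0 Sb0 ik by (simp add: Sb_def)
  then have "v i k = 0"
    using sum_nonneg_eq_0_iff[of "{..<r}" "\<lambda>k. v i k ^ 2"] ik by (simp add: b_def)
  then show ?thesis by (simp add: v_def m_def)
qed

section \<open>Chernoff bounds for inhomogeneous random graphs\<close>

definition vertex_pairs :: "nat \<Rightarrow> (nat \<times> nat) set" where
  "vertex_pairs n = {(i, j). i < j \<and> j < n}"

lemma finite_vertex_pairs [simp]: "finite (vertex_pairs n)"
  by (rule finite_subset[of _ "{..<n} \<times> {..<n}"]) (auto simp: vertex_pairs_def)

definition random_graph :: "nat \<Rightarrow> (nat \<times> nat \<Rightarrow> real) \<Rightarrow> (nat \<times> nat \<Rightarrow> bool) pmf" where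
  "random_graph n a = Pi_pmf (vertex_pairs n) False (\<lambda>e. bernoulli_pmf (a e))"

text \<open>Edge data live on pairs \<open>(i, j)\<close> with \<open>i < j\<close>; this turns them into a symmetric matrix with zero
  diagonal. Applied to coins it gives the adjacency matrix, applied to probabilities its mean.\<close>

definition sym_ext :: "(nat \<times> nat \<Rightarrow> real) \<Rightarrow> nat \<Rightarrow> nat \<Rightarrow> real" where
  "sym_ext h i j = (if i = j then 0 else h (min i j, max i j))"

definition adj :: "(nat \<times> nat \<Rightarrow> bool) \<Rightarrow> nat \<Rightarrow> nat \<Rightarrow> real" where
  "adj \<omega> = sym_ext (\<lambda>e. of_bool (\<omega> e))"

lemma sym_ext_commute: "sym_ext h i j = sym_ext h j i"
  by (simp add: sym_ext_def min.commute max.commute)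

lemma adj_commute: "adj \<omega> i j = adj \<omega> j i"
  unfolding adj_def by (rule sym_ext_commute)

lemma adj_range: "0 \<le> adj \<omega> i j" "adj \<omega> i j \<le> 1"
  by (auto simp: adj_def sym_ext_def)

text \<open>Passing from ordered pairs to edges exhibits a linear form of the adjacency matrix as a sum of
  independent terms.\<close>

lemma sum_sym_ext:
  "(\<Sum>i<n. \<Sum>j<n. sym_ext h i j * c i j)
    = (\<Sum>e\<in>vertex_pairs n. h e * (c (fst e) (snd e) + c (snd e) (fst e)))"
proof -
  let ?f = "\<lambda>e. sym_ext h (fst e) (snd e) * c (fst e) (snd e)"
  have split: "{..<n} \<times> {..<n} = vertex_pairs n \<union> prod.swap ` vertex_pairs n \<union> (\<lambda>i. (i, i)) ` {..<n}"
    by (force simp: vertex_pairs_def image_iff)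
  have "(\<Sum>i<n. \<Sum>j<n. sym_ext h i j * c i j) = sum ?f ({..<n} \<times> {..<n})"
    by (simp add: sum.cartesian_product case_prod_unfold)
  also have "\<dots> = sum ?f (vertex_pairs n) + sum ?f (prod.swap ` vertex_pairs n)
      + sum ?f ((\<lambda>i. (i, i)) ` {..<n})"
    unfolding split
    by (subst sum.union_disjoint, simp, simp, force simp: vertex_pairs_def,
        subst sum.union_disjoint, simp, simp, force simp: vertex_pairs_def) simp
  also have "sum ?f ((\<lambda>i. (i, i)) ` {..<n}) = 0"
    by (intro sum.neutral) (auto simp: sym_ext_def)
  also have "sum ?f (prod.swap ` vertex_pairs n) = (\<Sum>e\<in>vertex_pairs n. h e * c (snd e) (fst e))"
    by (subst sum.reindex) (auto simp: vertex_pairs_def sym_ext_def intro!: sum.cong)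
  also have "sum ?f (vertex_pairs n) = (\<Sum>e\<in>vertex_pairs n. h e * c (fst e) (snd e))"
    by (intro sum.cong) (auto simp: vertex_pairs_def sym_ext_def)
  finally show ?thesis by (simp add: distrib_left sum.distrib)
qed

lemma independent_coins_Chernoff:
  assumes E: "finite E" and a: "\<And>e. e \<in> E \<Longrightarrow> 0 \<le> a e \<and> a e \<le> (1::real)"
  shows "measure_pmf.prob (Pi_pmf E dflt (\<lambda>e. bernoulli_pmf (a e)))
      {\<omega>. T \<le> (\<Sum>e\<in>E. \<theta> e * of_bool (\<omega> e))}
    \<le> exp ((\<Sum>e\<in>E. a e * (exp (\<theta> e) - 1)) - T)"
proof -
  let ?M = "Pi_pmf E dflt (\<lambda>e. bernoulli_pmf (a e))"
  let ?u = "\<lambda>\<omega>. \<Prod>e\<in>E. exp (\<theta> e * of_bool (\<omega> e))"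
  have "finite (set_pmf ?M)"
    by (rule finite_subset[OF set_Pi_pmf_subset'[OF E]]) (intro finite_PiE_dflt E, auto)
  then have int: "integrable (measure_pmf ?M) ?u" by (rule integrable_measure_pmf_finite)
  have "measure_pmf.prob ?M {\<omega>. T \<le> (\<Sum>e\<in>E. \<theta> e * of_bool (\<omega> e))}
      = measure_pmf.prob ?M {\<omega> \<in> space (measure_pmf ?M). exp T \<le> ?u \<omega>}"
    using E by (simp add: exp_sum[symmetric])
  also have "\<dots> \<le> measure_pmf.expectation ?M ?u / exp T"
    using integral_Markov_inequality_measure[OF int, of UNIV "exp T"]
    by (auto simp: prod_nonneg)
  also have "measure_pmf.expectation ?M ?u
      = (\<Prod>e\<in>E. measure_pmf.expectation (bernoulli_pmf (a e)) (\<lambda>b. exp (\<theta> e * of_bool b)))"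
    by (rule expectation_prod_Pi_pmf[OF E, of _ "\<lambda>e b. exp (\<theta> e * of_bool b)"])
      (auto intro: integrable_measure_pmf_finite)
  also have "\<dots> \<le> (\<Prod>e\<in>E. exp (a e * (exp (\<theta> e) - 1)))"
  proof (intro prod_mono conjI)
    fix e assume e: "e \<in> E"
    have "measure_pmf.expectation (bernoulli_pmf (a e)) (\<lambda>b. exp (\<theta> e * of_bool b))
        = 1 + a e * (exp (\<theta> e) - 1)"
      using a[OF e] by (simp add: algebra_simps)
    then show "measure_pmf.expectation (bernoulli_pmf (a e)) (\<lambda>b. exp (\<theta> e * of_bool b))
        \<le> exp (a e * (exp (\<theta> e) - 1))"
      by (simp add: exp_ge_add_one_self)
  qed simp
  also have "\<dots> / exp T = exp ((\<Sum>e\<in>E. a e * (exp (\<theta> e) - 1)) - T)"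
    using E by (simp add: exp_sum exp_diff)
  finally show ?thesis by (simp add: divide_right_mono)
qed

lemma random_graph_Chernoff:
  assumes a: "\<And>e. e \<in> vertex_pairs n \<Longrightarrow> 0 \<le> a e \<and> a e \<le> 1"
  shows "measure_pmf.prob (random_graph n a) {\<omega>. T \<le> (\<Sum>i<n. \<Sum>j<n. adj \<omega> i j * c i j)}
    \<le> exp ((\<Sum>e\<in>vertex_pairs n. a e * (exp (c (fst e) (snd e) + c (snd e) (fst e)) - 1)) - T)"
  unfolding random_graph_def adj_def sum_sym_ext
  using independent_coins_Chernoff[OF finite_vertex_pairs a,
      where \<theta> = "\<lambda>e. c (fst e) (snd e) + c (snd e) (fst e)" and T = T and dflt = False]
  by (simp add: mult.commute)

text \<open>Each edge at the vertex \<open>i\<close> occurs exactly once in the row of \<open>i\<close>, so the exponent can be read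
  off the row of mean values.\<close>

lemma vertex_row_Chernoff:
  assumes a: "\<And>e. e \<in> vertex_pairs n \<Longrightarrow> 0 \<le> a e \<and> a e \<le> 1" and i: "i < n"
  shows "measure_pmf.prob (random_graph n a) {\<omega>. T \<le> (\<Sum>j<n. adj \<omega> i j * c j)}
    \<le> exp ((\<Sum>j<n. sym_ext a i j * (exp (c j) - 1)) - T)"
proof -
  define c' where "c' k j = (if k = i then c j else 0)" for k j
  have row: "(\<Sum>k<n. \<Sum>j<n. h k j * (if k = i then f j else 0)) = (\<Sum>j<n. h i j * f j)"
    for h :: "nat \<Rightarrow> nat \<Rightarrow> real" and f
    using i by (subst sum.swap) (simp add: if_distrib[of "(*) _"] cong: if_cong)
  have "(\<Sum>e\<in>vertex_pairs n. a e * (exp (c' (fst e) (snd e) + c' (snd e) (fst e)) - 1))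
      = (\<Sum>e\<in>vertex_pairs n. a e * ((if fst e = i then exp (c (snd e)) - 1 else 0)
          + (if snd e = i then exp (c (fst e)) - 1 else 0)))"
    by (intro sum.cong) (auto simp: c'_def vertex_pairs_def)
  also have "\<dots> = (\<Sum>j<n. sym_ext a i j * (exp (c j) - 1))"
    by (simp only: sum_sym_ext[symmetric, where c = "\<lambda>k j. if k = i then exp (c j) - 1 else 0"] row)
  finally have exponent: "(\<Sum>e\<in>vertex_pairs n. a e * (exp (c' (fst e) (snd e) + c' (snd e) (fst e)) - 1))
      = (\<Sum>j<n. sym_ext a i j * (exp (c j) - 1))" .
  have "(\<Sum>k<n. \<Sum>j<n. adj \<omega> k j * c' k j) = (\<Sum>j<n. adj \<omega> i j * c j)" for \<omega>
    by (simp only: c'_def row)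
  moreover have "measure_pmf.prob (random_graph n a) {\<omega>. T \<le> (\<Sum>k<n. \<Sum>j<n. adj \<omega> k j * c' k j)}
      \<le> exp ((\<Sum>e\<in>vertex_pairs n. a e * (exp (c' (fst e) (snd e) + c' (snd e) (fst e)) - 1)) - T)"
    using a by (rule random_graph_Chernoff)
  ultimately show ?thesis by (simp only: exponent)
qed

text \<open>Negative arguments reduce to \<open>exp t \<ge> 1 + t + t\<^sup>2 / 2\<close>, since
  \<open>(1 - t + t\<^sup>2) (1 + t + t\<^sup>2 / 2) = 1 + (t\<^sup>2 + t\<^sup>3 + t\<^sup>4) / 2\<close>.\<close>

lemma exp_le_quadratic:
  fixes x :: real
  assumes "\<bar>x\<bar> \<le> 1"
  shows "exp x \<le> 1 + x + x\<^sup>2"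
proof (cases "0 \<le> x")
  case True
  then show ?thesis using assms by (intro exp_bound) auto
next
  case False
  define t where "t = - x"
  have t: "0 < t" "t \<le> 1" using False assms by (auto simp: t_def)
  have "1 \<le> (1 - t + t\<^sup>2) * (1 + t + t\<^sup>2 / 2)"
  proof -
    have "(1 - t + t\<^sup>2) * (1 + t + t\<^sup>2 / 2) = 1 + (t\<^sup>2 + t ^ 3 + t ^ 4) / 2"
      by (simp add: power2_eq_square power3_eq_cube power4_eq_xxxx field_simps)
    then show ?thesis using t by simp
  qed
  also have "\<dots> \<le> (1 - t + t\<^sup>2) * exp t"
    using t by (intro mult_left_mono exp_lower_Taylor_quadratic) auto
  finally have "exp (- t) \<le> 1 - t + t\<^sup>2"
    by (simp add: exp_minus field_simps)
  then show ?thesis by (simp add: t_def)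
qed

text \<open>A Bernstein-type bound: as long as \<open>l\<close> times the coefficients is at most 1/2, the two
  orientations of an edge together stay in the range of the quadratic bound for the exponential
  function.\<close>

lemma centred_form_Chernoff:
  assumes a: "\<And>e. e \<in> vertex_pairs n \<Longrightarrow> 0 \<le> a e \<and> a e \<le> p" "p \<le> 1" "0 \<le> p"
    and c: "\<And>i j. i < n \<Longrightarrow> j < n \<Longrightarrow> \<bar>c i j\<bar> \<le> h" and l: "0 \<le> l" "l * h \<le> 1 / 2"
  shows "measure_pmf.prob (random_graph n a) {\<omega>. T \<le> (\<Sum>i<n. \<Sum>j<n. (adj \<omega> i j - sym_ext a i j) * c i j)}
    \<le> exp (2 * p * l ^ 2 * (\<Sum>i<n. \<Sum>j<n. c i j ^ 2) - l * T)"
proof -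
  define c' where "c' i j = l * c i j" for i j
  define x where "x e = c' (fst e) (snd e) + c' (snd e) (fst e)" for e
  define m where "m = (\<Sum>i<n. \<Sum>j<n. sym_ext a i j * c' i j)"
  have m: "m = (\<Sum>e\<in>vertex_pairs n. a e * x e)"
    unfolding m_def x_def by (rule sum_sym_ext)
  have "l * (\<Sum>i<n. \<Sum>j<n. (adj \<omega> i j - sym_ext a i j) * c i j)
      = (\<Sum>i<n. \<Sum>j<n. adj \<omega> i j * c' i j) - m" for \<omega>
    by (simp add: m_def c'_def sum_distrib_left sum_subtractf[symmetric] algebra_simps)
  then have "{\<omega>. T \<le> (\<Sum>i<n. \<Sum>j<n. (adj \<omega> i j - sym_ext a i j) * c i j)}
      \<subseteq> {\<omega>. m + l * T \<le> (\<Sum>i<n. \<Sum>j<n. adj \<omega> i j * c' i j)}"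
    using l(1) by (smt (verit, best) Collect_mono mult_left_mono)
  then have "measure_pmf.prob (random_graph n a) {\<omega>. T
      \<le> (\<Sum>i<n. \<Sum>j<n. (adj \<omega> i j - sym_ext a i j) * c i j)}
      \<le> measure_pmf.prob (random_graph n a) {\<omega>. m + l * T \<le> (\<Sum>i<n. \<Sum>j<n. adj \<omega> i j * c' i j)}"
    by (intro measure_pmf.finite_measure_mono) auto
  also have "\<dots> \<le> exp ((\<Sum>e\<in>vertex_pairs n. a e * (exp (x e) - 1)) - (m + l * T))"
    unfolding x_def using a by (intro random_graph_Chernoff) (meson order_trans)
  also have "(\<Sum>e\<in>vertex_pairs n. a e * (exp (x e) - 1)) - (m + l * T)
      = (\<Sum>e\<in>vertex_pairs n. a e * (exp (x e) - 1 - x e)) - l * T"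
    by (simp add: m sum_subtractf[symmetric] algebra_simps)
  also have "(\<Sum>e\<in>vertex_pairs n. a e * (exp (x e) - 1 - x e))
      \<le> (\<Sum>e\<in>vertex_pairs n. p * (2 * (c' (fst e) (snd e) ^ 2 + c' (snd e) (fst e) ^ 2)))"
  proof (rule sum_mono)
    fix e assume e: "e \<in> vertex_pairs n"
    have small: "\<bar>c' i j\<bar> \<le> 1 / 2" if "i < n" "j < n" for i j
      using mult_left_mono[OF c[OF that] l(1)] l by (simp add: c'_def abs_mult)
    have "\<bar>x e\<bar> \<le> 1"
      using e small[of "fst e" "snd e"] small[of "snd e" "fst e"]
      by (auto simp: x_def vertex_pairs_def)
    then have "exp (x e) - 1 - x e \<le> x e ^ 2"
      using exp_le_quadratic[of "x e"] by linarith
    also have "\<dots> \<le> 2 * (c' (fst e) (snd e) ^ 2 + c' (snd e) (fst e) ^ 2)"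
      unfolding x_def using sum_squares_bound[of "c' (fst e) (snd e)" "c' (snd e) (fst e)"]
      by (simp add: power2_sum)
    finally show "a e * (exp (x e) - 1 - x e)
        \<le> p * (2 * (c' (fst e) (snd e) ^ 2 + c' (snd e) (fst e) ^ 2))"
      using a(1)[OF e] exp_ge_add_one_self[of "x e"] by (intro mult_mono) linarith+
  qed
  also have "\<dots> = 2 * p * (\<Sum>e\<in>vertex_pairs n. 1 * (c' (fst e) (snd e) ^ 2 + c' (snd e) (fst e) ^ 2))"
    by (simp add: sum_distrib_left mult_ac)
  also have "\<dots> \<le> 2 * p * (\<Sum>i<n. \<Sum>j<n. c' i j ^ 2)"
  proof (rule mult_left_mono)
    show "(\<Sum>e\<in>vertex_pairs n. 1 * (c' (fst e) (snd e) ^ 2 + c' (snd e) (fst e) ^ 2))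
        \<le> (\<Sum>i<n. \<Sum>j<n. c' i j ^ 2)"
      unfolding sum_sym_ext[symmetric, of "\<lambda>_. 1" "\<lambda>i j. c' i j ^ 2"]
      by (intro sum_mono) (simp add: sym_ext_def)
  qed (use a in simp)
  also have "\<dots> = 2 * p * l ^ 2 * (\<Sum>i<n. \<Sum>j<n. c i j ^ 2)"
    by (simp add: c'_def power_mult_distrib sum_distrib_left mult_ac)
  finally show ?thesis by simp
qed

text \<open>Tilting by \<open>\<theta>\<close> makes an edge count beyond \<open>exp \<theta>\<close> times its largest possible mean cost \<open>\<theta> / 2\<close>
  per unit of excess. The factor 1/2 appears because an edge inside \<open>S \<inter> T\<close> is counted in both
  orientations.\<close>

lemma edge_count_Chernoff:
  assumes a: "\<And>e. e \<in> vertex_pairs n \<Longrightarrow> 0 \<le> a e \<and> a e \<le> p" "p \<le> 1" "0 \<le> p"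
    and S: "S \<subseteq> {..<n}" and T: "T \<subseteq> {..<n}" and \<theta>: "1 \<le> \<theta>"
  shows "measure_pmf.prob (random_graph n a)
      {\<omega>. exp \<theta> * p * real (card S) * real (card T) + 2 * L / \<theta> \<le> (\<Sum>i\<in>S. \<Sum>j\<in>T. adj \<omega> i j)}
    \<le> exp (- L)"
proof -
  define B where "B = exp \<theta> * p * real (card S) * real (card T)"
  define c where "c i j = (if i \<in> S \<and> j \<in> T then \<theta> / 2 else 0)" for i j
  \<comment> \<open>each orientation carries half of the tilt, so that an edge carries at most \<open>\<theta>\<close>\<close>
  have sub: "(\<Sum>i<n. \<Sum>j<n. f i j * c i j) = \<theta> / 2 * (\<Sum>i\<in>S. \<Sum>j\<in>T. f i j)" for f
  proof -
    have "(\<Sum>i<n. \<Sum>j<n. f i j * c i j)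
        = (\<Sum>i<n. if i \<in> S then \<Sum>j<n. if j \<in> T then \<theta> / 2 * f i j else 0 else 0)"
      by (intro sum.cong refl) (auto simp: c_def mult.commute intro!: sum.cong)
    also have "\<dots> = (\<Sum>i\<in>S. \<Sum>j\<in>T. \<theta> / 2 * f i j)"
      using S T by (simp add: sum.inter_restrict[symmetric] Int_absorb1)
    finally show ?thesis by (simp add: sum_distrib_left)
  qed
  have B0: "0 \<le> B" using a by (simp add: B_def)
  have "(\<Sum>e\<in>vertex_pairs n. a e * (exp (c (fst e) (snd e) + c (snd e) (fst e)) - 1))
      \<le> (\<Sum>e\<in>vertex_pairs n. p * exp \<theta> / \<theta> * (c (fst e) (snd e) + c (snd e) (fst e)))"
  proof (rule sum_mono)
    fix e assume e: "e \<in> vertex_pairs n"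
    define x where "x = c (fst e) (snd e) + c (snd e) (fst e)"
    have "x = 0 \<or> x = \<theta> / 2 \<or> x = \<theta>" by (auto simp: x_def c_def)
    moreover have "exp (\<theta> / 2) - 1 \<le> exp \<theta> / 2"
      using sum_squares_bound[of "exp (\<theta> / 2)" 1]
      by (simp add: power2_eq_square exp_add[symmetric])
    moreover have "exp \<theta> / \<theta> * (\<theta> / 2) = exp \<theta> / 2" using \<theta> by simp
    ultimately have "exp x - 1 \<le> exp \<theta> / \<theta> * x" "0 \<le> x" using \<theta> by auto
    then have "a e * (exp x - 1) \<le> p * (exp \<theta> / \<theta> * x)"
      using a(1)[OF e] by (intro mult_mono) auto
    then show "a e * (exp (c (fst e) (snd e) + c (snd e) (fst e)) - 1)
       \<le> p * exp \<theta> / \<theta> * (c (fst e) (snd e) + c (snd e) (fst e))" by (simp add: x_def)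
  qed
  also have "\<dots> = p * exp \<theta> / \<theta> * (\<Sum>i<n. \<Sum>j<n. sym_ext (\<lambda>_. 1) i j * c i j)"
    by (simp add: sum_sym_ext sum_distrib_left)
  also have "\<dots> \<le> p * exp \<theta> / \<theta> * (\<Sum>i<n. \<Sum>j<n. 1 * c i j)"
    using a \<theta> by (intro mult_left_mono sum_mono mult_right_mono) (auto simp: sym_ext_def c_def)
  also have "\<dots> = B / 2" unfolding sub using \<theta> by (simp add: B_def)
  finally have expo: "(\<Sum>e\<in>vertex_pairs n. a e * (exp (c (fst e) (snd e) + c (snd e) (fst e)) - 1))
      \<le> B / 2" .
  have "{\<omega>. B + 2 * L / \<theta> \<le> (\<Sum>i\<in>S. \<Sum>j\<in>T. adj \<omega> i j)}
      = {\<omega>. \<theta> / 2 * (B + 2 * L / \<theta>) \<le> (\<Sum>i<n. \<Sum>j<n. adj \<omega> i j * c i j)}"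
    unfolding sub using \<theta> by (auto simp: mult_le_cancel_left)
  also have "measure_pmf.prob (random_graph n a) \<dots>
    \<le> exp ((\<Sum>e\<in>vertex_pairs n. a e * (exp (c (fst e) (snd e) + c (snd e) (fst e)) - 1))
       - \<theta> / 2 * (B + 2 * L / \<theta>))"
    using a by (intro random_graph_Chernoff) (meson order_trans)
  also have "\<dots> \<le> exp (- L)"
    using expo mult_right_mono[OF \<theta> B0] \<theta> by (simp add: distrib_left)
  finally show ?thesis by (simp add: B_def)
qed

section \<open>Large entries: degrees, edge counts and dyadic levels\<close>

text \<open>A geometric sum is dominated by its largest term.\<close>

lemma sum_powers_of_two_le:
  fixes X :: real
  assumes "finite B" "\<And>b. b \<in> B \<Longrightarrow> 2 ^ b \<le> X" "0 \<le> X"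
  shows "(\<Sum>b\<in>B. 2 ^ b) \<le> 2 * X"
proof (cases "B = {}")
  case True
  then show ?thesis using assms by simp
next
  case False
  have "(\<Sum>b\<in>B. 2 ^ b) \<le> (\<Sum>b<Suc (Max B). (2::real) ^ b)"
    using assms(1) by (intro sum_mono2) (auto simp: less_Suc_eq_le)
  also have "\<dots> = 2 ^ Suc (Max B) - 1" using geometric_sum[of "2::real" "Suc (Max B)"] by simp
  also have "\<dots> \<le> 2 * X" using assms(2)[OF Max_in[OF assms(1) False]] by simp
  finally show ?thesis .
qed

text \<open>The dyadic level sets of a vector of natural numbers: on level \<open>a\<close> the entries lie between \<open>2\<^sup>a\<close>
  and \<open>2\<^sup>a\<^sup>+\<^sup>1\<close>. Zero entries belong to no level.\<close>

definition level_set :: "nat \<Rightarrow> (nat \<Rightarrow> nat) \<Rightarrow> nat \<Rightarrow> nat set" where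
  "level_set n k a = {i \<in> {..<n}. 0 < k i \<and> floor_log (k i) = a}"

lemma level_set_subset: "level_set n k a \<subseteq> {..<n}"
  by (auto simp: level_set_def)

lemma level_set_bounds:
  assumes "i \<in> level_set n k a"
  shows "2 ^ a \<le> real (k i)" "real (k i) < 2 * 2 ^ a"
proof -
  have "2 ^ a \<le> k i" "k i < 2 * 2 ^ a"
    using assms floor_log_exp2_le[of "k i"] floor_log_exp2_gt[of "k i"]
    by (auto simp: level_set_def)
  then have "real (2 ^ a) \<le> real (k i)" "real (k i) < real (2 * 2 ^ a)"
    by (simp_all only: of_nat_le_iff of_nat_less_iff)
  then show "2 ^ a \<le> real (k i)" "real (k i) < 2 * 2 ^ a" by simp_all
qed

lemma sum_level_sets_le:
  assumes "finite I"
  shows "(\<Sum>a\<in>I. 4 ^ a * real (card (level_set n k a))) \<le> (\<Sum>i<n. real (k i) ^ 2)"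
proof -
  have "(\<Sum>a\<in>I. 4 ^ a * real (card (level_set n k a)))
      = (\<Sum>a\<in>I. \<Sum>i<n. if i \<in> level_set n k a then 4 ^ a else 0)"
    using level_set_subset by (intro sum.cong refl) (simp add: sum.inter_restrict[symmetric] Int_absorb1)
  also have "\<dots> = (\<Sum>i<n. \<Sum>a\<in>I. if i \<in> level_set n k a then 4 ^ a else 0)" by (rule sum.swap)
  also have "\<dots> \<le> (\<Sum>i<n. real (k i) ^ 2)"
  proof (rule sum_mono)
    fix i
    have "(\<Sum>a\<in>I. if i \<in> level_set n k a then 4 ^ a else 0)
        \<le> (\<Sum>a\<in>I. if a = floor_log (k i) then real (k i) ^ 2 else 0)"
    proof (rule sum_mono)
      fix a
      have "4 ^ a \<le> real (k i) ^ 2" if "i \<in> level_set n k a"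
        using power_mono[OF level_set_bounds(1)[OF that], of 2]
            by (simp add: power_mult[symmetric] mult.commute[of a] power_mult)
      then show "(if i \<in> level_set n k a then 4 ^ a else 0)
          \<le> (if a = floor_log (k i) then real (k i) ^ 2 else 0)"
        by (auto simp: level_set_def)
    qed
    also have "\<dots> \<le> real (k i) ^ 2" using assms by simp
    finally show "(\<Sum>a\<in>I. if i \<in> level_set n k a then 4 ^ a else 0) \<le> real (k i) ^ 2" .
  qed
  finally show ?thesis .
qed

text \<open>Balanced pairs, whose two entries differ by a factor of at most \<open>R\<close>, are grouped by their dyadic
  levels \<open>a\<close> and \<open>b\<close>, and the edge count between two level sets is bounded by \<open>disc\<close>. In the part
  with \<open>\<alpha>\<close> a factor \<open>2\<^sup>a\<^sup>+\<^sup>b / h\<close> is gained because the products exceed \<open>h\<close>, after which the sum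
  factorizes. In the part with \<open>\<beta>\<close> balance restricts the levels \<open>b\<close> that occur with a given \<open>a\<close> to
  \<open>2\<^sup>b \<le> 2 R 2\<^sup>a\<close>, and the sum over them is geometric.\<close>

lemma balanced_heavy_pairs_le:
  fixes A :: "nat \<Rightarrow> nat \<Rightarrow> real" and k l :: "nat \<Rightarrow> nat"
  assumes A0: "\<And>i j. 0 \<le> A i j"
    and disc: "\<And>S T. S \<subseteq> {..<n} \<Longrightarrow> T \<subseteq> {..<n} \<Longrightarrow>
      (\<Sum>i\<in>S. \<Sum>j\<in>T. A i j) \<le> \<alpha> * real (card S) * real (card T) + \<beta> * (real (card S) + real (card T))"
    and k: "(\<Sum>i<n. real (k i) ^ 2) \<le> X" and l: "(\<Sum>i<n. real (l i) ^ 2) \<le> X"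
    and pos: "0 < h" "0 < R" "0 \<le> \<alpha>" "0 \<le> \<beta>"
  shows "(\<Sum>i<n. \<Sum>j<n. if h < real (k i) * real (l j) \<and> real (k i) \<le> R * real (l j) \<and> real (l j)
      \<le> R * real (k i)
      then A i j * (real (k i) * real (l j)) else 0)
    \<le> 16 * \<alpha> * X ^ 2 / h + 32 * \<beta> * R * X"
proof -
  define I where "I = (\<lambda>i. floor_log (k i)) ` {..<n}"
  define J where "J = (\<lambda>j. floor_log (l j)) ` {..<n}"
  define good where "good a b \<longleftrightarrow> h < 4 * (2 ^ a * 2 ^ b) \<and> 2 ^ a \<le> 2 * R * 2 ^ b \<and> 2 ^ b
      \<le> 2 * R * 2 ^ a" for a b :: nat
  define s where "s a = real (card (level_set n k a))" for a
  define t where "t b = real (card (level_set n l b))" for b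
  have fin: "finite I" "finite J" by (auto simp: I_def J_def)
  have X0: "0 \<le> X" using k by (meson order_trans sum_nonneg zero_le_power2)
  have mass: "(\<Sum>a\<in>I. 4 ^ a * s a) \<le> X" "(\<Sum>b\<in>J. 4 ^ b * t b) \<le> X"
    unfolding s_def t_def using sum_level_sets_le[OF fin(1), of n k] sum_level_sets_le[OF fin(2),
        of n l] k l
    by linarith+
  have st0: "0 \<le> s a" "0 \<le> t b" for a b by (simp_all add: s_def t_def)
  have mass0: "0 \<le> (\<Sum>a\<in>I. 4 ^ a * s a)" "0 \<le> (\<Sum>b\<in>J. 4 ^ b * t b)"
    using st0 by (auto intro!: sum_nonneg)
  have "(\<Sum>i<n. \<Sum>j<n. if h < real (k i) * real (l j) \<and> real (k i) \<le> R * real (l j) \<and> real (l j)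
      \<le> R * real (k i)
      then A i j * (real (k i) * real (l j)) else 0)
    \<le> (\<Sum>i<n. \<Sum>j<n. \<Sum>g\<in>I \<times> J. if good (fst g) (snd g) \<and> i \<in> level_set n k (fst g)
        \<and> j \<in> level_set n l (snd g)
        then A i j * (4 * (2 ^ fst g * 2 ^ snd g)) else 0)" (is "_ \<le> (\<Sum>i<n. \<Sum>j<n. \<Sum>g\<in>I \<times> J. ?f i j g)")
  proof (intro sum_mono)
    fix i j assume "i \<in> {..<n}" "j \<in> {..<n}"
    then have ij: "i < n" "j < n" by auto
    have f0: "0 \<le> ?f i j g" for g using A0 by simp
    show "(if h < real (k i) * real (l j) \<and> real (k i) \<le> R * real (l j) \<and> real (l j) \<le> R * real (k i)
      then A i j * (real (k i) * real (l j)) else 0) \<le> (\<Sum>g\<in>I \<times> J. ?f i j g)"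
    proof (cases "h < real (k i) * real (l j) \<and> real (k i) \<le> R * real (l j) \<and> real (l j)
        \<le> R * real (k i)")
      case True
      define a b where "a = floor_log (k i)" and "b = floor_log (l j)"
      have "0 < real (k i) * real (l j)" using True pos by linarith
      then have "0 < k i" "0 < l j" by (auto simp: zero_less_mult_iff)
      then have lev: "i \<in> level_set n k a" "j \<in> level_set n l b"
        using ij by (auto simp: level_set_def a_def b_def)
      note bd = level_set_bounds[OF lev(1)] level_set_bounds[OF lev(2)]
      have prod: "real (k i) * real (l j) \<le> (2 * 2 ^ a) * (2 * 2 ^ b)"
        using bd by (intro mult_mono) auto
      have "R * real (l j) \<le> R * (2 * 2 ^ b)" "R * real (k i) \<le> R * (2 * 2 ^ a)"
        using bd pos by (auto intro!: mult_left_mono)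
      then have "R * real (l j) \<le> 2 * R * 2 ^ b" "R * real (k i) \<le> 2 * R * 2 ^ a"
        by (simp_all only: mult_ac)
      then have "2 ^ a \<le> 2 * R * 2 ^ b" "2 ^ b \<le> 2 * R * 2 ^ a" "h < (2 * 2 ^ a) * (2 * 2 ^ b)"
        using True prod bd by linarith+
      then have "good a b" by (simp add: good_def)
      moreover have "A i j * (real (k i) * real (l j)) \<le> A i j * (4 * (2 ^ a * 2 ^ b))"
        using prod by (intro mult_left_mono A0) (simp add: mult_ac)
      ultimately have "A i j * (real (k i) * real (l j)) \<le> ?f i j (a, b)" using lev by simp
      also have "\<dots> \<le> (\<Sum>g\<in>I \<times> J. ?f i j g)"
        by (rule member_le_sum) (use ij fin f0 in \<open>auto simp: I_def J_def a_def b_def\<close>)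
      finally show ?thesis using True by simp
    next
      case False
      then show ?thesis using f0 by (simp only: if_False sum_nonneg)
    qed
  qed
  also have "\<dots> = (\<Sum>g\<in>I \<times> J. \<Sum>i<n. \<Sum>j<n. ?f i j g)" by (rule sum_swap3)
  also have "\<dots> \<le> (\<Sum>g\<in>I \<times> J. 16 * \<alpha> / h * ((4 ^ fst g * s (fst g)) * (4 ^ snd g * t (snd g)))
      + 4 * \<beta> * (if good (fst g) (snd g) then 2 ^ fst g * s (fst g) * 2 ^ snd g else 0)
      + 4 * \<beta> * (if good (fst g) (snd g) then 2 ^ snd g * t (snd g) * 2 ^ fst g else 0))"
  proof (rule sum_mono)
    fix g :: "nat \<times> nat"
    obtain a b where g: "g = (a, b)" by (cases g)
    have ab: "(4::real) ^ a * 4 ^ b = (2 ^ a * 2 ^ b) * (2 ^ a * 2 ^ b)"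
      by (simp add: power_mult_distrib[symmetric] mult_ac)
    have st: "0 \<le> 4 ^ a * s a * (4 ^ b * t b)" using st0 by simp
    show "(\<Sum>i<n. \<Sum>j<n. ?f i j g) \<le> 16 * \<alpha> / h * ((4 ^ fst g * s (fst g)) * (4 ^ snd g * t (snd g)))
      + 4 * \<beta> * (if good (fst g) (snd g) then 2 ^ fst g * s (fst g) * 2 ^ snd g else 0)
      + 4 * \<beta> * (if good (fst g) (snd g) then 2 ^ snd g * t (snd g) * 2 ^ fst g else 0)"
    proof (cases "good a b")
      case True
      define w where "w = (2::real) ^ a * 2 ^ b"
      have w: "0 < w" "h < 4 * w" using True by (auto simp: w_def good_def)
      have "(\<Sum>i<n. \<Sum>j<n. ?f i j g)
          = (\<Sum>i<n. if i \<in> level_set n k a then \<Sum>j<n.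
              if j \<in> level_set n l b then A i j * (4 * w) else 0 else 0)"
        using True unfolding g w_def fst_conv snd_conv
        by (intro sum.cong refl) (auto intro!: sum.cong)
      also have "\<dots> = 4 * w * (\<Sum>i\<in>level_set n k a. \<Sum>j\<in>level_set n l b. A i j)"
        using level_set_subset[of n k a] level_set_subset[of n l b]
        by (simp add: sum.inter_restrict[symmetric] Int_absorb1 sum_distrib_left mult.commute)
      also have "\<dots> \<le> 4 * w * (\<alpha> * s a * t b + \<beta> * (s a + t b))"
        unfolding s_def t_def using w by (intro mult_left_mono disc level_set_subset) auto
      also have "\<dots> = 4 * w * (\<alpha> * s a * t b) + 4 * \<beta> * (w * s a) + 4 * \<beta> * (w * t b)"
        by (simp add: algebra_simps)
      also have "4 * w * (\<alpha> * s a * t b) \<le> (16 / h * w * w) * (\<alpha> * s a * t b)"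
        using w pos st0 by (intro mult_right_mono) (auto simp: field_simps)
      also have "\<dots> = 16 * \<alpha> / h * ((4 ^ a * s a) * (4 ^ b * t b))"
        using ab by (simp add: w_def field_simps)
      finally show ?thesis using True by (simp add: g w_def mult_ac)
    next
      case False
      then show ?thesis using st pos by (simp add: g)
    qed
  qed
  also have "\<dots> = 16 * \<alpha> / h * ((\<Sum>a\<in>I. 4 ^ a * s a) * (\<Sum>b\<in>J. 4 ^ b * t b))
      + 4 * \<beta> * (\<Sum>a\<in>I. 2 ^ a * s a * (\<Sum>b\<in>J. if good a b then 2 ^ b else 0))
      + 4 * \<beta> * (\<Sum>b\<in>J. 2 ^ b * t b * (\<Sum>a\<in>I. if good a b then 2 ^ a else 0))"
  proof -
    have e1: "(\<Sum>g\<in>I \<times> J. (4 ^ fst g * s (fst g)) * (4 ^ snd g * t (snd g)))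
        = (\<Sum>a\<in>I. 4 ^ a * s a) * (\<Sum>b\<in>J. 4 ^ b * t b)"
      by (simp add: sum_product sum.cartesian_product case_prod_unfold)
    have e2: "(\<Sum>g\<in>I \<times> J. if good (fst g) (snd g) then 2 ^ fst g * s (fst g) * 2 ^ snd g else 0)
        = (\<Sum>a\<in>I. 2 ^ a * s a * (\<Sum>b\<in>J. if good a b then 2 ^ b else 0))"
      by (simp add: sum_distrib_left sum.cartesian_product case_prod_unfold if_distrib[of "(*)
          _"] cong: if_cong)
    have e3: "(\<Sum>g\<in>I \<times> J. if good (fst g) (snd g) then 2 ^ snd g * t (snd g) * 2 ^ fst g else 0)
        = (\<Sum>b\<in>J. 2 ^ b * t b * (\<Sum>a\<in>I. if good a b then 2 ^ a else 0))"
    proof -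
      have "(\<Sum>g\<in>I \<times> J. if good (fst g) (snd g) then 2 ^ snd g * t (snd g) * 2 ^ fst g else 0)
          = (\<Sum>a\<in>I. \<Sum>b\<in>J. if good a b then 2 ^ b * t b * 2 ^ a else 0)"
        by (simp add: sum.cartesian_product case_prod_unfold)
      also have "\<dots> = (\<Sum>b\<in>J. \<Sum>a\<in>I. if good a b then 2 ^ b * t b * 2 ^ a else 0)" by (rule sum.swap)
      also have "\<dots> = (\<Sum>b\<in>J. 2 ^ b * t b * (\<Sum>a\<in>I. if good a b then 2 ^ a else 0))"
        by (simp add: sum_distrib_left if_distrib[of "(*) _"] cong: if_cong)
      finally show ?thesis .
    qed
    show ?thesis by (simp only: sum.distrib sum_distrib_left[symmetric] e1 e2 e3)
  qed
  also have "\<dots> \<le> 16 * \<alpha> / h * (X * X) + 4 * \<beta> * (\<Sum>a\<in>I. 2 ^ a * s a * (2 * (2 * R * 2 ^ a)))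
      + 4 * \<beta> * (\<Sum>b\<in>J. 2 ^ b * t b * (2 * (2 * R * 2 ^ b)))"
  proof -
    have "(\<Sum>b\<in>J. if good a b then (2::real) ^ b else 0) \<le> 2 * (2 * R * 2 ^ a)" for a
      unfolding sum.inter_filter[OF fin(2), symmetric]
      using pos fin by (intro sum_powers_of_two_le) (auto simp: good_def)
    moreover have "(\<Sum>a\<in>I. if good a b then (2::real) ^ a else 0) \<le> 2 * (2 * R * 2 ^ b)" for b
      unfolding sum.inter_filter[OF fin(1), symmetric]
      using pos fin by (intro sum_powers_of_two_le) (auto simp: good_def)
    ultimately show ?thesis
      using pos st0 mass mass0 X0 by (intro add_mono mult_left_mono sum_mono mult_mono) auto
  qed
  also have "\<dots> = 16 * \<alpha> * X ^ 2 / h + 16 * \<beta> * R * ((\<Sum>a\<in>I. 4 ^ a * s a) + (\<Sum>b\<in>J. 4 ^ b * t b))"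
  proof -
    have four: "(4::real) ^ a = 2 ^ a * 2 ^ a" for a
      by (simp add: power_mult_distrib[symmetric])
    have "(\<Sum>a\<in>I. 2 ^ a * s a * (2 * (2 * R * 2 ^ a))) = 4 * R * (\<Sum>a\<in>I. 4 ^ a * s a)"
      "(\<Sum>b\<in>J. 2 ^ b * t b * (2 * (2 * R * 2 ^ b))) = 4 * R * (\<Sum>b\<in>J. 4 ^ b * t b)"
      unfolding four sum_distrib_left by (intro sum.cong refl; simp only: ac_simps; simp)+
    then show ?thesis
      by (simp add: power2_eq_square algebra_simps)
  qed
  also have "\<dots> \<le> 16 * \<alpha> * X ^ 2 / h + 16 * \<beta> * R * (X + X)"
    using pos mass by (intro add_mono mult_left_mono) auto
  finally show ?thesis by simp
qed

text \<open>If one entry exceeds \<open>R\<close> times the other, the product is at most the square of the larger entry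
  divided by \<open>R\<close>, and summing over neighbours costs only the maximal degree. The other pairs are
  balanced.\<close>

lemma heavy_pairs_le:
  fixes A :: "nat \<Rightarrow> nat \<Rightarrow> real" and k l :: "nat \<Rightarrow> nat"
  assumes A0: "\<And>i j. 0 \<le> A i j" and A_sym: "\<And>i j. A i j = A j i"
    and deg: "\<And>i. i < n \<Longrightarrow> (\<Sum>j<n. A i j) \<le> \<Delta>"
    and disc: "\<And>S T. S \<subseteq> {..<n} \<Longrightarrow> T \<subseteq> {..<n} \<Longrightarrow>
      (\<Sum>i\<in>S. \<Sum>j\<in>T. A i j) \<le> \<alpha> * real (card S) * real (card T) + \<beta> * (real (card S) + real (card T))"
    and k: "(\<Sum>i<n. real (k i) ^ 2) \<le> X" and l: "(\<Sum>i<n. real (l i) ^ 2) \<le> X"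
    and pos: "0 < h" "0 < R" "0 \<le> \<alpha>" "0 \<le> \<beta>" "0 \<le> \<Delta>"
  shows "(\<Sum>i<n. \<Sum>j<n. if h < real (k i) * real (l j) then A i j * (real (k i) * real (l j)) else 0)
    \<le> 2 * \<Delta> * X / R + 16 * \<alpha> * X ^ 2 / h + 32 * \<beta> * R * X"
proof -
  let ?bal = "\<lambda>i j. if h < real (k i) * real (l j) \<and> real (k i) \<le> R * real (l j) \<and> real (l j)
      \<le> R * real (k i)
      then A i j * (real (k i) * real (l j)) else 0"
  have weighted_degrees: "(\<Sum>i<n. \<Sum>j<n. A i j * real (f i) ^ 2) \<le> \<Delta> * X"
    if "(\<Sum>i<n. real (f i) ^ 2) \<le> X" for f
  proof -
    have "(\<Sum>i<n. \<Sum>j<n. A i j * real (f i) ^ 2) \<le> (\<Sum>i<n. \<Delta> * real (f i) ^ 2)"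
      unfolding sum_distrib_right[symmetric] using deg by (intro sum_mono mult_right_mono) auto
    also have "\<dots> \<le> \<Delta> * X"
      unfolding sum_distrib_left[symmetric] using that pos by (intro mult_left_mono)
    finally show ?thesis .
  qed
  have "(\<Sum>i<n. \<Sum>j<n. if h < real (k i) * real (l j) then A i j * (real (k i) * real (l j)) else 0)
      \<le> (\<Sum>i<n. \<Sum>j<n. A i j * real (k i) ^ 2 / R + A i j * real (l j) ^ 2 / R + ?bal i j)"
  proof (intro sum_mono)
    fix i j
    define x y where "x = real (k i)" and "y = real (l j)"
    have xy: "0 \<le> x" "0 \<le> y" by (simp_all add: x_def y_def)
    have nn: "0 \<le> A i j * x ^ 2 / R" "0 \<le> A i j * y ^ 2 / R" using A0 pos by auto
    have mono: "A i j * (x * y) \<le> A i j * u / R" if "x * y \<le> u / R" for u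
      using mult_left_mono[OF that A0[of i j]] by simp
    consider "R * y < x" | "R * x < y" | "x \<le> R * y" "y \<le> R * x" by linarith
    then have "(if h < x * y then A i j * (x * y) else 0)
      \<le> A i j * x ^ 2 / R + A i j * y ^ 2 / R
        + (if h < x * y \<and> x \<le> R * y \<and> y \<le> R * x then A i j * (x * y) else 0)"
    proof cases
      case 1
      then have "R * (x * y) \<le> x ^ 2"
        using mult_left_mono[of "R * y" x x] xy by (simp add: power2_eq_square mult_ac)
      then have "x * y \<le> x ^ 2 / R" using pos by (simp add: field_simps)
      from mono[OF this] show ?thesis using nn A0[of i j] xy by auto
    next
      case 2
      then have "R * (x * y) \<le> y ^ 2"
        using mult_left_mono[of "R * x" y y] xy by (simp add: power2_eq_square mult_ac)
      then have "x * y \<le> y ^ 2 / R" using pos by (simp add: field_simps)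
      from mono[OF this] show ?thesis using nn A0[of i j] xy by auto
    next
      case 3
      then show ?thesis using nn by simp
    qed
    then show "(if h < real (k i) * real (l j) then A i j * (real (k i) * real (l j)) else 0)
      \<le> A i j * real (k i) ^ 2 / R + A i j * real (l j) ^ 2 / R + ?bal i j"
      unfolding x_def y_def .
  qed
  also have "\<dots> = (\<Sum>i<n. \<Sum>j<n. A i j * real (k i) ^ 2) / R + (\<Sum>i<n. \<Sum>j<n. A i j * real (l j) ^ 2) / R
      + (\<Sum>i<n. \<Sum>j<n. ?bal i j)"
    by (simp only: sum.distrib sum_divide_distrib)
  also have "(\<Sum>i<n. \<Sum>j<n. A i j * real (l j) ^ 2) = (\<Sum>i<n. \<Sum>j<n. A i j * real (l i) ^ 2)"
    by (subst sum.swap) (simp add: A_sym)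
  also have "(\<Sum>i<n. \<Sum>j<n. A i j * real (k i) ^ 2) / R + (\<Sum>i<n. \<Sum>j<n. A i j * real (l i) ^ 2) / R
      + (\<Sum>i<n. \<Sum>j<n. ?bal i j) \<le> \<Delta> * X / R + \<Delta> * X / R + (16 * \<alpha> * X ^ 2 / h + 32 * \<beta> * R * X)"
    using pos by (intro add_mono divide_right_mono weighted_degrees k l
        balanced_heavy_pairs_le[OF A0 disc]) auto
  finally show ?thesis by (simp add: mult_ac)
qed

section \<open>Reduction of the bilinear norm to a lattice ball\<close>

text \<open>Rounding each coordinate up or down according to the sign of \<open>c\<close> cannot decrease the linear form
  given by \<open>c\<close>, and it moves each coordinate by at most 1.\<close>

lemma round_towards:
  fixes u c :: "nat \<Rightarrow> real"
  obtains k :: "nat \<Rightarrow> int"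
  where "\<And>i. c i * u i \<le> c i * of_int (k i)" "\<And>i. of_int (k i) ^ 2 \<le> 2 * u i ^ 2 + (2::real)"
proof
  define k where "k i = (if 0 \<le> c i then \<lceil>u i\<rceil> else \<lfloor>u i\<rfloor>)" for i
  fix i
  show "c i * u i \<le> c i * of_int (k i)"
    by (auto simp: k_def mult_left_mono mult_left_mono_neg)
  define d where "d = of_int (k i) - u i"
  have "\<bar>d\<bar> \<le> 1" unfolding d_def k_def by (cases "0 \<le> c i"; simp; linarith)
  then have d: "d ^ 2 \<le> 1" by (simp add: abs_square_le_1)
  have "of_int (k i) ^ 2 = (u i + d) ^ 2" by (simp add: d_def)
  also have "\<dots> \<le> 2 * u i ^ 2 + 2 * d ^ 2"
    using sum_squares_bound[of "u i" d] by (simp add: power2_sum)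
  finally show "of_int (k i) ^ 2 \<le> 2 * u i ^ 2 + (2::real)" using d by linarith
qed

text \<open>A bilinear form is linear in each argument, so both arguments, scaled to norm \<open>sqrt n\<close>, may be
  rounded to lattice points one after the other without decreasing the form. Rounding changes the
  squared norm from \<open>n\<close> to at most \<open>4 n\<close>. Unlike an approximation by a net this loses nothing but
  the radius.\<close>

lemma bilinear_norm_le_lattice:
  fixes N :: "nat \<Rightarrow> nat \<Rightarrow> real"
  assumes lattice: "\<And>k l :: nat \<Rightarrow> int. (\<Sum>i<n. real_of_int (k i) ^ 2) \<le> 4 * real n \<Longrightarrow>
      (\<Sum>i<n. real_of_int (l i) ^ 2) \<le> 4 * real n \<Longrightarrow>
      (\<Sum>i<n. \<Sum>j<n. N i j * (of_int (k i) * of_int (l j))) \<le> K * real n"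
  shows "bilinear_norm_le n N K"
proof (cases "n = 0")
  case True
  then show ?thesis by (simp add: bilinear_norm_le_def)
next
  case False
  then have n: "0 < n" by simp
  have scaled: "(\<Sum>i<n. \<Sum>j<n. N i j * (u i * v j)) \<le> K * real n"
    if u: "(\<Sum>i<n. u i ^ 2) \<le> real n" and v: "(\<Sum>i<n. v i ^ 2) \<le> real n" for u v
  proof -
    have lattice_size: "(\<Sum>i<n. real_of_int (k i) ^ 2) \<le> 4 * real n"
      if "\<And>i. of_int (k i) ^ 2 \<le> 2 * f i ^ 2 + (2::real)" "(\<Sum>i<n. f i ^ 2) \<le> real n" for k f
    proof -
      have "(\<Sum>i<n. real_of_int (k i) ^ 2) \<le> (\<Sum>i<n. 2 * f i ^ 2 + 2)" by (intro sum_mono that)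
      also have "\<dots> \<le> 4 * real n" using that(2) by (simp add: sum.distrib sum_distrib_left[symmetric])
      finally show ?thesis .
    qed
    obtain k where k: "\<And>i. (\<Sum>j<n. N i j * v j) * u i \<le> (\<Sum>j<n. N i j * v j) * of_int (k i)"
      "\<And>i. of_int (k i) ^ 2 \<le> 2 * u i ^ 2 + (2::real)"
      using round_towards[of "\<lambda>i. \<Sum>j<n. N i j * v j" u] by auto
    obtain l where l: "\<And>j. (\<Sum>i<n. N i j * of_int (k i)) * v j
        \<le> (\<Sum>i<n. N i j * of_int (k i)) * of_int (l j)"
      "\<And>i. of_int (l i) ^ 2 \<le> 2 * v i ^ 2 + (2::real)"
      using round_towards[of "\<lambda>j. \<Sum>i<n. N i j * of_int (k i)" v] by auto
    have "(\<Sum>i<n. \<Sum>j<n. N i j * (u i * v j)) = (\<Sum>i<n. (\<Sum>j<n. N i j * v j) * u i)"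
      unfolding sum_distrib_right by (intro sum.cong refl) (simp add: mult_ac)
    also have "\<dots> \<le> (\<Sum>i<n. (\<Sum>j<n. N i j * v j) * of_int (k i))" by (intro sum_mono k)
    also have "\<dots> = (\<Sum>i<n. \<Sum>j<n. N i j * of_int (k i) * v j)"
      unfolding sum_distrib_right by (intro sum.cong refl) (simp add: mult_ac)
    also have "\<dots> = (\<Sum>j<n. (\<Sum>i<n. N i j * of_int (k i)) * v j)"
      by (subst sum.swap) (simp add: sum_distrib_right)
    also have "\<dots> \<le> (\<Sum>j<n. (\<Sum>i<n. N i j * of_int (k i)) * of_int (l j))" by (intro sum_mono l)
    also have "\<dots> = (\<Sum>i<n. \<Sum>j<n. N i j * (of_int (k i) * of_int (l j)))"
      by (subst sum.swap) (simp add: sum_distrib_right mult.assoc)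
    also have "\<dots> \<le> K * real n" by (intro lattice lattice_size[OF k(2) u] lattice_size[OF l(2) v])
    finally show ?thesis .
  qed
  have upper: "(\<Sum>i<n. \<Sum>j<n. N i j * u i * v j) \<le> K * L2_set u {..<n} * L2_set v {..<n}" for u v
  proof (cases "L2_set u {..<n} = 0 \<or> L2_set v {..<n} = 0")
    case True
    then have "(\<forall>i<n. u i = 0) \<or> (\<forall>j<n. v j = 0)" by (auto simp: L2_set_eq_0_iff)
    then have "(\<Sum>i<n. \<Sum>j<n. N i j * u i * v j) = 0" by (auto intro!: sum.neutral)
    then show ?thesis using True by auto
  next
    case False
    define U V where "U = L2_set u {..<n}" and "V = L2_set v {..<n}"
    have UV: "0 < U" "0 < V" using False L2_set_nonneg[of u "{..<n}"] L2_set_nonneg[of v "{..<n}"]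
      unfolding U_def V_def by linarith+
    have norm: "(\<Sum>i<n. (sqrt (real n) / L2_set f {..<n} * f i) ^ 2) \<le> real n"
      if "0 < L2_set f {..<n}" for f
    proof -
      have "(\<Sum>i<n. (sqrt (real n) / L2_set f {..<n} * f i) ^ 2)
          = (\<Sum>i<n. real n / (L2_set f {..<n}) ^ 2 * f i ^ 2)"
        by (intro sum.cong refl) (simp add: power_mult_distrib power_divide)
      also have "\<dots> = real n / (L2_set f {..<n}) ^ 2 * (L2_set f {..<n} * L2_set f {..<n})"
        by (simp only: L2_set_squared sum_distrib_left)
      also have "\<dots> = real n" using that by (simp add: power2_eq_square)
      finally show ?thesis by simp
    qed
    have "(\<Sum>i<n. \<Sum>j<n. N i j * u i * v j) * (real n / (U * V))
        = (\<Sum>i<n. \<Sum>j<n. N i j * ((sqrt (real n) / U * u i) * (sqrt (real n) / V * v j)))"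
      unfolding sum_distrib_right using UV by (intro sum.cong refl) (simp add: field_simps)
    also have "\<dots> \<le> K * real n"
      using UV unfolding U_def V_def by (intro scaled norm)
    finally have "(\<Sum>i<n. \<Sum>j<n. N i j * u i * v j) / (U * V) * real n \<le> K * real n"
      by (simp only: times_divide_eq_left times_divide_eq_right)
    then have "(\<Sum>i<n. \<Sum>j<n. N i j * u i * v j) / (U * V) \<le> K"
      using n by (simp only: mult_le_cancel_right_pos of_nat_0_less_iff)
    then show ?thesis using UV by (simp add: U_def V_def field_simps)
  qed
  show ?thesis unfolding bilinear_norm_le_def
  proof (intro allI)
    fix u v
    have "L2_set (\<lambda>i. - u i) {..<n} = L2_set u {..<n}" by (simp add: L2_set_def)
    then show "\<bar>\<Sum>i<n. \<Sum>j<n. N i j * u i * v j\<bar> \<le> K * L2_set u {..<n} * L2_set v {..<n}"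
      using upper[of u v] upper[of "\<lambda>i. - u i" v] by (simp add: sum_negf abs_le_iff)
  qed
qed

text \<open>The bound \<open>4 n\<close> on single coordinates is implied by the bound on the squared norm; it makes the
  set a subset of a finite product.\<close>

definition lattice_ball :: "nat \<Rightarrow> (nat \<Rightarrow> int) set" where
  "lattice_ball n = {k \<in> PiE {..<n} (\<lambda>_. {- (4 * int n)..4 * int n}).
      (\<Sum>i<n. real_of_int (k i) ^ 2) \<le> 4 * real n}"

lemma finite_lattice_ball: "finite (lattice_ball n)"
  unfolding lattice_ball_def by (rule finite_subset[of _ "PiE {..<n} (\<lambda>_. {- (4 * int n)..4
      * int n})"]) (auto intro: finite_PiE)

lemma restrict_in_lattice_ball:
  assumes "(\<Sum>i<n. real_of_int (k i) ^ 2) \<le> 4 * real n"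
  shows "restrict k {..<n} \<in> lattice_ball n"
proof -
  have "k i \<in> {- (4 * int n)..4 * int n}" if "i < n" for i
  proof -
    have "real_of_int (k i) ^ 2 \<le> (\<Sum>i<n. real_of_int (k i) ^ 2)"
      using that by (intro member_le_sum) auto
    then have "real_of_int ((k i) ^ 2) \<le> real_of_int (4 * int n)" using assms by simp
    then have "(k i) ^ 2 \<le> 4 * int n" by (simp only: of_int_le_iff)
    moreover have "\<bar>k i\<bar> \<le> (k i) ^ 2"
      using self_le_power[of "\<bar>k i\<bar>" 2] by (cases "k i = 0") auto
    ultimately show ?thesis by auto
  qed
  then show ?thesis using assms by (auto simp: lattice_ball_def)
qed

text \<open>The induction hypothesis is strengthened by \<open>2 (1/2)\<^sup>m\<close>, which dominates the tail of the series.\<close>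

lemma sum_exp_neg_squares_le: "(\<Sum>x\<in>{- int m..int m}. exp (- (real_of_int x ^ 2))) \<le> 3"
proof -
  have "(\<Sum>x\<in>{- int m..int m}. exp (- (real_of_int x ^ 2))) \<le> 3 - 2 * (1 / 2) ^ m"
  proof (induction m)
    case 0
    then show ?case by simp
  next
    case (Suc m)
    have split: "{- int (Suc m)..int (Suc m)}
        = insert (int (Suc m)) (insert (- int (Suc m)) {- int m..int m})"
      by auto
    have "real (Suc m) \<le> real (Suc m) ^ 2" by (rule self_le_power) simp_all
    then have "exp (- (real (Suc m) ^ 2)) \<le> exp (- real (Suc m))"
      by (simp only: exp_le_cancel_iff neg_le_iff_le)
    also have "\<dots> = exp (- 1) ^ Suc m" by (metis exp_of_nat_mult mult.right_neutral mult_minus_right)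
    also have "\<dots> \<le> (1 / 2) ^ Suc m"
    proof (rule power_mono)
      show "exp (- 1) \<le> (1 / 2 :: real)"
        using exp_ge_add_one_self[of "1::real"] by (simp add: exp_minus field_simps)
    qed simp
    finally have "exp (- (real (Suc m) ^ 2)) \<le> (1 / 2) ^ Suc m" .
    moreover have "(- 1 - real m) ^ 2 = (1 + real m) ^ 2" by (simp add: power2_eq_square algebra_simps)
    ultimately show ?case using Suc.IH unfolding split by (simp add: algebra_simps)
  qed
  also have "\<dots> \<le> 3" by simp
  finally show ?thesis .
qed

text \<open>Each point of the ball has weight at least \<open>exp (- 4 n)\<close> under \<open>exp (- |k|\<^sup>2)\<close>, while the total
  weight of the lattice is the \<open>n\<close>-th power of a one-dimensional sum.\<close>

lemma card_lattice_ball: "real (card (lattice_ball n)) \<le> exp (6 * real n)"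
proof -
  define w where "w k = (\<Prod>i<n. exp (- (real_of_int (k i) ^ 2)))" for k :: "nat \<Rightarrow> int"
  have "real (card (lattice_ball n)) = (\<Sum>k\<in>lattice_ball n. 1)" by simp
  also have "\<dots> \<le> (\<Sum>k\<in>lattice_ball n. exp (4 * real n) * w k)"
  proof (rule sum_mono)
    fix k assume "k \<in> lattice_ball n"
    then have "0 \<le> 4 * real n + (\<Sum>i<n. - (real_of_int (k i) ^ 2))"
      by (simp add: lattice_ball_def sum_negf)
    then have "1 \<le> exp (4 * real n + (\<Sum>i<n. - (real_of_int (k i) ^ 2)))" by simp
    then show "1 \<le> exp (4 * real n) * w k" by (simp only: w_def exp_add exp_sum[OF finite_lessThan])
  qed
  also have "\<dots> \<le> (\<Sum>k\<in>PiE {..<n} (\<lambda>_. {- int (4 * n)..int (4 * n)}). exp (4 * real n) * w k)"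
    by (intro sum_mono2) (auto simp: lattice_ball_def w_def prod_nonneg intro!: finite_PiE)
  also have "\<dots> = exp (4 * real n) * (\<Prod>i<n. \<Sum>x\<in>{- int (4 * n)..int (4 * n)}. exp (- (real_of_int x ^ 2)))"
    unfolding w_def sum_distrib_left[symmetric] by (subst prod_sum_PiE) auto
  also have "\<dots> \<le> exp (4 * real n) * (\<Prod>i<n. exp 2)"
  proof (intro mult_left_mono prod_mono conjI)
    show "(\<Sum>x\<in>{- int (4 * n)..int (4 * n)}. exp (- (real_of_int x ^ 2))) \<le> exp 2"
      using sum_exp_neg_squares_le[of "4 * n"] exp_ge_add_one_self[of "2::real"] by linarith
  qed (auto intro!: sum_nonneg)
  also have "\<dots> = exp (6 * real n)"
    by (simp add: exp_of_nat_mult[symmetric] exp_add[symmetric] mult.commute)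
  finally show ?thesis .
qed

lemma sum_power_card_Pow:
  fixes x :: real
  assumes "finite A"
  shows "(\<Sum>S\<in>Pow A. x ^ card S) = (1 + x) ^ card A"
  using assms
proof (induction A rule: finite_induct)
  case empty
  then show ?case by simp
next
  case (insert a A)
  have "(\<Sum>S\<in>Pow (insert a A). x ^ card S) = (\<Sum>S\<in>Pow A. x ^ card S) + (\<Sum>S\<in>insert a ` Pow A. x ^ card S)"
    unfolding Pow_insert using insert by (intro sum.union_disjoint) auto
  also have "(\<Sum>S\<in>insert a ` Pow A. x ^ card S) = (\<Sum>S\<in>Pow A. x ^ card (insert a S))"
    using insert by (intro sum.reindex_cong[of "insert a"]) (auto simp: inj_on_def)
  also have "\<dots> = (\<Sum>S\<in>Pow A. x * x ^ card S)"
    using insert by (intro sum.cong refl) (subst card_insert_disjoint, auto intro: finite_subset)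
  finally show ?case using insert by (simp add: sum_distrib_left[symmetric] algebra_simps)
qed

text \<open>The bilinear form of \<open>A - P\<close> is split at products of size \<open>h\<close>. For larger products the
  cancellation between \<open>A\<close> and \<open>P\<close> is given up: the part of \<open>P\<close> is small because \<open>|x| \<le> x\<^sup>2 / h\<close>
  there, and the part of \<open>A\<close> is bounded by \<open>heavy_pairs_le\<close>.\<close>

lemma lattice_form_le:
  fixes A P :: "nat \<Rightarrow> nat \<Rightarrow> real" and k l :: "nat \<Rightarrow> int"
  assumes A0: "\<And>i j. 0 \<le> A i j" and A_sym: "\<And>i j. A i j = A j i"
    and P: "\<And>i j. i < n \<Longrightarrow> j < n \<Longrightarrow> 0 \<le> P i j \<and> P i j \<le> p"
    and deg: "\<And>i. i < n \<Longrightarrow> (\<Sum>j<n. A i j) \<le> \<Delta>"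
    and disc: "\<And>S T. S \<subseteq> {..<n} \<Longrightarrow> T \<subseteq> {..<n} \<Longrightarrow>
      (\<Sum>i\<in>S. \<Sum>j\<in>T. A i j) \<le> \<alpha> * real (card S) * real (card T) + \<beta> * (real (card S) + real (card T))"
    and k: "(\<Sum>i<n. real_of_int (k i) ^ 2) \<le> X" and l: "(\<Sum>i<n. real_of_int (l i) ^ 2) \<le> X"
    and light: "(\<Sum>i<n. \<Sum>j<n. (A i j - P i j) *
      (if \<bar>real_of_int (k i) * of_int (l j)\<bar> \<le> h then of_int (k i) * of_int (l j) else 0)) \<le> t"
    and pos: "0 < h" "0 < R" "0 \<le> \<alpha>" "0 \<le> \<beta>" "0 \<le> \<Delta>" "0 \<le> p"
  shows "(\<Sum>i<n. \<Sum>j<n. (A i j - P i j) * (of_int (k i) * of_int (l j)))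
    \<le> t + p * X ^ 2 / h + 2 * \<Delta> * X / R + 16 * \<alpha> * X ^ 2 / h + 32 * \<beta> * R * X"
proof -
  define k' l' where "k' i = nat \<bar>k i\<bar>" and "l' i = nat \<bar>l i\<bar>" for i
  have k': "real (k' i) = \<bar>real_of_int (k i)\<bar>" "real (l' i) = \<bar>real_of_int (l i)\<bar>" for i
    by (simp_all add: k'_def l'_def)
  have "(\<Sum>i<n. \<Sum>j<n. (A i j - P i j) * (of_int (k i) * of_int (l j)))
     \<le> (\<Sum>i<n. \<Sum>j<n. (A i j - P i j) *
      (if \<bar>real_of_int (k i) * of_int (l j)\<bar> \<le> h then of_int (k i) * of_int (l j) else 0)
      + p / h * (real_of_int (k i) ^ 2 * real_of_int (l j) ^ 2)
      + (if h < real (k' i) * real (l' j) then A i j * (real (k' i) * real (l' j)) else 0))"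
  proof (intro sum_mono)
    fix i j assume "i \<in> {..<n}" "j \<in> {..<n}"
    then have ij: "i < n" "j < n" by auto
    define x where "x = real_of_int (k i) * of_int (l j)"
    have x: "real (k' i) * real (l' j) = \<bar>x\<bar>" "real_of_int (k i) ^ 2 * real_of_int (l j) ^ 2 = x ^ 2"
      by (simp_all add: k' x_def abs_mult power_mult_distrib)
    show "(A i j - P i j) * (of_int (k i) * of_int (l j)) \<le> (A i j - P i j) *
      (if \<bar>real_of_int (k i) * of_int (l j)\<bar> \<le> h then of_int (k i) * of_int (l j) else 0)
      + p / h * (real_of_int (k i) ^ 2 * real_of_int (l j) ^ 2)
      + (if h < real (k' i) * real (l' j) then A i j * (real (k' i) * real (l' j)) else 0)"
      unfolding x x_def[symmetric]
    proof (cases "\<bar>x\<bar> \<le> h")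
      case True
      then show "(A i j - P i j) * x \<le> (A i j - P i j) * (if \<bar>x\<bar> \<le> h then x else 0) + p / h * x ^ 2
          + (if h < \<bar>x\<bar> then A i j * \<bar>x\<bar> else 0)" using pos by simp
    next
      case False
      have "h * \<bar>x\<bar> \<le> \<bar>x\<bar> * \<bar>x\<bar>" using False by (intro mult_right_mono) auto
      then have "p * (h * \<bar>x\<bar>) \<le> p * x ^ 2" using pos
          by (intro mult_left_mono) (auto simp: power2_eq_square)
      then have "p * \<bar>x\<bar> \<le> p / h * x ^ 2" using pos by (simp add: field_simps)
      moreover have "P i j * - x \<le> P i j * \<bar>x\<bar>"
        using P[OF ij] by (intro mult_left_mono) auto
      moreover have "P i j * \<bar>x\<bar> \<le> p * \<bar>x\<bar>" "A i j * x \<le> A i j * \<bar>x\<bar>"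
        using P[OF ij] A0 by (auto intro!: mult_left_mono mult_right_mono)
      ultimately show "(A i j - P i j) * x \<le> (A i j - P i j) * (if \<bar>x\<bar> \<le> h then x else 0) + p / h * x ^ 2
          + (if h < \<bar>x\<bar> then A i j * \<bar>x\<bar> else 0)" using False by (simp add: left_diff_distrib)
    qed
  qed
  also have "\<dots> = (\<Sum>i<n. \<Sum>j<n. (A i j - P i j) *
      (if \<bar>real_of_int (k i) * of_int (l j)\<bar> \<le> h then of_int (k i) * of_int (l j) else 0))
      + p / h * ((\<Sum>i<n. real_of_int (k i) ^ 2) * (\<Sum>j<n. real_of_int (l j) ^ 2))
      + (\<Sum>i<n. \<Sum>j<n. if h < real (k' i) * real (l' j) then A i j * (real (k' i) * real (l' j)) else 0)"
  proof -
    have "(\<Sum>i<n. \<Sum>j<n. p / h * (real_of_int (k i) ^ 2 * real_of_int (l j) ^ 2))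
        = p / h * ((\<Sum>i<n. real_of_int (k i) ^ 2) * (\<Sum>j<n. real_of_int (l j) ^ 2))"
      by (subst sum_product) (simp only: sum_distrib_left)
    then show ?thesis by (simp only: sum.distrib)
  qed
  also have "\<dots> \<le> t + p / h * (X * X) + (2 * \<Delta> * X / R + 16 * \<alpha> * X ^ 2 / h + 32 * \<beta> * R * X)"
  proof (intro add_mono light mult_left_mono mult_mono k l heavy_pairs_le[OF A0 A_sym deg disc])
    show "0 \<le> X" using k by (meson order_trans sum_nonneg zero_le_power2)
  qed (use pos k l in \<open>auto simp: k' intro!: sum_nonneg\<close>)
  finally show ?thesis by (simp add: power2_eq_square)
qed

section \<open>Norm of a centred adjacency matrix\<close>

lemma prob_union_bound:
  assumes "finite X" and "\<And>x. x \<in> X \<Longrightarrow> measure_pmf.prob M {\<omega>. Q x \<omega>} \<le> f x"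
  shows "measure_pmf.prob M {\<omega>. \<exists>x\<in>X. Q x \<omega>} \<le> (\<Sum>x\<in>X. f x)"
proof -
  have "{\<omega>. \<exists>x\<in>X. Q x \<omega>} = (\<Union>x\<in>X. {\<omega>. Q x \<omega>})" by auto
  also have "measure_pmf.prob M \<dots> \<le> (\<Sum>x\<in>X. measure_pmf.prob M {\<omega>. Q x \<omega>})"
    by (rule measure_pmf.finite_measure_subadditive_finite) (use assms in auto)
  also have "\<dots> \<le> (\<Sum>x\<in>X. f x)" by (intro sum_mono assms)
  finally show ?thesis .
qed

text \<open>Since \<open>n p \<ge> 2 ln n\<close>, four times the largest possible mean degree is already too large a
  deviation for any vertex.\<close>

lemma prob_large_degree:
  assumes n: "0 < n" and p: "p \<le> 1" "2 * ln (real n) \<le> real n * p"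
    and a: "\<And>e. e \<in> vertex_pairs n \<Longrightarrow> 0 \<le> a e \<and> a e \<le> p"
  shows "measure_pmf.prob (random_graph n a) {\<omega>. \<exists>i\<in>{..<n}. 4 * (real n * p) \<le> (\<Sum>j<n. adj \<omega> i j)}
      \<le> 1 / real n"
proof -
  have "0 \<le> ln (real n)" using n by simp
  then have "0 \<le> real n * p" using p by linarith
  then have p0: "0 \<le> p" using n by (simp add: zero_le_mult_iff)
  have mean: "0 \<le> sym_ext a i j \<and> sym_ext a i j \<le> p" if "i < n" "j < n" for i j
    using a[of "(min i j, max i j)"] that p0 by (auto simp: sym_ext_def vertex_pairs_def)
  have "measure_pmf.prob (random_graph n a) {\<omega>. 4 * (real n * p) \<le> (\<Sum>j<n. adj \<omega> i j)} \<le> 1 / real n ^ 2"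
    if i: "i < n" for i
  proof -
    have "measure_pmf.prob (random_graph n a) {\<omega>. 4 * (real n * p) \<le> (\<Sum>j<n. adj \<omega> i j * 1)}
      \<le> exp ((\<Sum>j<n. sym_ext a i j * (exp 1 - 1)) - 4 * (real n * p))"
      by (rule vertex_row_Chernoff[OF _ i]) (use a p in \<open>force\<close>)
    also have "\<dots> \<le> exp (- (2 * ln (real n)))"
    proof -
      have "(\<Sum>j<n. sym_ext a i j * (exp 1 - 1)) \<le> (\<Sum>j<n. p * 2)"
        using mean[OF i] exp_le p0 by (intro sum_mono mult_mono) auto
      then show ?thesis using p \<open>0 \<le> ln (real n)\<close> by simp
    qed
    also have "exp (- (2 * ln (real n))) = 1 / real n ^ 2"
      using n by (simp add: exp_minus exp_double inverse_eq_divide power2_eq_square)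
    finally show ?thesis by simp
  qed
  then have "measure_pmf.prob (random_graph n a) {\<omega>. \<exists>i\<in>{..<n}. 4 * (real n * p) \<le> (\<Sum>j<n. adj \<omega> i j)}
    \<le> (\<Sum>i<n. 1 / real n ^ 2)"
    by (intro prob_union_bound) auto
  also have "\<dots> = 1 / real n" using n by (simp add: power2_eq_square)
  finally show ?thesis .
qed

text \<open>The excess \<open>6 ln n / \<theta>\<close> per vertex makes each pair of sets fail with probability \<open>n\<^sup>-\<^sup>3\<close> per
  vertex, which beats the number of pairs of sets; nonemptiness of both sets provides the final
  factor \<open>n\<^sup>-\<^sup>2\<close>.\<close>

lemma prob_discrepancy:
  assumes n: "9 \<le> n" and p: "0 \<le> p" "p \<le> 1" and \<theta>: "1 \<le> \<theta>"
    and a: "\<And>e. e \<in> vertex_pairs n \<Longrightarrow> 0 \<le> a e \<and> a e \<le> p"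
  shows "measure_pmf.prob (random_graph n a) {\<omega>. \<exists>x\<in>(Pow {..<n} - {{}}) \<times> (Pow {..<n} - {{}}).
      exp \<theta> * p * real (card (fst x)) * real (card (snd x))
        + 6 * ln (real n) / \<theta> * (real (card (fst x)) + real (card (snd x)))
      \<le> (\<Sum>i\<in>fst x. \<Sum>j\<in>snd x. adj \<omega> i j)} \<le> 1 / real n"
proof -
  define y where "y = 1 / real n ^ 2"
  have y: "0 \<le> y" by (simp add: y_def)
  have y_exp: "exp (- (2 * ln (real n))) = y"
    using n by (simp add: y_def exp_minus exp_double inverse_eq_divide power2_eq_square)
  have ln0: "0 \<le> ln (real n)" using n by simp
  have pair: "measure_pmf.prob (random_graph n a) {\<omega>. exp \<theta> * p * real (card S) * real (card T)
        + 6 * ln (real n) / \<theta> * (real (card S) + real (card T)) \<le> (\<Sum>i\<in>S. \<Sum>j\<in>T. adj \<omega> i j)}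
      \<le> y * (y ^ card S * y ^ card T)"
    if ST: "S \<in> Pow {..<n} - {{}}" "T \<in> Pow {..<n} - {{}}" for S T
  proof -
    define m where "m = real (card S) + real (card T)"
    have "0 < card S" "0 < card T" using ST by (auto simp: card_gt_0_iff intro: finite_subset)
    then have m: "2 \<le> m" unfolding m_def by linarith
    have "measure_pmf.prob (random_graph n a) {\<omega>. exp \<theta> * p * real (card S) * real (card T)
        + 2 * (3 * m * ln (real n)) / \<theta> \<le> (\<Sum>i\<in>S. \<Sum>j\<in>T. adj \<omega> i j)} \<le> exp (- (3 * m * ln (real n)))"
      by (rule edge_count_Chernoff) (use a p \<theta> ST in auto)
    also have "exp (- (3 * m * ln (real n))) \<le> exp (- (2 * ln (real n)) + m * - (2 * ln (real n)))"
      using mult_right_mono[OF m ln0] by (simp add: algebra_simps)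
    also have "\<dots> = y * (exp (real (card S) * - (2 * ln (real n)))
        * exp (real (card T) * - (2 * ln (real n))))"
      unfolding exp_add y_exp m_def distrib_right by simp
    also have "\<dots> = y * (y ^ card S * y ^ card T)"
      unfolding exp_of_nat_mult y_exp ..
    finally have tail: "measure_pmf.prob (random_graph n a) {\<omega>. exp \<theta> * p * real (card S) * real (card T)
        + 2 * (3 * m * ln (real n)) / \<theta> \<le> (\<Sum>i\<in>S. \<Sum>j\<in>T. adj \<omega> i j)} \<le> y * (y ^ card S * y ^ card T)" .
    have "2 * (3 * m * ln (real n)) / \<theta> = 6 * ln (real n) / \<theta> * m" by simp
    from tail[unfolded this] show ?thesis unfolding m_def .
  qed
  have "measure_pmf.prob (random_graph n a) {\<omega>. \<exists>x\<in>(Pow {..<n} - {{}}) \<times> (Pow {..<n} - {{}}).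
      exp \<theta> * p * real (card (fst x)) * real (card (snd x))
        + 6 * ln (real n) / \<theta> * (real (card (fst x)) + real (card (snd x)))
      \<le> (\<Sum>i\<in>fst x. \<Sum>j\<in>snd x. adj \<omega> i j)}
    \<le> (\<Sum>x\<in>(Pow {..<n} - {{}}) \<times> (Pow {..<n} - {{}}). y * (y ^ card (fst x) * y ^ card (snd x)))"
    by (intro prob_union_bound pair) (auto simp: mem_Times_iff)
  also have "\<dots> \<le> (\<Sum>x\<in>Pow {..<n} \<times> Pow {..<n}. y * (y ^ card (fst x) * y ^ card (snd x)))"
    using y by (intro sum_mono2) auto
  also have "\<dots> = y * ((\<Sum>S\<in>Pow {..<n}. y ^ card S) * (\<Sum>T\<in>Pow {..<n}. y ^ card T))"
    by (subst sum_product) (simp add: sum_distrib_left sum.cartesian_product case_prod_unfold)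
  also have "\<dots> = y * ((1 + y) ^ n * (1 + y) ^ n)" by (simp add: sum_power_card_Pow)
  also have "\<dots> \<le> y * (3 * 3)"
  proof -
    have "(1 + y) ^ n \<le> exp y ^ n" using y exp_ge_add_one_self[of y] by (intro power_mono) auto
    also have "\<dots> = exp (1 / real n)"
      using n by (simp add: exp_of_nat_mult[symmetric] y_def power2_eq_square)
    also have "\<dots> \<le> exp 1" using n by simp
    also have "\<dots> \<le> 3" by (rule exp_le)
    finally have "(1 + y) ^ n \<le> 3" .
    then show ?thesis using y by (intro mult_left_mono mult_mono) auto
  qed
  also have "\<dots> \<le> 1 / real n" using n by (simp add: y_def power2_eq_square field_simps)
  finally show ?thesis .
qed

text \<open>For products up to \<open>h\<close> the exponent of the Chernoff bound with \<open>l = 1 / (2 h)\<close> is at most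
  \<open>n - 20 n\<close>, which beats the \<open>exp (12 n)\<close> pairs of lattice points.\<close>

lemma prob_light_pairs:
  assumes n: "0 < n" and p: "0 \<le> p" "p \<le> 1"
    and a: "\<And>e. e \<in> vertex_pairs n \<Longrightarrow> 0 \<le> a e \<and> a e \<le> p"
    and h: "0 < h" "8 * (real n * p) \<le> h ^ 2" and t: "40 * real n * h \<le> t"
  shows "measure_pmf.prob (random_graph n a) {\<omega>. \<exists>x\<in>lattice_ball n \<times> lattice_ball n.
      t \<le> (\<Sum>i<n. \<Sum>j<n. (adj \<omega> i j - sym_ext a i j) *
        (if \<bar>real_of_int (fst x i) * of_int (snd x j)\<bar>
            \<le> h then of_int (fst x i) * of_int (snd x j) else 0))}
    \<le> 1 / real n"
proof -
  have pair: "measure_pmf.prob (random_graph n a) {\<omega>. t \<le> (\<Sum>i<n. \<Sum>j<n. (adj \<omega> i j - sym_ext a i j) *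
        (if \<bar>real_of_int (k i) * of_int (l j)\<bar> \<le> h then of_int (k i) * of_int (l j) else 0))}
            \<le> exp (- (19 * real n))"
    if kl: "k \<in> lattice_ball n" "l \<in> lattice_ball n" for k l
  proof -
    define c where "c i j = (if \<bar>real_of_int (k i) * of_int (l j)\<bar>
        \<le> h then real_of_int (k i) * of_int (l j) else 0)" for i j
    have "measure_pmf.prob (random_graph n a) {\<omega>. t \<le> (\<Sum>i<n. \<Sum>j<n. (adj \<omega> i j - sym_ext a i j) * c i j)}
      \<le> exp (2 * p * (1 / (2 * h)) ^ 2 * (\<Sum>i<n. \<Sum>j<n. c i j ^ 2) - 1 / (2 * h) * t)"
      by (rule centred_form_Chernoff[where h = h]) (use a p h in \<open>auto simp: c_def\<close>)
    also have "\<dots> \<le> exp (- (19 * real n))"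
    proof -
      have "(\<Sum>i<n. \<Sum>j<n. c i j ^ 2) \<le> (\<Sum>i<n. \<Sum>j<n. real_of_int (k i) ^ 2 * real_of_int (l j) ^ 2)"
        by (intro sum_mono) (auto simp: c_def power_mult_distrib)
      also have "\<dots> = (\<Sum>i<n. real_of_int (k i) ^ 2) * (\<Sum>j<n. real_of_int (l j) ^ 2)"
        by (simp add: sum_product)
      also have "\<dots> \<le> (4 * real n) * (4 * real n)"
        using kl by (intro mult_mono sum_nonneg) (simp_all add: lattice_ball_def)
      finally have "2 * p * (1 / (2 * h)) ^ 2 * (\<Sum>i<n. \<Sum>j<n. c i j ^ 2)
          \<le> 2 * p * (1 / (2 * h)) ^ 2 * ((4 * real n) * (4 * real n))"
        using p by (intro mult_left_mono) auto
      also have "\<dots> = (8 * (real n * p)) / h ^ 2 * real n"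
        by (simp add: power2_eq_square field_simps)
      also have "\<dots> \<le> 1 * real n" using h by (intro mult_right_mono) (auto simp: field_simps)
      finally have variance: "2 * p * (1 / (2 * h)) ^ 2 * (\<Sum>i<n. \<Sum>j<n. c i j ^ 2) \<le> real n" by simp
      have "20 * real n \<le> 1 / (2 * h) * t" using h t by (simp add: field_simps)
      then show ?thesis using variance by simp
    qed
    finally show ?thesis by (simp add: c_def)
  qed
  have "measure_pmf.prob (random_graph n a) {\<omega>. \<exists>x\<in>lattice_ball n \<times> lattice_ball n.
      t \<le> (\<Sum>i<n. \<Sum>j<n. (adj \<omega> i j - sym_ext a i j) *
        (if \<bar>real_of_int (fst x i) * of_int (snd x j)\<bar>
            \<le> h then of_int (fst x i) * of_int (snd x j) else 0))}
    \<le> (\<Sum>x\<in>lattice_ball n \<times> lattice_ball n. exp (- (19 * real n)))"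
    by (intro prob_union_bound pair) (auto simp: finite_lattice_ball)
  also have "\<dots> = real (card (lattice_ball n)) * real (card (lattice_ball n)) * exp (- (19 * real n))"
    by (simp add: card_cartesian_product)
  also have "\<dots> \<le> exp (6 * real n) * exp (6 * real n) * exp (- (19 * real n))"
    by (intro mult_right_mono mult_mono card_lattice_ball) auto
  also have "\<dots> = exp (- (7 * real n))" by (simp add: exp_add[symmetric])
  also have "\<dots> \<le> 1 / real n"
  proof -
    have "real n \<le> exp (7 * real n)" using exp_ge_add_one_self[of "7 * real n"] by linarith
    then show ?thesis using n by (simp add: exp_minus inverse_eq_divide frac_le)
  qed
  finally show ?thesis .
qed

text \<open>Put \<open>s = sqrt (d ln n)\<close> with \<open>d = n p\<close>. The light pairs use half of the target \<open>\<kappa> s n\<close>, which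
  dictates \<open>h = \<kappa> s / 80\<close>, and each of the four error terms of \<open>lattice_form_le\<close> gets an eighth.
  The terms with \<open>h\<close> in the denominator are of order \<open>s / ln n\<close>, hence negligible for large \<open>n\<close>.
  The degree term is of order \<open>d / R\<close>, which fixes \<open>R = Q d / s\<close> with \<open>Q = 256 / \<kappa>\<close>; the term with
  \<open>\<beta> = 6 ln n / \<theta>\<close> is then of order \<open>Q s / \<theta>\<close>, which a large constant \<open>\<theta>\<close> makes small.\<close>

theorem random_graph_norm:
  fixes \<kappa> :: real
  assumes \<kappa>: "0 < \<kappa>"
  shows "\<forall>\<^sub>F n in sequentially. \<forall>p a. p \<le> 1 \<longrightarrow> 2 * ln (real n) \<le> real n * p \<longrightarrow>
    (\<forall>e\<in>vertex_pairs n. 0 \<le> a e \<and> a e \<le> p) \<longrightarrow>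
    measure_pmf.prob (random_graph n a) {\<omega>. \<not> bilinear_norm_le n (\<lambda>i j. adj \<omega> i j - sym_ext a i j)
        (\<kappa> * sqrt (real n * p * ln (real n)))} \<le> 3 / real n"
proof -
  define Q where "Q = 256 / \<kappa>"
  define \<theta> where "\<theta> = max 1 (6144 * Q / \<kappa>)"
  define \<Lambda> where "\<Lambda> = 163840 * exp \<theta> / \<kappa> ^ 2"
  have Q: "0 < Q" using \<kappa> by (simp add: Q_def)
  have \<theta>: "1 \<le> \<theta>" "6144 * Q / \<kappa> \<le> \<theta>" by (simp_all add: \<theta>_def)
  have "filterlim (\<lambda>n. ln (real n)) at_top sequentially"
    by (rule filterlim_compose[OF ln_at_top filterlim_real_sequentially])
  then have "\<forall>\<^sub>F n in sequentially. max \<Lambda> 1 \<le> ln (real n)" unfolding filterlim_at_top by blast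
  then show ?thesis using eventually_ge_at_top[of 9]
  proof eventually_elim
    case (elim n)
    define L where "L = ln (real n)"
    have L: "\<Lambda> \<le> L" "1 \<le> L" and n: "9 \<le> n" using elim by (auto simp: L_def)
    show ?case
    proof (intro allI impI)
      fix p :: real and a :: "nat \<times> nat \<Rightarrow> real"
      assume p1: "p \<le> 1" and np: "2 * ln (real n) \<le> real n * p"
        and a: "\<forall>e\<in>vertex_pairs n. 0 \<le> a e \<and> a e \<le> p"
      define d where "d = real n * p"
      define s where "s = sqrt (d * L)"
      define h where "h = \<kappa> * s / 80"
      define t where "t = \<kappa> * s * real n / 2"
      define R where "R = Q * d / s"
      have d: "0 < d" using np L by (simp add: d_def L_def)
      then have p0: "0 \<le> p" using n by (simp add: d_def zero_less_mult_iff)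
      have s: "0 < s" "s ^ 2 = d * L" using d L by (auto simp: s_def)
      have d_eq: "d = s ^ 2 / L" using s L by simp
      have h: "0 < h" and R: "0 < R" using \<kappa> s d Q by (simp_all add: h_def R_def)
      have LK: "163840 * exp \<theta> \<le> \<kappa> ^ 2 * L"
        using L \<kappa> by (simp add: \<Lambda>_def field_simps)
      have "1 \<le> exp \<theta>" using \<theta> by simp
      then have LK': "163840 \<le> \<kappa> ^ 2 * L" using LK by linarith
      define deg disc light where
        "deg = {\<omega>. \<exists>i\<in>{..<n}. 4 * (real n * p) \<le> (\<Sum>j<n. adj \<omega> i j)}" and
        "disc = {\<omega>. \<exists>x\<in>(Pow {..<n} - {{}}) \<times> (Pow {..<n} - {{}}).
          exp \<theta> * p * real (card (fst x)) * real (card (snd x))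
            + 6 * ln (real n) / \<theta> * (real (card (fst x)) + real (card (snd x)))
          \<le> (\<Sum>i\<in>fst x. \<Sum>j\<in>snd x. adj \<omega> i j)}" and
        "light = {\<omega>. \<exists>x\<in>lattice_ball n \<times> lattice_ball n.
          t \<le> (\<Sum>i<n. \<Sum>j<n. (adj \<omega> i j - sym_ext a i j) *
            (if \<bar>real_of_int (fst x i) * of_int (snd x j)\<bar>
                \<le> h then of_int (fst x i) * of_int (snd x j) else 0))}"
      have prob_deg: "measure_pmf.prob (random_graph n a) deg \<le> 1 / real n"
        unfolding deg_def using n p1 np a by (intro prob_large_degree) auto
      have prob_disc: "measure_pmf.prob (random_graph n a) disc \<le> 1 / real n"
        unfolding disc_def using n p1 p0 a \<theta> by (intro prob_discrepancy) auto
      have prob_light: "measure_pmf.prob (random_graph n a) light \<le> 1 / real n"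
        unfolding light_def
      proof (rule prob_light_pairs)
        have "8 * d * 6400 \<le> d * (\<kappa> ^ 2 * L)" using mult_left_mono[OF LK', of d] d by simp
        also have "\<dots> = \<kappa> ^ 2 * s ^ 2" using s by simp
        finally show "8 * (real n * p) \<le> h ^ 2"
          by (simp add: h_def d_def power_mult_distrib power_divide)
      qed (use n p0 p1 a h in \<open>auto simp: t_def h_def\<close>)
      have norm: "bilinear_norm_le n (\<lambda>i j. adj \<omega> i j - sym_ext a i j) (\<kappa> * s)"
        if good: "\<omega> \<notin> deg" "\<omega> \<notin> disc" "\<omega> \<notin> light" for \<omega>
      proof (rule bilinear_norm_le_lattice)
        fix k l :: "nat \<Rightarrow> int"
        assume k: "(\<Sum>i<n. real_of_int (k i) ^ 2) \<le> 4 * real n"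
            and l: "(\<Sum>i<n. real_of_int (l i) ^ 2) \<le> 4 * real n"
        have "(\<Sum>i<n. \<Sum>j<n. (adj \<omega> i j - sym_ext a i j) * (of_int (k i) * of_int (l j)))
          \<le> t + p * (4 * real n) ^ 2 / h + 2 * (4 * d) * (4 * real n) / R
            + 16 * (exp \<theta> * p) * (4 * real n) ^ 2 / h + 32 * (6 * L / \<theta>) * R * (4 * real n)"
        proof (rule lattice_form_le[OF _ _ _ _ _ k l])
          show "0 \<le> adj \<omega> i j" "adj \<omega> i j = adj \<omega> j i" for i j
            using adj_range adj_commute by auto
          show "0 \<le> sym_ext a i j \<and> sym_ext a i j \<le> p" if "i < n" "j < n" for i j
            using bspec[OF a, of "(min i j, max i j)"] that p0
                by (auto simp: sym_ext_def vertex_pairs_def)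
          show "(\<Sum>j<n. adj \<omega> i j) \<le> 4 * d" if "i < n" for i
            using good(1) that by (auto simp: deg_def d_def not_le intro: less_imp_le)
          show "(\<Sum>i\<in>S. \<Sum>j\<in>T. adj \<omega> i j)
              \<le> exp \<theta> * p * real (card S) * real (card T) + 6 * L / \<theta> * (real (card S) + real (card T))"
            if "S \<subseteq> {..<n}" "T \<subseteq> {..<n}" for S T
          proof (cases "S = {} \<or> T = {}")
            case True
            then show ?thesis using \<theta> L by auto
          next
            case False
            then have "(S, T) \<in> (Pow {..<n} - {{}}) \<times> (Pow {..<n} - {{}})" using that by auto
            then have "\<not> exp \<theta> * p * real (card S) * real (card T) + 6 * L / \<theta>
                * (real (card S) + real (card T))
                \<le> (\<Sum>i\<in>S. \<Sum>j\<in>T. adj \<omega> i j)"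
              using good(2) unfolding disc_def L_def mem_Collect_eq bex_simps
                  by (metis fst_conv snd_conv)
            then show ?thesis by simp
          qed
          show "(\<Sum>i<n. \<Sum>j<n. (adj \<omega> i j - sym_ext a i j) *
              (if \<bar>real_of_int (k i) * of_int (l j)\<bar> \<le> h then of_int (k i) * of_int (l j) else 0)) \<le> t"
          proof -
            have inside: "(restrict k {..<n}, restrict l {..<n}) \<in> lattice_ball n \<times> lattice_ball n"
              using k l restrict_in_lattice_ball by auto
            have "\<not> t \<le> (\<Sum>i<n. \<Sum>j<n. (adj \<omega> i j - sym_ext a i j) *
              (if \<bar>real_of_int (restrict k {..<n} i) * of_int (restrict l {..<n} j)\<bar> \<le> h
                then of_int (restrict k {..<n} i) * of_int (restrict l {..<n} j) else 0))"
                    (is "\<not> ?large")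
            proof
              assume ?large
              then have "\<omega> \<in> light"
                unfolding light_def mem_Collect_eq
                    by (intro bexI[OF _ inside]) (simp only: fst_conv snd_conv)
              then show False using good(3) by blast
            qed
            then show ?thesis by (simp cong: if_cong)
          qed
        qed (use h R \<theta> L d p0 in auto)
        also have "\<dots> \<le> \<kappa> * s * real n"
        proof -
          have hd: "d / h = 80 * s / (\<kappa> * L)"
            using s(1) L \<kappa> by (simp add: h_def d_eq power2_eq_square mult.commute)
          have b1: "p * (4 * real n) ^ 2 / h \<le> \<kappa> * s * real n / 8"
          proof -
            have "p * (4 * real n) ^ 2 / h = 16 * real n * (d / h)" by (simp add: d_def power2_eq_square)
            also have "\<dots> = 1280 * real n * s / (\<kappa> * L)" by (simp add: hd)
            also have "\<dots> \<le> \<kappa> * s * real n / 8"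
              using mult_right_mono[OF LK', of "s * real n"] s(1) L \<kappa>
              by (simp add: field_simps power2_eq_square)
            finally show ?thesis .
          qed
          have b2: "2 * (4 * d) * (4 * real n) / R = \<kappa> * s * real n / 8"
            using d s(1) \<kappa> by (simp add: R_def Q_def)
          have b3: "16 * (exp \<theta> * p) * (4 * real n) ^ 2 / h \<le> \<kappa> * s * real n / 8"
          proof -
            have "16 * (exp \<theta> * p) * (4 * real n) ^ 2 / h = 256 * exp \<theta> * real n * (d / h)"
              by (simp add: d_def power2_eq_square)
            also have "\<dots> = 20480 * exp \<theta> * real n * s / (\<kappa> * L)" by (simp add: hd)
            also have "\<dots> \<le> \<kappa> * s * real n / 8"
              using mult_right_mono[OF LK, of "s * real n"] s(1) L \<kappa>
              by (simp add: field_simps power2_eq_square)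
            finally show ?thesis .
          qed
          have b4: "32 * (6 * L / \<theta>) * R * (4 * real n) \<le> \<kappa> * s * real n / 8"
          proof -
            have "R * L = Q * s" using s(1) L by (simp add: R_def d_eq power2_eq_square)
            then have "32 * (6 * L / \<theta>) * R * (4 * real n) = 768 * Q * s * real n / \<theta>"
              using \<theta> by (simp add: field_simps)
            also have "\<dots> \<le> \<kappa> * s * real n / 8"
            proof -
              have "6144 * Q \<le> \<kappa> * \<theta>" using \<theta>(2) \<kappa> by (simp add: field_simps)
              from mult_right_mono[OF this, of "s * real n"] show ?thesis
                using s(1) \<theta>(1) by (simp add: field_simps)
            qed
            finally show ?thesis .
          qed
          show ?thesis using b1 b2 b3 b4 by (simp add: t_def)
        qed
        finally show "(\<Sum>i<n. \<Sum>j<n. (adj \<omega> i j - sym_ext a i j) * (of_int (k i) * of_int (l j)))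
            \<le> \<kappa> * s * real n" .
      qed
      have "measure_pmf.prob (random_graph n a)
          {\<omega>. \<not> bilinear_norm_le n (\<lambda>i j. adj \<omega> i j - sym_ext a i j) (\<kappa> * s)}
          \<le> measure_pmf.prob (random_graph n a) (deg \<union> disc \<union> light)"
        using norm by (intro measure_pmf.finite_measure_mono) auto
      also have "\<dots> \<le> measure_pmf.prob (random_graph n a) deg + measure_pmf.prob (random_graph n a) disc
          + measure_pmf.prob (random_graph n a) light"
        using measure_Un_le[of "deg \<union> disc" "measure_pmf (random_graph n a)" light]
          measure_Un_le[of deg "measure_pmf (random_graph n a)" disc] by simp
      also have "\<dots> \<le> 1 / real n + 1 / real n + 1 / real n"
        by (intro add_mono prob_deg prob_disc prob_light)
      finally show "measure_pmf.prob (random_graph n a)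
          {\<omega>. \<not> bilinear_norm_le n (\<lambda>i j. adj \<omega> i j - sym_ext a i j)
        (\<kappa> * sqrt (real n * p * ln (real n)))} \<le> 3 / real n"
        by (simp add: s_def d_def L_def)
    qed
  qed
qed

section \<open>Signed degrees above the threshold\<close>

text \<open>Here \<open>\<sigma>\<close> is the tilt for which \<open>p' exp (- \<sigma>) = q' exp \<sigma> = sqrt (p' q')\<close>. Replacing \<open>p\<close> and \<open>q\<close> by
  \<open>p'\<close> and \<open>q'\<close> in the exponent leaves the square \<open>(sqrt p' - sqrt q')\<^sup>2\<close> and a term
  \<open>\<delta> (p - q) (exp \<sigma> - exp (- \<sigma>)) \<ge> \<epsilon> (p - q) \<sigma>\<close>. Half of the latter pays for the required degree,
  and the other half is at least a multiple of \<open>L\<close>, as \<open>\<sigma> \<ge> 1 - sqrt q' / sqrt p'\<close> implies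
  \<open>(p - q) \<sigma> \<ge> (sqrt p' - sqrt q')\<^sup>2\<close>.\<close>

lemma threshold_consequences:
  fixes n p q \<delta> \<epsilon> L :: real
  assumes n: "0 < n" and L: "0 < L" and pq: "0 \<le> q" "q < p" "p \<le> 1"
    and \<delta>: "0 < \<epsilon>" "\<epsilon> \<le> \<delta>" "\<delta> < 1 / 2"
  defines "p' \<equiv> p - \<delta> * (p - q)" and "q' \<equiv> q + \<delta> * (p - q)"
  defines "\<sigma> \<equiv> ln (sqrt p' / sqrt q')"
  assumes thr: "2 * L \<le> n * (sqrt p' - sqrt q')\<^sup>2"
  shows "2 * L \<le> n * p" "sqrt (n * p * L) \<le> n * (p - q)" "0 \<le> \<sigma>"
    "n / 2 * (p * (exp (- \<sigma>) - 1) + q * (exp \<sigma> - 1)) + \<sigma> * (\<epsilon> / 2 * ((p - q) / 2) * n)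
        \<le> - ((1 + \<epsilon> / 2) * L)"
proof -
  define x y where "x = sqrt p'" and "y = sqrt q'"
  have gap: "0 < \<delta> * (p - q)" "p' - q' = (1 - 2 * \<delta>) * (p - q)"
    using pq \<delta> by (auto simp: p'_def q'_def algebra_simps)
  then have q': "0 < q'" using pq by (simp add: q'_def)
  have "0 < (1 - 2 * \<delta>) * (p - q)" using pq \<delta> by simp
  then have "q' < p'" using gap by linarith
  then have xy: "0 < y" "y < x" using q' by (auto simp: x_def y_def)
  have sq: "x\<^sup>2 = p'" "y\<^sup>2 = q'" using q' \<open>q' < p'\<close> by (auto simp: x_def y_def)
  have thr': "2 * L \<le> n * (x - y)\<^sup>2" using thr by (simp add: x_def y_def)
  have "(x - y)\<^sup>2 \<le> x\<^sup>2" using xy by (intro power_mono) auto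
  also have "\<dots> \<le> p" using gap by (simp add: sq p'_def)
  finally have "n * (x - y)\<^sup>2 \<le> n * p" using n by simp
  then show "2 * L \<le> n * p" using thr' by linarith
  have diff: "(x - y) * (x + y) \<le> p - q"
  proof -
    have "(x - y) * (x + y) = p' - q'" by (simp add: sq[symmetric] power2_eq_square algebra_simps)
    also have "\<dots> \<le> p - q" using gap mult_right_mono[of "1 - 2 * \<delta>" 1 "p - q"] pq \<delta> by simp
    finally show ?thesis .
  qed
  show "sqrt (n * p * L) \<le> n * (p - q)"
  proof (rule real_le_lsqrt)
    have "p \<le> p' + q'" using pq by (simp add: p'_def q'_def)
    also have "\<dots> \<le> (x + y)\<^sup>2" using xy by (simp add: sq[symmetric] power2_sum)
    finally have p: "p \<le> (x + y)\<^sup>2" .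
    have "n * p * L \<le> n * p * (n * (x - y)\<^sup>2)"
      using thr' L n pq by (intro mult_left_mono) auto
    also have "\<dots> \<le> n * (x + y)\<^sup>2 * (n * (x - y)\<^sup>2)"
      using p n by (intro mult_right_mono mult_left_mono) auto
    also have "\<dots> = (n * ((x - y) * (x + y)))\<^sup>2"
        by (simp add: power_mult_distrib power2_eq_square mult_ac)
    also have "\<dots> \<le> (n * (p - q))\<^sup>2"
      using diff n xy by (intro power_mono mult_left_mono) auto
    finally show "n * p * L \<le> (n * (p - q))\<^sup>2" .
  qed (use n pq in auto)
  have \<sigma>: "exp \<sigma> = x / y" "exp (- \<sigma>) = y / x"
    using xy by (simp_all add: \<sigma>_def x_def y_def exp_minus)
  show \<sigma>0: "0 \<le> \<sigma>" using xy by (simp add: \<sigma>_def x_def[symmetric] y_def[symmetric])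
  have \<sigma>_lower: "(x - y) / x \<le> \<sigma>"
    using exp_ge_add_one_self[of "- \<sigma>"] xy by (simp add: \<sigma>(2) diff_divide_distrib)
  have tilt: "p * (exp (- \<sigma>) - 1) + q * (exp \<sigma> - 1) = - (x - y)\<^sup>2 - \<delta> * (p - q) * (exp \<sigma> - exp (- \<sigma>))"
  proof -
    have "p * exp (- \<sigma>) + q * exp \<sigma>
        = p' * exp (- \<sigma>) + q' * exp \<sigma> - \<delta> * (p - q) * (exp \<sigma> - exp (- \<sigma>))"
      by (simp add: p'_def q'_def algebra_simps)
    also have "p' * exp (- \<sigma>) + q' * exp \<sigma> = 2 * x * y"
      using xy by (simp add: \<sigma> sq[symmetric] power2_eq_square)
    finally show ?thesis using sq by (simp add: p'_def q'_def power2_diff algebra_simps)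
  qed
  have "exp (- \<sigma>) \<le> 1" "1 + \<sigma> \<le> exp \<sigma>" using \<sigma>0 exp_ge_add_one_self[of \<sigma>] by auto
  then have "\<sigma> \<le> exp \<sigma> - exp (- \<sigma>)" by linarith
  then have "\<epsilon> * (p - q) * \<sigma> \<le> \<delta> * (p - q) * (exp \<sigma> - exp (- \<sigma>))"
    using \<delta> pq \<sigma>0 by (intro mult_mono) auto
  then have "n / 2 * (p * (exp (- \<sigma>) - 1) + q * (exp \<sigma> - 1)) \<le> n / 2 * (- (x - y)\<^sup>2 - \<epsilon> * (p - q) * \<sigma>)"
    unfolding tilt using n by (intro mult_left_mono) auto
  also have "\<dots> = - (n * (x - y)\<^sup>2) / 2 - \<epsilon> / 2 * (n * ((p - q) * \<sigma>))"
    by (simp add: field_simps)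
  finally have "n / 2 * (p * (exp (- \<sigma>) - 1) + q * (exp \<sigma> - 1)) + \<sigma> * (\<epsilon> / 2 * ((p - q) / 2) * n)
      \<le> - (n * (x - y)\<^sup>2) / 2 - \<epsilon> / 4 * (n * ((p - q) * \<sigma>))"
    by (simp add: field_simps)
  also have "\<dots> \<le> - L - \<epsilon> / 4 * (2 * L)"
  proof -
    have "(x - y)\<^sup>2 = (x - y) * x * ((x - y) / x)" using xy by (simp add: power2_eq_square)
    also have "\<dots> \<le> (x - y) * (x + y) * ((x - y) / x)"
      using xy by (intro mult_right_mono mult_left_mono) auto
    also have "\<dots> \<le> (p - q) * \<sigma>"
      using diff \<sigma>_lower xy pq by (intro mult_mono) auto
    finally have "2 * L \<le> n * ((p - q) * \<sigma>)" using thr' n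
        by (meson mult_left_mono less_imp_le order_trans)
    then have "\<epsilon> / 4 * (2 * L) \<le> \<epsilon> / 4 * (n * ((p - q) * \<sigma>))" using \<delta> by (intro mult_left_mono) auto
    then show ?thesis using thr' by linarith
  qed
  finally show "n / 2 * (p * (exp (- \<sigma>) - 1) + q * (exp \<sigma> - 1)) + \<sigma> * (\<epsilon> / 2 * ((p - q) / 2) * n)
      \<le> - ((1 + \<epsilon> / 2) * L)" by (simp add: algebra_simps)
qed

definition sbm_prob :: "(nat \<Rightarrow> real) \<Rightarrow> real \<Rightarrow> real \<Rightarrow> nat \<times> nat \<Rightarrow> real" where
  "sbm_prob \<zeta> p q e = (if \<zeta> (fst e) = \<zeta> (snd e) then p else q)"

lemma sym_ext_sbm_prob:
  assumes "\<zeta> i \<in> {-1, 1}" "\<zeta> j \<in> {-1, 1}"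
  shows "sym_ext (sbm_prob \<zeta> p q) i j = (if i = j then 0 else (p + q) / 2 + (p - q) / 2 * (\<zeta> i * \<zeta> j))"
proof -
  have "sbm_prob \<zeta> p q (min i j, max i j) = (if \<zeta> i = \<zeta> j then p else q)"
    by (simp add: sbm_prob_def min_def max_def eq_commute)
  then show ?thesis using assms by (auto simp: sym_ext_def field_simps)
qed

text \<open>The summand \<open>1\<close> in the exponent accounts for the missing diagonal entry of the row: a vertex has
  one potential neighbour fewer in its own community than in the other one.\<close>

lemma signed_degree_tail:
  assumes \<zeta>: "\<And>i. i < n \<Longrightarrow> \<zeta> i \<in> {-1, 1}" and balanced: "(\<Sum>i<n. \<zeta> i) = 0"
    and pq: "0 \<le> q" "q \<le> p" "p \<le> 1" and \<sigma>: "0 \<le> \<sigma>" and i: "i < n"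
  shows "measure_pmf.prob (random_graph n (sbm_prob \<zeta> p q)) {\<omega>. (\<Sum>j<n. adj \<omega> i j * (\<zeta> i * \<zeta> j)) \<le> t}
    \<le> exp (1 + real n / 2 * (p * (exp (- \<sigma>) - 1) + q * (exp \<sigma> - 1)) + \<sigma> * t)"
proof -
  define a where "a = sbm_prob \<zeta> p q"
  define u v where "u = p * (exp (- \<sigma>) - 1)" and "v = q * (exp \<sigma> - 1)"
  have ends: "0 \<le> a e \<and> a e \<le> 1" for e using pq by (simp add: a_def sbm_prob_def)
  have "{\<omega>. (\<Sum>j<n. adj \<omega> i j * (\<zeta> i * \<zeta> j)) \<le> t}
      \<subseteq> {\<omega>. - (\<sigma> * t) \<le> (\<Sum>j<n. adj \<omega> i j * (- \<sigma> * (\<zeta> i * \<zeta> j)))}"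
  proof (intro Collect_mono impI)
    fix \<omega> assume "(\<Sum>j<n. adj \<omega> i j * (\<zeta> i * \<zeta> j)) \<le> t"
    then have "\<sigma> * (\<Sum>j<n. adj \<omega> i j * (\<zeta> i * \<zeta> j)) \<le> \<sigma> * t" using \<sigma> by (rule mult_left_mono)
    then show "- (\<sigma> * t) \<le> (\<Sum>j<n. adj \<omega> i j * (- \<sigma> * (\<zeta> i * \<zeta> j)))"
      by (simp add: sum_distrib_left sum_negf mult_ac)
  qed
  then have "measure_pmf.prob (random_graph n a) {\<omega>. (\<Sum>j<n. adj \<omega> i j * (\<zeta> i * \<zeta> j)) \<le> t}
    \<le> measure_pmf.prob (random_graph n a) {\<omega>. - (\<sigma> * t) \<le> (\<Sum>j<n. adj \<omega> i j * (- \<sigma> * (\<zeta> i * \<zeta> j)))}"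
    by (intro measure_pmf.finite_measure_mono) auto
  also have "\<dots> \<le> exp ((\<Sum>j<n. sym_ext a i j * (exp (- \<sigma> * (\<zeta> i * \<zeta> j)) - 1)) - - (\<sigma> * t))"
    by (rule vertex_row_Chernoff[OF ends i])
  also have "(\<Sum>j<n. sym_ext a i j * (exp (- \<sigma> * (\<zeta> i * \<zeta> j)) - 1))
      = (\<Sum>j<n. ((u + v) / 2 + (u - v) / 2 * \<zeta> i * \<zeta> j) - (if j = i then u else 0))"
  proof (intro sum.cong refl)
    fix j assume "j \<in> {..<n}"
    then have "\<zeta> i \<in> {-1, 1}" "\<zeta> j \<in> {-1, 1}" using \<zeta> i by auto
    then show "sym_ext a i j * (exp (- \<sigma> * (\<zeta> i * \<zeta> j)) - 1)
        = ((u + v) / 2 + (u - v) / 2 * \<zeta> i * \<zeta> j) - (if j = i then u else 0)"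
      unfolding a_def sym_ext_sbm_prob[OF \<open>\<zeta> i \<in> {-1, 1}\<close> \<open>\<zeta> j \<in> {-1, 1}\<close>]
      by (auto simp: u_def v_def field_simps)
  qed
  also have "\<dots> = real n / 2 * (u + v) - u"
  proof -
    have "(\<Sum>j<n. (u - v) / 2 * \<zeta> i * \<zeta> j) = 0"
      by (simp only: sum_distrib_left[symmetric] balanced mult_zero_right)
    then show ?thesis using i by (simp only: sum_subtractf sum.distrib) simp
  qed
  also have "\<dots> - - (\<sigma> * t) \<le> 1 + real n / 2 * (u + v) + \<sigma> * t"
  proof -
    have "p * (1 - exp (- \<sigma>)) \<le> 1 * 1" using pq \<sigma> by (intro mult_mono) auto
    then show ?thesis by (simp add: u_def algebra_simps)
  qed
  finally show ?thesis by (simp add: u_def v_def a_def)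
qed

section \<open>Critical points of the block model\<close>

lemma bilinear_norm_le_add:
  assumes "bilinear_norm_le n M K" "bilinear_norm_le n N L"
  shows "bilinear_norm_le n (\<lambda>i j. M i j + N i j) (K + L)"
  unfolding bilinear_norm_le_def
proof (intro allI)
  fix u v
  show "\<bar>\<Sum>i<n. \<Sum>j<n. (M i j + N i j) * u i * v j\<bar> \<le> (K + L) * L2_set u {..<n} * L2_set v {..<n}"
    using bilinear_norm_leD[OF assms(1), of u v] bilinear_norm_leD[OF assms(2), of u v]
    by (simp add: distrib_right sum.distrib)
qed

lemma bilinear_norm_le_mono:
  assumes "bilinear_norm_le n M K" "K \<le> L"
  shows "bilinear_norm_le n M L"
  unfolding bilinear_norm_le_def
proof (intro allI)
  fix u v
  have "K * (L2_set u {..<n} * L2_set v {..<n}) \<le> L * (L2_set u {..<n} * L2_set v {..<n})"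
    using assms(2) by (intro mult_right_mono) auto
  then show "\<bar>\<Sum>i<n. \<Sum>j<n. M i j * u i * v j\<bar> \<le> L * L2_set u {..<n} * L2_set v {..<n}"
    using bilinear_norm_leD[OF assms(1), of u v] by (simp add: mult.assoc)
qed

lemma bilinear_norm_le_const: "bilinear_norm_le n (\<lambda>_ _. c) (\<bar>c\<bar> * real n)"
  unfolding bilinear_norm_le_def
proof (intro allI)
  fix u v :: "nat \<Rightarrow> real"
  have sum_le: "\<bar>\<Sum>i<n. f i\<bar> \<le> sqrt (real n) * L2_set f {..<n}" for f
    using L2_set_mult_ineq[of "\<lambda>_. 1" f "{..<n}"]
    by (intro order_trans[OF sum_abs]) (simp add: L2_set_constant)
  have "\<bar>\<Sum>i<n. \<Sum>j<n. c * u i * v j\<bar> = \<bar>c\<bar> * (\<bar>\<Sum>i<n. u i\<bar> * \<bar>\<Sum>j<n. v j\<bar>)"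
    by (simp add: sum_distrib_left[symmetric] sum_distrib_right[symmetric] abs_mult mult.assoc)
  also have "\<dots> \<le> \<bar>c\<bar> * ((sqrt (real n) * L2_set u {..<n}) * (sqrt (real n) * L2_set v {..<n}))"
    by (intro mult_left_mono mult_mono sum_le) auto
  also have "\<dots> = \<bar>c\<bar> * real n * L2_set u {..<n} * L2_set v {..<n}" by (simp add: mult_ac)
  finally show "\<bar>\<Sum>i<n. \<Sum>j<n. c * u i * v j\<bar> \<le> \<bar>c\<bar> * real n * L2_set u {..<n} * L2_set v {..<n}" .
qed

lemma bilinear_norm_le_signs:
  assumes N: "bilinear_norm_le n N K" and \<zeta>: "\<And>i. i < n \<Longrightarrow> \<zeta> i \<in> {-1, 1}"
  shows "bilinear_norm_le n (\<lambda>i j. \<zeta> i * \<zeta> j * N i j) K"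
  unfolding bilinear_norm_le_def
proof (intro allI)
  fix u v
  have L2: "L2_set (\<lambda>i. \<zeta> i * f i) {..<n} = L2_set f {..<n}" for f
  proof -
    have "(\<zeta> i) ^ 2 = 1" if "i < n" for i using \<zeta>[OF that] by auto
    then show ?thesis by (simp add: L2_set_def power_mult_distrib)
  qed
  show "\<bar>\<Sum>i<n. \<Sum>j<n. \<zeta> i * \<zeta> j * N i j * u i * v j\<bar> \<le> K * L2_set u {..<n} * L2_set v {..<n}"
    using bilinear_norm_leD[OF N, of "\<lambda>i. \<zeta> i * u i" "\<lambda>i. \<zeta> i * v i"] unfolding L2 by (simp add: mult_ac)
qed

text \<open>Both costs have the form \<open>A - t 1 1\<^sup>T\<close>. A shift \<open>t\<close> other than \<open>(p + q) / 2\<close> adds a multiple of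
  \<open>z z\<^sup>T\<close> to the noise. Its norm is at most \<open>2 K\<close>, and its rows sum to zero by balance, so
  \<open>landscape_rigidity\<close> applies with \<open>3 K\<close> in place of \<open>K\<close>.\<close>

lemma benign_landscape_shifted_adjacency:
  assumes z: "z \<in> carrier_vec n" "\<And>i. i < n \<Longrightarrow> z $ i \<in> {-1, 1}" "(\<Sum>i<n. z $ i) = 0"
    and n: "0 < n" and r: "4 \<le> r" and pq: "0 \<le> q" "q < p"
    and norm: "bilinear_norm_le n (\<lambda>i j. adj \<omega> i j - sym_ext (sbm_prob (($) z) p q) i j) K"
    and deg: "\<And>i. i < n \<Longrightarrow> \<eta> * ((p - q) / 2) * real n \<le> (\<Sum>j<n. adj \<omega> i j * (z $ i * z $ j))"
    and K: "0 \<le> K" "45 * K < \<eta> * ((p - q) / 2) * real n"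
    and t: "\<bar>(p + q) / 2 - t\<bar> * real n \<le> 2 * K"
  shows "benign_landscape n r z (adjacency_of_edges n \<omega> - t \<cdot>\<^sub>m outer (ones_vec n) (ones_vec n))"
    (is "benign_landscape n r z ?C")
  unfolding benign_landscape_def
proof (intro allI impI)
  fix Y assume crit: "second_order_critical n r (objective ?C) Y"
  define \<mu> where "\<mu> = (p - q) / 2"
  define E where "E i j = adj \<omega> i j - sym_ext (sbm_prob (($) z) p q) i j" for i j
  define N where "N i j = z $ i * z $ j * (E i j + ((p + q) / 2 - t))" for i j
  have z2: "z $ i * z $ i = 1" if "i < n" for i using z(2)[OF that] by auto
  have C: "?C \<in> carrier_mat n n" by (intro minus_carrier_mat) (simp add: ones_vec_def outer_def)
  have C_index: "?C $$ (i, j) = adj \<omega> i j - t" if "i < n" "j < n" for i j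
    using that by (simp add: adjacency_of_edges_def ones_vec_def outer_def adj_def sym_ext_def)
  have C_sym: "?C\<^sup>T = ?C"
  proof (rule eq_matI)
    fix i j assume "i < dim_row ?C" "j < dim_col ?C"
    then have "i < n" "j < n" using C by auto
    then show "?C\<^sup>T $$ (i, j) = ?C $$ (i, j)" using C
        by (simp add: C_index adj_commute[of _ i j] del: index_minus_mat)
  qed (simp_all only: index_transpose_mat carrier_matD[OF C])
  have mean: "sym_ext (sbm_prob (($) z) p q) i j
      = (if i = j then 0 else (p + q) / 2 + \<mu> * (z $ i * z $ j))"
    if "i < n" "j < n" for i j
    unfolding \<mu>_def using that z(2) by (intro sym_ext_sbm_prob) auto
  have rows: "\<mu> * real n + (\<Sum>j<n. N i j) = (\<Sum>j<n. adj \<omega> i j * (z $ i * z $ j)) + p" if i: "i < n" for i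
  proof -
    have "(\<Sum>j<n. N i j) = (\<Sum>j<n. adj \<omega> i j * (z $ i * z $ j) - \<mu> - t * z $ i * z $ j
        + (if j = i then p else 0))"
    proof (intro sum.cong refl)
      fix j assume "j \<in> {..<n}"
      then have j: "j < n" by simp
      have "(z $ i * z $ j) * (z $ i * z $ j) = 1" using z2[OF i] z2[OF j]
          by (metis mult.assoc mult.left_commute mult_1)
      moreover have "(p + q) / 2 + \<mu> = p" by (simp add: \<mu>_def field_simps)
      ultimately show "N i j = adj \<omega> i j * (z $ i * z $ j) - \<mu> - t * z $ i * z $ j
          + (if j = i then p else 0)"
        using z2[OF i] by (auto simp: N_def E_def mean[OF i j] algebra_simps)
    qed
    also have "\<dots> = (\<Sum>j<n. adj \<omega> i j * (z $ i * z $ j)) - real n * \<mu> + p"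
      using i by (simp add: sum_subtractf sum.distrib sum_distrib_left[symmetric] z(3))
    finally show ?thesis by simp
  qed
  define y where "y i k = z $ i * Y $$ (i, k)" for i k
  have Y: "Y \<in> sphere_rows n r" using crit by (simp add: second_order_critical_def)
  then have Yc: "Y \<in> carrier_mat n r" by (simp add: sphere_rows_iff)
  have unit: "(\<Sum>k<r. y i k ^ 2) = 1" if "i < n" for i
    using Y z2[OF that] that by (simp add: y_def sphere_rows_iff power_mult_distrib
        power2_eq_square[of "z $ i"])
  define m where "m k = (\<Sum>j<n. y j k) / real n" for k
  have const: "y i k = m k" if "i < n" "k < r" for i k
    unfolding m_def
  proof (rule landscape_rigidity[OF unit r, where \<mu> = \<mu> and \<eta> = \<eta> and K = "3 * K" and N = N
        and B = "\<lambda>i j. z $ i * z $ j * ?C $$ (i, j)"])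
    show "0 < \<mu>" using pq by (simp add: \<mu>_def)
    show "15 * (3 * K) < \<eta> * \<mu> * real n" "0 \<le> 3 * K" using K by (simp_all add: \<mu>_def)
    show "z $ i * z $ j * ?C $$ (i, j) = \<mu> + N i j" if ij: "i < n" "j < n" "i \<noteq> j" for i j
    proof -
      have "(z $ i * z $ j) * (z $ i * z $ j) = 1" using z2[OF ij(1)] z2[OF ij(2)]
          by (metis mult.assoc mult.left_commute mult_1)
      then show ?thesis unfolding C_index[OF ij(1,2)] using ij
        by (simp add: N_def E_def mean algebra_simps)
    qed
    show "N i j = N j i" if "i < n" "j < n" for i j
      by (simp add: N_def E_def adj_commute[of _ i j] sym_ext_commute[of _ i j] mult.commute)
    show "bilinear_norm_le n N (3 * K)"
    proof -
      have "bilinear_norm_le n (\<lambda>i j. E i j + ((p + q) / 2 - t)) (K + \<bar>(p + q) / 2 - t\<bar> * real n)"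
        unfolding E_def by (intro bilinear_norm_le_add norm bilinear_norm_le_const)
      then have "bilinear_norm_le n N (K + \<bar>(p + q) / 2 - t\<bar> * real n)"
        unfolding N_def using z(2) by (rule bilinear_norm_le_signs)
      then show ?thesis
        by (rule bilinear_norm_le_mono) (use t in linarith)
    qed
    show "\<eta> * \<mu> * real n \<le> \<mu> * real n + (\<Sum>j<n. N i j)" if "i < n" for i
      unfolding rows[OF that] using deg[OF that] pq by (simp add: \<mu>_def)
    show "(\<Sum>i<n. \<Sum>j<n. z $ i * z $ j * ?C $$ (i, j) *
        ((1 - (\<Sum>k<r. y i k * y j k)) * (real r - 2 - (\<Sum>k<r. y i k * y j k)))) \<le> 0"
      unfolding y_def using second_order_critical_averaged[OF C C_sym crit, of "($) z"] z2 by blast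
  qed (use that in auto)
  show "\<exists>u\<in>carrier_vec r. sqrt (u \<bullet> u) = 1 \<and> Y = outer z u"
  proof (intro bexI conjI)
    have "Matrix.vec r m \<bullet> Matrix.vec r m = (\<Sum>k<r. y 0 k ^ 2)"
      using const[OF n] by (simp add: scalar_prod_def atLeast0LessThan power2_eq_square)
    then show "sqrt (Matrix.vec r m \<bullet> Matrix.vec r m) = 1" using unit[OF n] by simp
    show "Y = outer z (Matrix.vec r m)"
    proof (rule eq_matI)
      fix i k assume "i < dim_row (outer z (Matrix.vec r m))" "k < dim_col (outer z (Matrix.vec r m))"
      then have ik: "i < n" "k < r" using z(1) by (auto simp: outer_def)
      have "z $ i * y i k = Y $$ (i, k)" unfolding y_def using z2[OF ik(1)] by (metis mult.assoc mult_1)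
      then show "Y $$ (i, k) = outer z (Matrix.vec r m) $$ (i, k)"
        using ik z(1) const[OF ik] by (simp add: outer_def)
    qed (use Yc z(1) in \<open>auto simp: outer_def\<close>)
  qed simp
qed

lemma sbm_eq_random_graph:
  "sbm n z p q = map_pmf (adjacency_of_edges n) (random_graph n (sbm_prob (($) z) p q))"
  by (simp add: sbm_def random_graph_def vertex_pairs_def sbm_prob_def case_prod_unfold)

text \<open>The average entry of the adjacency matrix is the average edge probability plus the form of the
  centred matrix at the all-ones vector divided by \<open>n\<^sup>2\<close>, hence within \<open>2 K / n\<close> of \<open>(p + q) / 2\<close>;
  the zero diagonal accounts for the deviation \<open>p / n \<le> K / n\<close>.\<close>

lemma benign_landscape_both_costs:
  assumes z: "z \<in> carrier_vec n" "\<And>i. i < n \<Longrightarrow> z $ i \<in> {-1, 1}" "(\<Sum>i<n. z $ i) = 0"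
    and n: "0 < n" and r: "4 \<le> r" and pq: "0 \<le> q" "q < p" "p \<le> 1"
    and norm: "bilinear_norm_le n (\<lambda>i j. adj \<omega> i j - sym_ext (sbm_prob (($) z) p q) i j) K"
    and deg: "\<And>i. i < n \<Longrightarrow> \<eta> * ((p - q) / 2) * real n \<le> (\<Sum>j<n. adj \<omega> i j * (z $ i * z $ j))"
    and K: "1 \<le> K" "45 * K < \<eta> * ((p - q) / 2) * real n"
  shows "benign_landscape n r z (cost_empirical n (adjacency_of_edges n \<omega>))"
    and "benign_landscape n r z (cost_population n p q (adjacency_of_edges n \<omega>))"
proof -
  note shifted = benign_landscape_shifted_adjacency[OF z n r pq(1,2) norm deg _ K(2)]
  show "benign_landscape n r z (cost_population n p q (adjacency_of_edges n \<omega>))"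
    unfolding cost_population_def using K by (intro shifted) auto
  define t where "t = 1 / real n ^ 2 * frob_inner (adjacency_of_edges n \<omega>)
      (outer (ones_vec n) (ones_vec n))"
  have "\<bar>(p + q) / 2 - t\<bar> * real n \<le> 2 * K"
  proof -
    define noise where "noise = (\<Sum>i<n. \<Sum>j<n. (adj \<omega> i j - sym_ext (sbm_prob (($) z) p q) i j) * 1 * 1)"
    have "\<bar>noise\<bar> \<le> K * L2_set (\<lambda>_. 1) {..<n} * L2_set (\<lambda>_. 1) {..<n}"
      unfolding noise_def by (rule bilinear_norm_leD[OF norm])
    then have noise: "\<bar>noise\<bar> \<le> K * real n" by (simp add: L2_set_constant mult.assoc)
    have "frob_inner (adjacency_of_edges n \<omega>) (outer (ones_vec n) (ones_vec n))
        = (\<Sum>i<n. \<Sum>j<n. adj \<omega> i j)"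
    proof -
      have "adjacency_of_edges n \<omega> \<in> carrier_mat n n" "outer (ones_vec n) (ones_vec n) \<in> carrier_mat n n"
        by (simp_all add: adjacency_of_edges_def ones_vec_def outer_def)
      from frob_inner_sum[OF this] show ?thesis
      proof (rule trans, intro sum.cong refl)
        fix i j assume "i \<in> {..<n}" "j \<in> {..<n}"
        then show "adjacency_of_edges n \<omega> $$ (i, j) * outer (ones_vec n) (ones_vec n) $$ (i, j)
            = adj \<omega> i j"
          by (simp add: adjacency_of_edges_def ones_vec_def outer_def adj_def sym_ext_def)
      qed
    qed
    also have "\<dots> = noise + (\<Sum>i<n. \<Sum>j<n. sym_ext (sbm_prob (($) z) p q) i j)"
      by (simp add: noise_def sum_subtractf)
    also have "(\<Sum>i<n. \<Sum>j<n. sym_ext (sbm_prob (($) z) p q) i j)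
        = (\<Sum>i<n. \<Sum>j<n. (p + q) / 2 + (p - q) / 2 * z $ i * z $ j - (if j = i then p else 0))"
    proof (intro sum.cong refl)
      fix i j assume "i \<in> {..<n}" "j \<in> {..<n}"
      then have "z $ i \<in> {-1, 1}" "z $ j \<in> {-1, 1}" using z by auto
      then show "sym_ext (sbm_prob (($) z) p q) i j
          = (p + q) / 2 + (p - q) / 2 * z $ i * z $ j - (if j = i then p else 0)"
        unfolding sym_ext_sbm_prob[OF \<open>z $ i \<in> {-1, 1}\<close> \<open>z $ j \<in> {-1, 1}\<close>] by (auto simp: field_simps)
    qed
    also have "\<dots> = real n ^ 2 * ((p + q) / 2) - real n * p"
    proof -
      have "(\<Sum>j<n. (p - q) / 2 * z $ i * z $ j) = 0" for i
        by (simp only: sum_distrib_left[symmetric] z(3) mult_zero_right)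
      then show ?thesis
        by (simp only: sum_subtractf sum.distrib) (simp add: power2_eq_square)
    qed
    finally have "t = (noise + (real n ^ 2 * ((p + q) / 2) - real n * p)) / real n ^ 2"
        by (simp add: t_def)
    then have "((p + q) / 2 - t) * real n = p - noise / real n"
      using n by (simp add: field_simps power2_eq_square)
    moreover have "\<bar>noise / real n\<bar> \<le> K" using noise n by (simp add: abs_divide field_simps)
    ultimately have "\<bar>((p + q) / 2 - t) * real n\<bar> \<le> 2 * K" using pq K by linarith
    then show ?thesis by (simp add: abs_mult)
  qed
  then show "benign_landscape n r z (cost_empirical n (adjacency_of_edges n \<omega>))"
    unfolding cost_empirical_def Let_def t_def[symmetric] using K by (intro shifted) auto
qed

lemma benign_landscape_prob:
  fixes p q \<delta> \<epsilon> :: real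
  assumes n: "9 \<le> n" and z: "z \<in> carrier_vec n" "\<And>i. i < n \<Longrightarrow> z $ i \<in> {-1, 1}" "(\<Sum>i<n. z $ i) = 0"
    and r: "4 \<le> r" and pq: "0 \<le> q" "q < p" "p \<le> 1"
    and \<delta>: "0 < \<epsilon>" "\<epsilon> \<le> \<delta>" "\<delta> < 1 / 2"
    and thr: "2 * ln (real n) \<le> real n * (sqrt (p - \<delta> * (p - q)) - sqrt (q + \<delta> * (p - q)))\<^sup>2"
    and large: "200 / \<epsilon> \<le> ln (real n)"
    and norm: "measure_pmf.prob (random_graph n (sbm_prob (($) z) p q))
      {\<omega>. \<not> bilinear_norm_le n (\<lambda>i j. adj \<omega> i j - sym_ext (sbm_prob (($) z) p q) i j)
        (\<epsilon> / 200 * sqrt (real n * p * ln (real n)))} \<le> 3 / real n"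
    and cost: "cost = cost_empirical n \<or> cost = cost_population n p q"
  shows "1 - 3 / real n - 3 * exp (- (\<epsilon> / 2 * ln (real n)))
    \<le> measure_pmf.prob (sbm n z p q) {A. benign_landscape n r z (cost A)}"
proof -
  define M where "M = random_graph n (sbm_prob (($) z) p q)"
  define L where "L = ln (real n)"
  define s where "s = sqrt (real n * p * L)"
  define \<sigma> where "\<sigma> = ln (sqrt (p - \<delta> * (p - q)) / sqrt (q + \<delta> * (p - q)))"
  define \<tau> where "\<tau> = \<epsilon> / 2 * ((p - q) / 2) * real n"
  have L: "0 < L" using n by (simp add: L_def)
  have n0: "0 < real n" using n by simp
  note thr' = threshold_consequences[OF n0 L pq \<delta> thr[folded L_def], folded \<sigma>_def]
  define noisy where "noisy = {\<omega>. \<not> bilinear_norm_le n (\<lambda>i j. adj \<omega> i j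
      - sym_ext (sbm_prob (($) z) p q) i j) (\<epsilon> / 200 * s)}"
  define low where "low = {\<omega>. \<exists>i\<in>{..<n}. (\<Sum>j<n. adj \<omega> i j * (z $ i * z $ j)) \<le> \<tau>}"
  have "measure_pmf.prob M noisy \<le> 3 / real n"
    using norm by (simp add: noisy_def M_def s_def L_def)
  moreover have "measure_pmf.prob M low \<le> 3 * exp (- (\<epsilon> / 2 * L))"
  proof -
    have "measure_pmf.prob M low \<le> (\<Sum>i<n. exp (1 - (1 + \<epsilon> / 2) * L))"
      unfolding low_def
    proof (rule prob_union_bound)
      fix i assume "i \<in> {..<n}"
      then have "measure_pmf.prob M {\<omega>. (\<Sum>j<n. adj \<omega> i j * (z $ i * z $ j)) \<le> \<tau>}
        \<le> exp (1 + real n / 2 * (p * (exp (- \<sigma>) - 1) + q * (exp \<sigma> - 1)) + \<sigma> * \<tau>)"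
        unfolding M_def using z pq thr'(3) by (intro signed_degree_tail) auto
      also have "\<dots> \<le> exp (1 - (1 + \<epsilon> / 2) * L)"
        using thr'(4) by (simp add: \<tau>_def)
      finally show "measure_pmf.prob M {\<omega>. (\<Sum>j<n. adj \<omega> i j * (z $ i * z $ j)) \<le> \<tau>}
          \<le> exp (1 - (1 + \<epsilon> / 2) * L)" .
    qed simp
    also have "\<dots> = real n * exp (1 + - L + - (\<epsilon> / 2 * L))" by (simp add: algebra_simps)
    also have "\<dots> = exp 1 * exp (- (\<epsilon> / 2 * L))"
      unfolding exp_add using n by (simp add: L_def exp_minus field_simps)
    also have "\<dots> \<le> 3 * exp (- (\<epsilon> / 2 * L))" by (intro mult_right_mono exp_le) simp
    finally show ?thesis .
  qed
  moreover have "benign_landscape n r z (cost (adjacency_of_edges n \<omega>))" if "\<omega> \<notin> noisy \<union> low" for \<omega>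
  proof -
    have "2 * L * L \<le> real n * p * L" using thr'(1) L by (intro mult_right_mono) auto
    then have "L\<^sup>2 \<le> real n * p * L" using L by (simp add: power2_eq_square)
    then have "L \<le> s" unfolding s_def by (rule real_le_rsqrt)
    then have "200 / \<epsilon> \<le> s" using large by (simp add: L_def)
    \<comment> \<open>the norm bound exceeds 1, so that it absorbs the diagonal contribution \<open>p \<le> 1\<close>\<close>
    then have K1: "1 \<le> \<epsilon> / 200 * s" using \<delta> by (simp add: field_simps)
    have s0: "0 < s" using L \<open>L \<le> s\<close> by simp
    have "\<epsilon> / 4 * s \<le> \<epsilon> / 4 * (real n * (p - q))"
      using thr'(2) \<delta> by (intro mult_left_mono) (auto simp: s_def)
    then have "\<epsilon> / 4 * s \<le> \<tau>" by (simp add: \<tau>_def mult_ac)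
    moreover have "45 * (\<epsilon> / 200 * s) < \<epsilon> / 4 * s" using s0 \<delta> by simp
    ultimately have K2: "45 * (\<epsilon> / 200 * s) < \<epsilon> / 2 * ((p - q) / 2) * real n" unfolding \<tau>_def by linarith
    have "0 < n" using n by simp
    moreover have "bilinear_norm_le n (\<lambda>i j. adj \<omega> i j - sym_ext (sbm_prob (($) z) p q) i j)
        (\<epsilon> / 200 * s)"
      using that by (simp add: noisy_def)
    moreover have "\<epsilon> / 2 * ((p - q) / 2) * real n \<le> (\<Sum>j<n. adj \<omega> i j * (z $ i * z $ j))" if "i < n" for i
    proof -
      have "\<not> (\<Sum>j<n. adj \<omega> i j * (z $ i * z $ j)) \<le> \<tau>"
        using \<open>\<omega> \<notin> noisy \<union> low\<close> that by (auto simp: low_def)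
      then show ?thesis unfolding \<tau>_def by linarith
    qed
    ultimately show ?thesis
      using benign_landscape_both_costs[OF z _ r pq _ _ K1 K2, of \<omega>] cost by auto
  qed
  then have "- {\<omega>. benign_landscape n r z (cost (adjacency_of_edges n \<omega>))} \<subseteq> noisy \<union> low" by auto
  then have "measure_pmf.prob M (- {\<omega>. benign_landscape n r z (cost (adjacency_of_edges n \<omega>))})
      \<le> measure_pmf.prob M noisy + measure_pmf.prob M low"
    by (intro order_trans[OF measure_pmf.finite_measure_mono measure_Un_le]) auto
  moreover have "measure_pmf.prob M (- {\<omega>. benign_landscape n r z (cost (adjacency_of_edges n \<omega>))})
      = 1 - measure_pmf.prob M {\<omega>. benign_landscape n r z (cost (adjacency_of_edges n \<omega>))}"
    using measure_pmf.prob_compl[of "{\<omega>. benign_landscape n r z (cost (adjacency_of_edges n \<omega>))}" M]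
    by (simp add: Compl_eq_Diff_UNIV)
  moreover have "measure_pmf.prob (sbm n z p q) {A. benign_landscape n r z (cost A)}
      = measure_pmf.prob M {\<omega>. benign_landscape n r z (cost (adjacency_of_edges n \<omega>))}"
    unfolding sbm_eq_random_graph M_def[symmetric] by (simp add: measure_map_pmf vimage_def)
  ultimately show ?thesis unfolding L_def by linarith
qed

theorem theorem3:
  fixes z :: "nat \<Rightarrow> real vec"
    and p q :: "nat \<Rightarrow> real"
    and r :: "nat \<Rightarrow> nat"
    and \<epsilon> :: real
  assumes z_carrier: "\<And>n. even n \<Longrightarrow> z n \<in> carrier_vec n"
    and z_labels: "\<And>n i. even n \<Longrightarrow> i < n \<Longrightarrow> z n $ i \<in> {-1, 1}"
    and z_balanced: "\<And>n. even n \<Longrightarrow> z n \<bullet> ones_vec n = 0"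
    and pq: "\<And>n. even n \<Longrightarrow> 0 \<le> q n \<and> q n < p n \<and> p n \<le> 1"
    and r: "\<And>n. even n \<Longrightarrow> 4 \<le> r n"
    and eps: "0 < \<epsilon>" "\<epsilon> \<le> 1 / 12"
    and threshold: "\<forall>\<^sub>F n in sequentially. even n \<longrightarrow>
      real n / ln (real n) *
        (sqrt (p n - (1 / (real (r n) - 1) + \<epsilon>) * (p n - q n))
          - sqrt (q n + (1 / (real (r n) - 1) + \<epsilon>) * (p n - q n)))\<^sup>2 \<ge> 2"
  shows "((\<lambda>n. measure_pmf.prob (sbm n (z n) (p n) (q n))
            {A. benign_landscape n (r n) (z n) (cost_empirical n A)})
          \<longlongrightarrow> 1) (inf sequentially (principal {n. even n}))
    \<and> ((\<lambda>n. measure_pmf.prob (sbm n (z n) (p n) (q n))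
            {A. benign_landscape n (r n) (z n) (cost_population n (p n) (q n) A)})
          \<longlongrightarrow> 1) (inf sequentially (principal {n. even n}))"
proof -
  define lower where "lower n = 1 - 3 / real n - 3 * exp (- (\<epsilon> / 2 * ln (real n)))" for n
  have ln_top: "filterlim (\<lambda>n. ln (real n)) at_top sequentially"
    by (rule filterlim_compose[OF ln_at_top filterlim_real_sequentially])
  have "((\<lambda>n. exp (- (\<epsilon> / 2 * ln (real n)))) \<longlongrightarrow> 0) sequentially"
  proof -
    have "filterlim (\<lambda>n. \<epsilon> / 2 * ln (real n)) at_top sequentially"
      using eps by (intro filterlim_tendsto_pos_mult_at_top[OF tendsto_const _ ln_top]) simp
    then show ?thesis
      by (intro filterlim_compose[OF exp_at_bot]) (simp add: filterlim_uminus_at_bot)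
  qed
  then have "(lower \<longlongrightarrow> 1 - 0 - 3 * 0) sequentially"
    unfolding lower_def by (intro tendsto_diff tendsto_mult tendsto_const lim_const_over_n)
  then have lower_lim: "(lower \<longlongrightarrow> 1) (inf sequentially (principal {n. even n}))"
    by (intro tendsto_mono[OF inf_le1]) simp
  have bound: "\<forall>\<^sub>F n in sequentially. even n \<longrightarrow> (\<forall>cost. cost = cost_empirical n \<or> cost
      = cost_population n (p n) (q n) \<longrightarrow>
      lower n \<le> measure_pmf.prob (sbm n (z n) (p n) (q n)) {A. benign_landscape n (r n) (z n) (cost A)})"
  proof -
    have "\<forall>\<^sub>F n in sequentially. 200 / \<epsilon> \<le> ln (real n)" using ln_top by (simp add: filterlim_at_top)
    moreover have "0 < \<epsilon> / 200" using eps by simp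
    note random_graph_norm[OF this]
    ultimately show ?thesis using threshold eventually_ge_at_top[of 9]
    proof eventually_elim
      case (elim n)
      show ?case
      proof (intro impI allI)
        fix cost assume even: "even n" and cost: "cost = cost_empirical n \<or> cost
            = cost_population n (p n) (q n)"
        define \<delta> where "\<delta> = 1 / (real (r n) - 1) + \<epsilon>"
        \<comment> \<open>both tilted probabilities stay in order because \<open>1 / 3 + 1 / 12 < 1 / 2\<close>\<close>
        have "1 / (real (r n) - 1) \<le> 1 / 3" "0 < 1 / (real (r n) - 1)"
          using r[OF even] by (auto simp: field_simps)
        then have \<delta>: "\<epsilon> \<le> \<delta>" "\<delta> < 1 / 2" unfolding \<delta>_def using eps by linarith+
        have pqn: "0 \<le> q n" "q n < p n" "p n \<le> 1" using pq[OF even] by auto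
        have n0: "0 < real n" "0 < ln (real n)" using elim(4) by auto
        have thr: "2 * ln (real n) \<le> real n * (sqrt (p n - \<delta> * (p n - q n))
            - sqrt (q n + \<delta> * (p n - q n)))\<^sup>2"
          using elim(3) even n0 by (simp add: \<delta>_def field_simps)
        have sum_z: "(\<Sum>i<n. z n $ i) = 0"
          using z_balanced[OF even] by (simp add: scalar_prod_def ones_vec_def atLeast0LessThan)
        have "2 * ln (real n) \<le> real n * p n"
          by (rule threshold_consequences(1)[OF n0 pqn eps(1) \<delta> thr])
        then have "measure_pmf.prob (random_graph n (sbm_prob (($) (z n)) (p n) (q n)))
            {\<omega>. \<not> bilinear_norm_le n (\<lambda>i j. adj \<omega> i j - sym_ext (sbm_prob (($) (z n)) (p n) (q n)) i j)
              (\<epsilon> / 200 * sqrt (real n * p n * ln (real n)))} \<le> 3 / real n"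
          using elim(2) pqn by (auto simp: sbm_prob_def)
        then show "lower n \<le> measure_pmf.prob (sbm n (z n) (p n) (q n))
            {A. benign_landscape n (r n) (z n) (cost A)}"
          unfolding lower_def
          using benign_landscape_prob[OF elim(4)
              z_carrier[OF even] z_labels[OF even] sum_z r[OF even] pqn
              eps(1) \<delta> thr elim(1) _ cost] by blast
      qed
    qed
  qed
  have "((\<lambda>n. measure_pmf.prob (sbm n (z n) (p n) (q n)) {A. benign_landscape n (r n) (z n) (cost n A)})
      \<longlongrightarrow> 1) (inf sequentially (principal {n. even n}))"
    if "\<And>n. cost n = cost_empirical n \<or> cost n = cost_population n (p n) (q n)" for cost
  proof (rule tendsto_sandwich[OF _ _ lower_lim tendsto_const])
    show "\<forall>\<^sub>F n in inf sequentially (principal {n. even n}). lower n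
        \<le> measure_pmf.prob (sbm n (z n) (p n) (q n)) {A. benign_landscape n (r n) (z n) (cost n A)}"
      unfolding eventually_inf_principal using bound by eventually_elim (use that in blast)
  qed simp
  from this[of cost_empirical] this[of "\<lambda>n. cost_population n (p n) (q n)"] show ?thesis by simp
qed

end
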